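(* Let $r\in[2,\infty)$, let $(f_j)_{j=1}^\infty$ be an orthonormal system in $L^2(\mathbb{R})$ and let $\gamma_0=\sum_{j=1}^\infty \lambda_j |f_j\rangle\langle f_j|\in\mathfrak{S}^2(L^2(\mathbb{R}))$, where $\lambda_j\in\mathbb{C}$ and $\|\gamma_0\|_{\mathfrak{S}^2}=\left(\sum_{j=1}^\infty|\lambda_j|^2\right)^{1/2}<\infty$. For $t,x\in\mathbb{R}$ and $(\omega,\widetilde\omega)\in\Omega\times\widetilde\Omega$ put $$F(t,x,\omega,\widetilde\omega)=\sum_{j=1}^\infty \lambda_j\, g_j^{(2)}(\widetilde\omega)\left(|f_j^\omega(x)|^2-|(U(t)f_j^\omega)(x)|^2\right).$$ Then there is a constant $C>0$, independent of $r,\epsilon,x,t$, such that the following hold. (i) For every $0<\epsilon\le 1$, there exists $\delta$ with $0<\delta\le M_2^{-4}\epsilon^6$ such that for all $|t|<\delta$ and all $x\in\mathbb{R}$, $$\|F(t,x,\omega,\widetilde\omega)\|_{L^r_{\omega,\widetilde\omega}(\Omega\times\widetilde\Omega)}\le C r^{3/2}\epsilon^2\left(\|\gamma_0\|_{\mathfrak{S}^2}+1\right).$$ (ii) Moreover, for every $0<\epsilon\le1$, setting $\alpha_1=\left(\|\gamma_0\|_{\mathfrak{S}^2}+1\right)e\,\epsilon^{1/2}\left(\epsilon\ln\frac1\epsilon\right)^{3/2}$, one has $$\lim_{t\to0}(\mathbb{P}\otimes\widetilde{\mathbb{P}})\left(\left\{(\omega,\widetilde\omega)\in\Omega\times\widetilde\Omega:\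 |F(t,x,\omega,\widetilde\omega)|>C\alpha_1\right\}\right)=0,$$ independently of $x$ (that is, uniformly in $x\in\mathbb{R}$).
   Context: Fourier transform: $\mathscr{F}_xf(\xi)=\frac1{\sqrt{2\pi}}\int_{\mathbb{R}}e^{-ix\xi}f(x)\,dx$. With $\phi(\xi)=\xi^3+\xi^{-1}$, set $$U(t)f(x)=e^{-t(\partial_x^3+\partial_x^{-1})}f(x)=\frac1{\sqrt{2\pi}}\int_{\mathbb{R}}e^{ix\xi}e^{it\phi(\xi)}\mathscr{F}_xf(\xi)\,d\xi .$$ Notation: $|u\rangle\langle v|$ is the operator $f\mapsto\langle v,f\rangle u$ with $\langle v,f\rangle=\int\overline v f\,dx$; $\mathfrak{S}^2$ is the Hilbert-Schmidt class. Randomization: $\psi\in C_c^\infty(\mathbb{R})$ is a fixed real-valued, even, non-negative bump function supported in $[-1,1]$ with $\sum_{k\in\mathbb{Z}}\psi(\xi-k)=1$ for all $\xi\in\mathbb{R}$, and $(\psi(D-k)f)(x)=\int_{\mathbb{R}}e^{ix\xi}\psi(\xi-k)\mathscr{F}_xf(\xi)\,d\xi$. $(\Omega,\mathcal{A},\mathbb{P})$ and $(\widetilde\Omega,\widetilde{\mathcal{A}},\widetilde{\mathbb{P}})$ are two probability spaces, carrying respectively sequences $\{g_k^{(1)}(\omega)\}_{k\in\mathbb{Z}}$ and $\{g_j^{(2)}(\widetilde\omega)\}_{j\ge1}$ of independent, zero-mean, real-valued random variables with distributions $\mu_k^1$ and $\mu_j^2$, such that for some $c>0$ (independent of $k,j,\gamma$),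 $\left|\int_{-\infty}^{\infty}e^{\gamma x}d\mu_k^1(x)\right|\le e^{c\gamma^2}$ and $\left|\int_{-\infty}^{\infty}e^{\gamma x}d\mu_j^2(x)\right|\le e^{c\gamma^2}$ for all $\gamma\in\mathbb{R}$, $k\in\mathbb{Z}$, $j\ge1$. For $f_j\in L^2(\mathbb{R})$, $$f_j^\omega=\sum_{k\in\mathbb{Z}}g_k^{(1)}(\omega)\,\psi(D-k)f_j,\qquad U(t)f_j^\omega=\sum_{k\in\mathbb{Z}}g_k^{(1)}(\omega)\,U(t)\psi(D-k)f_j .$$ The random series are understood, for fixed $x$ and $t$, as limits in $L^r$ of the corresponding probability space. $\|\cdot\|_{L^r_{\omega,\widetilde\omega}}$ is the $L^r$ norm with respect to $\mathbb{P}\otimes\widetilde{\mathbb{P}}$. The constant $M_2$: given $0<\epsilon\le1$, $(\lambda_j)_j$ and $(f_j)_j$, choose a positive integer $M_1$ with $\left(\sum_{j=M_1+1}^\infty|\lambda_j|^2\right)^{1/2}<\epsilon^2/2$, and then $M_2\ge2026$ (depending on $\epsilon$, $M_1$ and $f_1,\dots,f_{M_1}$) such that $\left(\sum_{|k|\ge M_2}\|\psi(\xi-k)\mathscr{F}_xf_j\|_{L^2_\xi}^2\right)^{1/2}\le\epsilon^2/2$ for all $1\le j\le M_1$.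
   Formalization: Part (ii) is stated for 0 < ε < 1 instead of 0 < ε ≤ 1: at ε = 1 one has α_1 = 0, and the claim that the probability of |F| > 0 tends to 0 fails, e.g. for λ_1 = 1, other λ_j = 0, Rademacher variables and f_1 with nonnegative continuous Fourier transform supported in (0,1/2). *)

theory Defs
  imports "HOL-Probability.Probability"
begin

section \<open>Lebesgue spaces\<close>

text \<open>
  Elements of \<open>L\<^sup>p\<close> are represented by measurable functions; equality in \<open>L\<^sup>p\<close> is equality almost
  everywhere.  Since the Bochner integral of a non-integrable function is \<open>0\<close>, \<open>norm_Lp M p f\<close> is
  meaningful only for \<open>f \<in> Lp M p\<close>.
\<close>

definition Lp :: "'a measure \<Rightarrow> real \<Rightarrow> ('a \<Rightarrow> complex) set" where
  "Lp M p = {f \<in> borel_measurable M. integrable M (\<lambda>x. cmod (f x) powr p)}"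

definition norm_Lp :: "'a measure \<Rightarrow> real \<Rightarrow> ('a \<Rightarrow> complex) \<Rightarrow> real" where
  "norm_Lp M p f = (LINT x|M. cmod (f x) powr p) powr (1 / p)"

definition tendsto_Lp ::
  "'a measure \<Rightarrow> real \<Rightarrow> ('i \<Rightarrow> 'a \<Rightarrow> complex) \<Rightarrow> ('a \<Rightarrow> complex) \<Rightarrow> 'i filter \<Rightarrow> bool" where
  "tendsto_Lp M p X Y F \<longleftrightarrow>
     Y \<in> Lp M p \<and> (\<forall>\<^sub>F n in F. X n \<in> Lp M p) \<and>
     ((\<lambda>n. norm_Lp M p (\<lambda>x. X n x - Y x)) \<longlongrightarrow> 0) F"

text \<open>A representative of the limit, which is unique up to null sets; unspecified if \<open>X\<close> diverges.\<close>

definition lim_Lp :: "'a measure \<Rightarrow> real \<Rightarrow> 'i filter \<Rightarrow> ('i \<Rightarrow> 'a \<Rightarrow> complex) \<Rightarrow> 'a \<Rightarrow> complex" where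
  "lim_Lp M p F X = (SOME Y. tendsto_Lp M p X Y F)"

abbreviation L2 :: "(real \<Rightarrow> complex) set" where
  "L2 \<equiv> Lp lborel 2"

abbreviation norm_L2 :: "(real \<Rightarrow> complex) \<Rightarrow> real" where
  "norm_L2 \<equiv> norm_Lp lborel 2"

definition inner_L2 :: "(real \<Rightarrow> complex) \<Rightarrow> (real \<Rightarrow> complex) \<Rightarrow> complex" where
  "inner_L2 v f = (LINT x|lborel. cnj (v x) * f x)"


section \<open>Hilbert--Schmidt operators on \<open>L\<^sup>2(\<real>)\<close>\<close>

definition rank_one ::
  "(real \<Rightarrow> complex) \<Rightarrow> (real \<Rightarrow> complex) \<Rightarrow> (real \<Rightarrow> complex) \<Rightarrow> real \<Rightarrow> complex" where
  "rank_one u v f = (\<lambda>x. inner_L2 v f * u x)"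

definition orthonormal_basis :: "(real \<Rightarrow> complex) set \<Rightarrow> bool" where
  "orthonormal_basis E \<longleftrightarrow>
     E \<subseteq> L2 \<and>
     (\<forall>u\<in>E. \<forall>v\<in>E. inner_L2 u v = (if u = v then 1 else 0)) \<and>
     (\<forall>h\<in>L2. (\<forall>u\<in>E. inner_L2 u h = 0) \<longrightarrow> (AE x in lborel. h x = 0))"

text \<open>The class and the norm below do not depend on the choice of this basis.\<close>

definition basis_L2 :: "(real \<Rightarrow> complex) set" where
  "basis_L2 = (SOME E. orthonormal_basis E)"

definition bounded_operator_L2 :: "((real \<Rightarrow> complex) \<Rightarrow> real \<Rightarrow> complex) \<Rightarrow> bool" where
  "bounded_operator_L2 A \<longleftrightarrow>
     (\<forall>h\<in>L2. A h \<in> L2) \<and>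
     (\<forall>g\<in>L2. \<forall>h\<in>L2. \<forall>a b.
        AE x in lborel. A (\<lambda>y. a * g y + b * h y) x = a * A g x + b * A h x) \<and>
     (\<exists>K. \<forall>h\<in>L2. norm_L2 (A h) \<le> K * norm_L2 h)"

definition hilbert_schmidt :: "((real \<Rightarrow> complex) \<Rightarrow> real \<Rightarrow> complex) \<Rightarrow> bool" where
  "hilbert_schmidt A \<longleftrightarrow>
     bounded_operator_L2 A \<and> (\<lambda>u. (norm_L2 (A u))\<^sup>2) summable_on basis_L2"

definition norm_HS :: "((real \<Rightarrow> complex) \<Rightarrow> real \<Rightarrow> complex) \<Rightarrow> real" where
  "norm_HS A = sqrt (\<Sum>\<^sub>\<infinity>u\<in>basis_L2. (norm_L2 (A u))\<^sup>2)"

text \<open>\<open>A = \<Sum>\<^sub>j\<^sub>\<ge>\<^sub>1 \<lambda>\<^sub>j |f\<^sub>j\<rangle>\<langle>f\<^sub>j|\<close>, with the series converging strongly; this determines \<open>A\<close>.\<close>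

definition is_diagonal_sum ::
  "((real \<Rightarrow> complex) \<Rightarrow> real \<Rightarrow> complex) \<Rightarrow> (nat \<Rightarrow> complex) \<Rightarrow> (nat \<Rightarrow> real \<Rightarrow> complex) \<Rightarrow> bool" where
  "is_diagonal_sum A lam f \<longleftrightarrow>
     (\<forall>h\<in>L2. tendsto_Lp lborel 2 (\<lambda>n x. \<Sum>j=1..n. lam j * rank_one (f j) (f j) h x) (A h) sequentially)"


section \<open>Fourier transform and the linear flow\<close>

definition fourier_L1 :: "(real \<Rightarrow> complex) \<Rightarrow> real \<Rightarrow> complex" where
  "fourier_L1 f \<xi> =
     complex_of_real (1 / sqrt (2 * pi)) *
     (LINT x|lborel. exp (- (\<i> * complex_of_real (x * \<xi>))) * f x)"

text \<open>The Fourier--Plancherel transform on \<open>L\<^sup>2\<close>, as the \<open>L\<^sup>2\<close> limit of transforms of truncations.\<close>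

definition fourier :: "(real \<Rightarrow> complex) \<Rightarrow> real \<Rightarrow> complex" where
  "fourier f = lim_Lp lborel 2 at_top (\<lambda>R::real. fourier_L1 (\<lambda>x. indicator {-R..R} x * f x))"

definition phi :: "real \<Rightarrow> real" where
  "phi \<xi> = \<xi> ^ 3 + inverse \<xi>"

text \<open>
  The integral converges absolutely when \<open>fourier f\<close> is integrable, which covers all uses below:
  there \<open>fourier f\<close> is square integrable with compact support, so that \<open>flow t f x\<close> is defined
  for every \<open>x\<close>.
\<close>

definition flow :: "real \<Rightarrow> (real \<Rightarrow> complex) \<Rightarrow> real \<Rightarrow> complex" where
  "flow t f x =
     complex_of_real (1 / sqrt (2 * pi)) *
     (LINT \<xi>|lborel. exp (\<i> * complex_of_real (x * \<xi>)) * exp (\<i> * complex_of_real (t * phi \<xi>)) * fourier f \<xi>)"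


section \<open>Randomization\<close>

definition partition_bump :: "(real \<Rightarrow> real) \<Rightarrow> bool" where
  "partition_bump \<psi> \<longleftrightarrow>
     (\<forall>n x. (deriv ^^ n) \<psi> differentiable (at x)) \<and>
     (\<forall>\<xi>. \<psi> (- \<xi>) = \<psi> \<xi>) \<and>
     (\<forall>\<xi>. 0 \<le> \<psi> \<xi>) \<and>
     (\<forall>\<xi>. \<psi> \<xi> \<noteq> 0 \<longrightarrow> \<xi> \<in> {-1..1}) \<and>
     (\<forall>\<xi>. ((\<lambda>k::int. \<psi> (\<xi> - of_int k)) has_sum 1) UNIV)"

text \<open>The operator \<open>\<psi>(D - k)\<close>; the factor \<open>1 / sqrt (2 * pi)\<close> is absent by convention.\<close>

definition freq_proj :: "(real \<Rightarrow> real) \<Rightarrow> int \<Rightarrow> (real \<Rightarrow> complex) \<Rightarrow> real \<Rightarrow> complex" where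
  "freq_proj \<psi> k f x =
     (LINT \<xi>|lborel. exp (\<i> * complex_of_real (x * \<xi>)) * complex_of_real (\<psi> (\<xi> - of_int k)) * fourier f \<xi>)"

definition subgaussian_family :: "'a measure \<Rightarrow> 'i set \<Rightarrow> ('i \<Rightarrow> 'a \<Rightarrow> real) \<Rightarrow> real \<Rightarrow> bool" where
  "subgaussian_family M I g c \<longleftrightarrow>
     prob_space.indep_vars M (\<lambda>_. borel) g I \<and>
     (\<forall>k\<in>I. integrable M (g k) \<and> (LINT w|M. g k w) = 0) \<and>
     (\<forall>k\<in>I. \<forall>s::real.
        integrable (distr M borel (g k)) (\<lambda>x. exp (s * x)) \<and>
        \<bar>LINT x|distr M borel (g k). exp (s * x)\<bar> \<le> exp (c * s\<^sup>2))"

text \<open>\<open>\<Sum>\<^sub>k\<^sub>\<in>\<^sub>\<int> g\<^sub>k a\<^sub>k\<close> as an unordered series in \<open>L\<^sup>r(M)\<close>.\<close>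

definition random_series ::
  "'a measure \<Rightarrow> real \<Rightarrow> (int \<Rightarrow> 'a \<Rightarrow> real) \<Rightarrow> (int \<Rightarrow> complex) \<Rightarrow> 'a \<Rightarrow> complex" where
  "random_series M r g a =
     lim_Lp M r (finite_subsets_at_top UNIV) (\<lambda>K w. \<Sum>k\<in>K. complex_of_real (g k w) * a k)"

definition randomized ::
  "'a measure \<Rightarrow> real \<Rightarrow> (real \<Rightarrow> real) \<Rightarrow> (int \<Rightarrow> 'a \<Rightarrow> real) \<Rightarrow> (real \<Rightarrow> complex) \<Rightarrow> real \<Rightarrow> 'a \<Rightarrow> complex" where
  "randomized M r \<psi> g f x = random_series M r g (\<lambda>k. freq_proj \<psi> k f x)"

definition flow_randomized ::
  "'a measure \<Rightarrow> real \<Rightarrow> (real \<Rightarrow> real) \<Rightarrow> (int \<Rightarrow> 'a \<Rightarrow> real) \<Rightarrow> real \<Rightarrow> (real \<Rightarrow> complex) \<Rightarrow> real \<Rightarrow> 'a \<Rightarrow> complex" where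
  "flow_randomized M r \<psi> g t f x = random_series M r g (\<lambda>k. flow t (freq_proj \<psi> k f) x)"

text \<open>
  The random density difference \<open>F(t,x,\<omega>,\<omega>')\<close>.  For fixed \<open>t\<close> and \<open>x\<close> it is determined up to null
  sets of the product space, and up to null sets it does not depend on the exponent \<open>r\<close>.
\<close>

definition density_diff ::
  "'a measure \<Rightarrow> 'b measure \<Rightarrow> real \<Rightarrow> (real \<Rightarrow> real) \<Rightarrow> (int \<Rightarrow> 'a \<Rightarrow> real) \<Rightarrow> (nat \<Rightarrow> 'b \<Rightarrow> real) \<Rightarrow>
   (nat \<Rightarrow> complex) \<Rightarrow> (nat \<Rightarrow> real \<Rightarrow> complex) \<Rightarrow> real \<Rightarrow> real \<Rightarrow> 'a \<times> 'b \<Rightarrow> complex" where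
  "density_diff P Q r \<psi> g1 g2 lam f t x =
     lim_Lp (P \<Otimes>\<^sub>M Q) r sequentially
       (\<lambda>n (\<omega>, \<omega>'). \<Sum>j=1..n. lam j * complex_of_real (g2 j \<omega>') *
          complex_of_real ((cmod (randomized P r \<psi> g1 (f j) x \<omega>))\<^sup>2
                         - (cmod (flow_randomized P r \<psi> g1 t (f j) x \<omega>))\<^sup>2))"


section \<open>Parameters of the estimates\<close>

text \<open>Admissible choices of \<open>M\<^sub>1\<close> and \<open>M\<^sub>2\<close> for given \<open>\<epsilon>\<close>, \<open>\<lambda>\<close> and \<open>f\<close>.\<close>

definition admissible_cutoffs ::
  "(real \<Rightarrow> real) \<Rightarrow> (nat \<Rightarrow> complex) \<Rightarrow> (nat \<Rightarrow> real \<Rightarrow> complex) \<Rightarrow> real \<Rightarrow> nat \<Rightarrow> real \<Rightarrow> bool" where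
  "admissible_cutoffs \<psi> lam f \<epsilon> M1 M2 \<longleftrightarrow>
     1 \<le> M1 \<and>
     sqrt (\<Sum>\<^sub>\<infinity>j\<in>{M1+1..}. (cmod (lam j))\<^sup>2) < \<epsilon>\<^sup>2 / 2 \<and>
     2026 \<le> M2 \<and>
     (\<forall>j\<in>{1..M1}.
        sqrt (\<Sum>\<^sub>\<infinity>k\<in>{k::int. M2 \<le> \<bar>real_of_int k\<bar>}.
                (norm_L2 (\<lambda>\<xi>. complex_of_real (\<psi> (\<xi> - of_int k)) * fourier (f j) \<xi>))\<^sup>2) \<le> \<epsilon>\<^sup>2 / 2)"

text \<open>The threshold \<open>\<alpha>\<^sub>1\<close> as a function of \<open>\<parallel>\<gamma>\<^sub>0\<parallel>\<close> and \<open>\<epsilon>\<close>.  It vanishes at \<open>\<epsilon> = 1\<close>.\<close>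

definition alpha1 :: "real \<Rightarrow> real \<Rightarrow> real" where
  "alpha1 N \<epsilon> = (N + 1) * exp 1 * \<epsilon> powr (1/2) * (\<epsilon> * ln (1 / \<epsilon>)) powr (3/2)"

end

theory Submission
  imports Defs
begin

text \<open>
  Write \<open>h\<^sub>j\<close> for the Fourier transform of \<open>f\<^sub>j\<close>.  The \<open>k\<close>-th coefficient of the random series
  \<open>f\<^sub>j\<^sup>\<omega>(x)\<close> is the wave packet \<open>\<integral> e\<^sup>i\<^sup>x\<^sup>\<xi> \<psi>(\<xi> - k) h\<^sub>j(\<xi>) d\<xi>\<close>, and the flow only replaces \<open>h\<^sub>j\<close> by
  \<open>e\<^sup>i\<^sup>t\<^sup>\<phi> h\<^sub>j\<close>.  Because the window of \<open>\<psi>(\<cdot> - k)\<close> has length 2 and \<open>\<Sum>\<^sub>k \<psi>(\<cdot> - k)\<^sup>2 \<le> 1\<close>, the squares of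
  the packets of a function \<open>u\<close> add up to at most \<open>2 \<parallel>u\<parallel>\<^sup>2\<close>, whatever \<open>x\<close> is (\<open>sum_packets_le\<close>).  This
  is the source of the uniformity in \<open>x\<close>.

  Subgaussian variables satisfy Khinchine's inequality in every \<open>L\<^sup>p\<close> (\<open>khinchine\<close>).  Hence
  \<open>f\<^sub>j\<^sup>\<omega>(x)\<close> and \<open>U(t) f\<^sub>j\<^sup>\<omega>(x)\<close> have bounded moments, their difference has moments controlled by the
  energy \<open>D\<^sub>j(t) = \<parallel>h\<^sub>j - e\<^sup>i\<^sup>t\<^sup>\<phi> h\<^sub>j\<parallel>\<^sup>2\<close>, and by Cauchy--Schwarz the \<open>r\<close>-th moment of the difference of
  the two densities is at most a constant times \<open>D\<^sub>j(t)\<^sup>r\<^sup>/\<^sup>2\<close> (\<open>moment_orbital_density_le\<close>).  A second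
  use of Khinchine's inequality, for the variables attached to the orbitals, followed by Jensen's
  inequality with the weights \<open>|\<lambda>\<^sub>j|\<^sup>2\<close>, bounds the \<open>r\<close>-th moment of \<open>F(t,x)\<close> by a constant times
  \<open>\<Sum>\<^sub>j |\<lambda>\<^sub>j|\<^sup>2 D\<^sub>j(t)\<^sup>r\<^sup>/\<^sup>2\<close> (\<open>tendsto_Lp_random_sum\<close>).

  Each \<open>D\<^sub>j(t)\<close> tends to 0 with \<open>t\<close> and is at most 4, as \<open>\<parallel>f\<^sub>j\<parallel> = 1\<close>, so by dominated convergence this bound, which does
  not involve \<open>x\<close>, tends to 0 (\<open>density_diff_moment_tendsto\<close>).  In (i) the right-hand side is a fixed
  positive number once \<open>r\<close> and \<open>\<epsilon>\<close> are given, and \<open>\<delta>\<close> is chosen after them; so the bound holds for all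
  small \<open>t\<close>, already with \<open>C = 1\<close>.  Part (ii) is Chebyshev's inequality, as \<open>\<alpha>\<^sub>1 > 0\<close> for \<open>0 < \<epsilon> < 1\<close>.

  All objects are defined as limits in \<open>L\<^sup>p\<close>, so their existence has to be proved as well: this needs
  the completeness of \<open>L\<^sup>p\<close> (\<open>Lp_complete\<close>), the Plancherel bound that makes the Fourier transform exist
  on \<open>L\<^sup>2\<close> (\<open>tendsto_fourier\<close>), and the inversion formula (\<open>fourier_inversion\<close>), since the flow applies the
  Fourier transform to the inverse transform \<open>\<psi>(D - k) f\<^sub>j\<close>.
\<close>

section \<open>Moments and convergence in \<open>L\<^sup>p\<close>\<close>

text \<open>
  The \<open>p\<close>-th moment takes the value \<open>\<infinity>\<close> where the Bochner integral in the norm would be 0, so estimates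
  can be chained before integrability is known.
\<close>

definition moment :: "'a measure \<Rightarrow> real \<Rightarrow> ('a \<Rightarrow> complex) \<Rightarrow> ennreal" where
  "moment M p X = (\<integral>\<^sup>+ x. ennreal (cmod (X x) powr p) \<partial>M)"

lemma Lp_iff_moment: "X \<in> Lp M p \<longleftrightarrow> X \<in> borel_measurable M \<and> moment M p X < \<infinity>"
  unfolding Lp_def moment_def by (auto simp: integrable_iff_bounded)

lemma integral_eq_moment:
  assumes "X \<in> borel_measurable M"
  shows "(LINT x|M. cmod (X x) powr p) = enn2real (moment M p X)"
  unfolding moment_def using assms by (intro integral_eq_nn_integral) auto

lemma norm_Lp_eq_moment:
  assumes "X \<in> borel_measurable M"
  shows "norm_Lp M p X = enn2real (moment M p X) powr (1 / p)"
  unfolding norm_Lp_def integral_eq_moment[OF assms] ..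

lemma moment_diff_commute: "moment M p (\<lambda>x. X x - Y x) = moment M p (\<lambda>x. Y x - X x)"
  unfolding moment_def by (simp add: norm_minus_commute)

text \<open>
  This crude convexity bound replaces Minkowski's inequality: only the topology of \<open>L\<^sup>p\<close> matters below,
  so the factor \<open>2\<^sup>p\<close> is harmless, and it spares the distinction between \<open>p < 1\<close> and \<open>p \<ge> 1\<close>.
\<close>

lemma powr_add_le:
  fixes a b p :: real
  assumes "0 \<le> a" "0 \<le> b" "0 \<le> p"
  shows "(a + b) powr p \<le> 2 powr p * (a powr p + b powr p)"
proof -
  have "(a + b) powr p \<le> (2 * max a b) powr p"
    using assms by (intro powr_mono2) auto
  also have "\<dots> = 2 powr p * max a b powr p"
    using assms by (simp add: powr_mult)
  also have "max a b powr p \<le> a powr p + b powr p"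
    by (auto simp: max_def)
  finally show ?thesis by simp
qed

lemma moment_add_le:
  assumes [measurable]: "X \<in> borel_measurable M" "Y \<in> borel_measurable M" and "0 \<le> p"
  shows "moment M p (\<lambda>x. X x + Y x) \<le> ennreal (2 powr p) * (moment M p X + moment M p Y)"
proof -
  have "ennreal (cmod (X x + Y x) powr p) \<le>
      ennreal (2 powr p) * (ennreal (cmod (X x) powr p) + ennreal (cmod (Y x) powr p))" for x
  proof -
    have "cmod (X x + Y x) powr p \<le> (cmod (X x) + cmod (Y x)) powr p"
      using assms by (intro powr_mono2 norm_triangle_ineq) auto
    also have "\<dots> \<le> 2 powr p * (cmod (X x) powr p + cmod (Y x) powr p)"
      using assms by (intro powr_add_le) auto
    finally show ?thesis
      by (simp add: ennreal_mult'[symmetric] ennreal_plus[symmetric] del: ennreal_plus)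
  qed
  then have "moment M p (\<lambda>x. X x + Y x) \<le>
      (\<integral>\<^sup>+ x. ennreal (2 powr p) * (ennreal (cmod (X x) powr p) + ennreal (cmod (Y x) powr p)) \<partial>M)"
    unfolding moment_def by (intro nn_integral_mono) auto
  also have "\<dots> = ennreal (2 powr p) * (moment M p X + moment M p Y)"
    unfolding moment_def by (simp add: nn_integral_cmult nn_integral_add)
  finally show ?thesis .
qed

lemma moment_uminus: "moment M p (\<lambda>x. - X x) = moment M p X"
  unfolding moment_def by simp

lemma moment_diff_le:
  assumes [measurable]: "X \<in> borel_measurable M" "Y \<in> borel_measurable M" and "0 \<le> p"
  shows "moment M p (\<lambda>x. X x - Y x) \<le> ennreal (2 powr p) * (moment M p X + moment M p Y)"
  using moment_add_le[of X M "\<lambda>x. - Y x" p] assms by (simp add: moment_uminus)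

lemma Lp_diff: "X \<in> Lp M p \<Longrightarrow> Y \<in> Lp M p \<Longrightarrow> 0 \<le> p \<Longrightarrow> (\<lambda>x. X x - Y x) \<in> Lp M p"
  unfolding Lp_iff_moment
  by (auto intro!: le_less_trans[OF moment_diff_le] simp: ennreal_mult_less_top)

lemma tendsto_Lp_iff_moment:
  assumes "0 < p"
  shows "tendsto_Lp M p X Y F \<longleftrightarrow>
    Y \<in> Lp M p \<and> (\<forall>\<^sub>F i in F. X i \<in> Lp M p) \<and> ((\<lambda>i. moment M p (\<lambda>x. X i x - Y x)) \<longlongrightarrow> 0) F"
proof -
  have "((\<lambda>i. norm_Lp M p (\<lambda>x. X i x - Y x)) \<longlongrightarrow> 0) F \<longleftrightarrow>
      ((\<lambda>i. moment M p (\<lambda>x. X i x - Y x)) \<longlongrightarrow> 0) F"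
    if "Y \<in> Lp M p" and ev: "\<forall>\<^sub>F i in F. X i \<in> Lp M p"
  proof -
    let ?m = "\<lambda>i. moment M p (\<lambda>x. X i x - Y x)"
    have fin: "\<forall>\<^sub>F i in F. (\<lambda>x. X i x - Y x) \<in> Lp M p"
      using ev by eventually_elim (use that assms in \<open>auto intro: Lp_diff\<close>)
    have eq: "\<forall>\<^sub>F i in F. norm_Lp M p (\<lambda>x. X i x - Y x) = enn2real (?m i) powr (1 / p)"
      using fin by eventually_elim (auto simp: Lp_iff_moment norm_Lp_eq_moment)
    have eq2: "\<forall>\<^sub>F i in F. ennreal (enn2real (?m i)) = ?m i"
      using fin by eventually_elim (auto simp: Lp_iff_moment)
    have "((\<lambda>i. norm_Lp M p (\<lambda>x. X i x - Y x)) \<longlongrightarrow> 0) F \<longleftrightarrow>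
        ((\<lambda>i. enn2real (?m i) powr (1 / p)) \<longlongrightarrow> 0) F"
      by (intro tendsto_cong eq)
    also have "\<dots> \<longleftrightarrow> ((\<lambda>i. enn2real (?m i)) \<longlongrightarrow> 0) F"
    proof
      assume "((\<lambda>i. enn2real (?m i) powr (1 / p)) \<longlongrightarrow> 0) F"
      then have "((\<lambda>i. (enn2real (?m i) powr (1 / p)) powr p) \<longlongrightarrow> 0 powr p) F"
        using assms by (intro tendsto_powr') auto
      then show "((\<lambda>i. enn2real (?m i)) \<longlongrightarrow> 0) F"
        using assms by (simp add: powr_powr)
    next
      assume "((\<lambda>i. enn2real (?m i)) \<longlongrightarrow> 0) F"
      then have "((\<lambda>i. enn2real (?m i) powr (1 / p)) \<longlongrightarrow> 0 powr (1 / p)) F"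
        using assms by (intro tendsto_powr') auto
      then show "((\<lambda>i. enn2real (?m i) powr (1 / p)) \<longlongrightarrow> 0) F" by simp
    qed
    also have "\<dots> \<longleftrightarrow> ((\<lambda>i. ennreal (enn2real (?m i))) \<longlongrightarrow> ennreal 0) F"
      by (subst tendsto_ennreal_iff) auto
    also have "\<dots> \<longleftrightarrow> (?m \<longlongrightarrow> 0) F"
      using tendsto_cong[OF eq2] by simp
    finally show ?thesis .
  qed
  then show ?thesis unfolding tendsto_Lp_def by blast
qed

lemma lim_Lp_eq:
  assumes "tendsto_Lp M p X Y F"
  shows "tendsto_Lp M p X (lim_Lp M p F X) F"
  unfolding lim_Lp_def by (rule someI[of "\<lambda>Y. tendsto_Lp M p X Y F", OF assms])

text \<open>
  The sum of all \<open>|Z\<^sub>n|\<^sup>p\<close> has finite integral, so it converges almost everywhere and its terms vanish.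
\<close>

lemma AE_tendsto_zero_of_summable_moments:
  fixes Z :: "nat \<Rightarrow> 'a \<Rightarrow> complex"
  assumes [measurable]: "\<And>n. Z n \<in> borel_measurable M" and "0 < p"
    and bound: "\<And>n. moment M p (Z n) \<le> ennreal ((1/2) ^ n)"
  shows "AE x in M. (\<lambda>n. Z n x) \<longlonglongrightarrow> 0"
proof -
  have "(\<integral>\<^sup>+ x. (\<Sum>n. ennreal (cmod (Z n x) powr p)) \<partial>M) = (\<Sum>n. moment M p (Z n))"
    unfolding moment_def by (intro nn_integral_suminf) auto
  also have "\<dots> \<le> (\<Sum>n. ennreal ((1/2) ^ n))"
    by (intro suminf_le bound) auto
  also have "\<dots> = ennreal (\<Sum>n. (1/2) ^ n)"
    by (intro suminf_ennreal2) auto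
  also have "\<dots> < \<infinity>" by simp
  finally have "AE x in M. (\<Sum>n. ennreal (cmod (Z n x) powr p)) \<noteq> \<infinity>"
    by (intro nn_integral_PInf_AE) auto
  then show ?thesis
  proof eventually_elim
    case (elim x)
    then have "summable (\<lambda>n. cmod (Z n x) powr p)"
      by (intro summable_suminf_not_top) auto
    then have "(\<lambda>n. cmod (Z n x) powr p) \<longlonglongrightarrow> 0" by (rule summable_LIMSEQ_zero)
    then have "(\<lambda>n. (cmod (Z n x) powr p) powr (1 / p)) \<longlonglongrightarrow> 0 powr (1 / p)"
      using \<open>0 < p\<close> by (intro tendsto_powr') auto
    then show ?case using \<open>0 < p\<close> by (simp add: powr_powr tendsto_norm_zero_iff)
  qed
qed

text \<open>
  The moments are so small that even the rescaled increments \<open>2\<^sup>n (X\<^sub>n\<^sub>+\<^sub>1 - X\<^sub>n)\<close> tend to 0 almost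
  everywhere; the increments are then dominated by a geometric series.
\<close>

lemma AE_convergent_of_summable_moments:
  fixes X :: "nat \<Rightarrow> 'a \<Rightarrow> complex"
  assumes [measurable]: "\<And>n. X n \<in> borel_measurable M" and "0 < p"
    and bound: "\<And>n. moment M p (\<lambda>x. X (Suc n) x - X n x) \<le> ennreal ((1/2) powr (p * n) * (1/2) ^ n)"
  shows "AE x in M. convergent (\<lambda>n. X n x)"
proof -
  define Z where "Z n x = complex_of_real (2 ^ n) * (X (Suc n) x - X n x)" for n x
  have Z: "moment M p (Z n) \<le> ennreal ((1/2) ^ n)" for n
  proof -
    have "moment M p (Z n) = ennreal (2 powr (p * n)) * moment M p (\<lambda>x. X (Suc n) x - X n x)"
      unfolding moment_def Z_def
      by (subst nn_integral_cmult[symmetric])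
        (auto simp: norm_mult powr_mult ennreal_mult' norm_power powr_realpow[symmetric] powr_powr mult.commute
          intro!: nn_integral_cong)
    also have "\<dots> \<le> ennreal (2 powr (p * n)) * ennreal ((1/2) powr (p * n) * (1/2) ^ n)"
      by (intro mult_left_mono bound) auto
    also have "\<dots> = ennreal ((1/2) ^ n)"
    proof -
      have "2 powr (p * n) * ((1/2) powr (p * n) * (1/2) ^ n) = ((1/2) ^ n :: real)"
        by (simp add: powr_divide)
      then show ?thesis by (simp add: ennreal_mult'[symmetric])
    qed
    finally show ?thesis .
  qed
  have [measurable]: "Z n \<in> borel_measurable M" for n unfolding Z_def[abs_def] by measurable
  have "AE x in M. (\<lambda>n. Z n x) \<longlonglongrightarrow> 0"
    by (rule AE_tendsto_zero_of_summable_moments[OF _ \<open>0 < p\<close> Z]) simp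
  then show ?thesis
  proof eventually_elim
    case (elim x)
    have "\<forall>\<^sub>F n in sequentially. cmod (Z n x) < 1"
      using elim by (auto simp: tendsto_iff dist_norm)
    then have "\<forall>\<^sub>F n in sequentially. cmod (X (Suc n) x - X n x) \<le> (1/2) ^ n"
      by eventually_elim (simp add: Z_def norm_mult norm_power power_divide pos_le_divide_eq mult.commute del: of_real_power)
    then have "summable (\<lambda>n. X (Suc n) x - X n x)"
      by (rule summable_comparison_test_ev) simp
    then obtain l where "(\<lambda>n. \<Sum>i<n. X (Suc i) x - X i x) \<longlonglongrightarrow> l"
      unfolding summable_def sums_def by auto
    then have "(\<lambda>n. (X n x - X 0 x) + X 0 x) \<longlonglongrightarrow> l + X 0 x"
      using sum_lessThan_telescope[of "\<lambda>n. X n x"] by (intro tendsto_add) simp_all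
    then have "(\<lambda>n. X n x) \<longlonglongrightarrow> l + X 0 x" by simp
    then show ?case by (rule convergentI)
  qed
qed

text \<open>
  The filter is arbitrary, since limits along finite subsets, along real truncations and along
  sequences all occur.  A property \<open>Q\<close> that holds eventually can be kept along the sequence.
\<close>

lemma tendsto_Lp_AE_subsequence:
  assumes "tendsto_Lp M p X Y F" "0 < p" "F \<noteq> bot" "\<forall>\<^sub>F i in F. Q i"
  obtains s :: "nat \<Rightarrow> 'i" where "\<And>n. Q (s n)" "\<And>n. X (s n) \<in> Lp M p"
    "AE x in M. (\<lambda>n. X (s n) x) \<longlonglongrightarrow> Y x"
proof -
  have Y: "Y \<in> Lp M p" and ev: "\<forall>\<^sub>F i in F. X i \<in> Lp M p"
    and lim: "((\<lambda>i. moment M p (\<lambda>x. X i x - Y x)) \<longlongrightarrow> 0) F"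
    using assms by (auto simp: tendsto_Lp_iff_moment)
  have "\<exists>i. Q i \<and> X i \<in> Lp M p \<and> moment M p (\<lambda>x. X i x - Y x) < ennreal ((1/2) ^ n)" for n :: nat
  proof -
    have "\<forall>\<^sub>F i in F. moment M p (\<lambda>x. X i x - Y x) < ennreal ((1/2) ^ n)"
      by (rule order_tendstoD(2)[OF lim]) simp
    with ev assms(4) have "\<forall>\<^sub>F i in F. Q i \<and> X i \<in> Lp M p \<and> moment M p (\<lambda>x. X i x - Y x) < ennreal ((1/2) ^ n)"
      by eventually_elim simp
    then show ?thesis by (rule eventually_happens'[OF assms(3)])
  qed
  then obtain s where s: "\<And>n. Q (s n)" "\<And>n. X (s n) \<in> Lp M p"
      "\<And>n. moment M p (\<lambda>x. X (s n) x - Y x) < ennreal ((1/2) ^ n)"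
    by metis
  have "AE x in M. (\<lambda>n. X (s n) x - Y x) \<longlonglongrightarrow> 0"
    using s Y assms(2)
    by (intro AE_tendsto_zero_of_summable_moments[where p=p] borel_measurable_diff)
      (auto simp: Lp_iff_moment less_imp_le)
  then have "AE x in M. (\<lambda>n. X (s n) x) \<longlonglongrightarrow> Y x"
    by eventually_elim (simp add: LIM_zero_iff)
  with s that show ?thesis by blast
qed

lemma moment_Fatou:
  assumes "\<And>n. X n \<in> borel_measurable M" and "0 < q"
    and "AE x in M. (\<lambda>n. X n x) \<longlonglongrightarrow> Y x"
    and "\<And>n. moment M q (X n) \<le> B"
  shows "moment M q Y \<le> B"
proof -
  have "moment M q Y = (\<integral>\<^sup>+ x. liminf (\<lambda>n. ennreal (cmod (X n x) powr q)) \<partial>M)"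
    unfolding moment_def
  proof (intro nn_integral_cong_AE, use assms(3) in eventually_elim)
    case (elim x)
    have "(\<lambda>n. ennreal (cmod (X n x) powr q)) \<longlonglongrightarrow> ennreal (cmod (Y x) powr q)"
      using assms(2) by (intro tendsto_ennrealI tendsto_powr' tendsto_norm elim) auto
    then show ?case by (intro lim_imp_Liminf[symmetric]) auto
  qed
  also have "\<dots> \<le> liminf (\<lambda>n. moment M q (X n))"
    unfolding moment_def using assms(1) by (intro nn_integral_liminf) auto
  also have "\<dots> \<le> B"
    using assms(4) by (intro order_trans[OF Liminf_le_Limsup] Limsup_bounded) auto
  finally show ?thesis .
qed

text \<open>
  The exponents \<open>p\<close> of the convergence and \<open>q\<close> of the bound are unrelated: by Fatou's lemma along an
  almost everywhere convergent sequence, a limit in \<open>L\<^sup>r\<close> inherits the bounds on the moments of order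
  \<open>2r\<close> of its approximants.
\<close>

lemma tendsto_Lp_moment_le:
  assumes "tendsto_Lp M p X Y F" "0 < p" "F \<noteq> bot" "0 < q"
    and "\<forall>\<^sub>F i in F. moment M q (X i) \<le> B"
  shows "moment M q Y \<le> B"
proof -
  obtain s where s: "\<And>n. moment M q (X (s n)) \<le> B" "\<And>n. X (s n) \<in> Lp M p"
    "AE x in M. (\<lambda>n. X (s n) x) \<longlonglongrightarrow> Y x"
    by (rule tendsto_Lp_AE_subsequence[OF assms(1-3,5)]) (rule that; assumption)
  show ?thesis
    by (rule moment_Fatou[OF _ assms(4) s(3,1)]) (use s(2) in \<open>simp add: Lp_iff_moment\<close>)
qed

lemma tendsto_Lp_diff:
  assumes "tendsto_Lp M p X Y F" "tendsto_Lp M p X' Y' F" "0 < p"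
  shows "tendsto_Lp M p (\<lambda>i x. X i x - X' i x) (\<lambda>x. Y x - Y' x) F"
proof -
  let ?m = "\<lambda>i. moment M p (\<lambda>x. X i x - Y x)" and ?m' = "\<lambda>i. moment M p (\<lambda>x. X' i x - Y' x)"
  have 1: "Y \<in> Lp M p \<and> (\<forall>\<^sub>F i in F. X i \<in> Lp M p) \<and> (?m \<longlongrightarrow> 0) F"
    by (rule tendsto_Lp_iff_moment[OF assms(3), THEN iffD1, OF assms(1)])
  note 1 = 1[THEN conjunct1] 1[THEN conjunct2, THEN conjunct1] 1[THEN conjunct2, THEN conjunct2]
  have 2: "Y' \<in> Lp M p \<and> (\<forall>\<^sub>F i in F. X' i \<in> Lp M p) \<and> (?m' \<longlongrightarrow> 0) F"
    by (rule tendsto_Lp_iff_moment[OF assms(3), THEN iffD1, OF assms(2)])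
  note 2 = 2[THEN conjunct1] 2[THEN conjunct2, THEN conjunct1] 2[THEN conjunct2, THEN conjunct2]
  have "\<forall>\<^sub>F i in F. moment M p (\<lambda>x. (X i x - X' i x) - (Y x - Y' x)) \<le> ennreal (2 powr p) * (?m i + ?m' i)"
    using 1(2) 2(2)
  proof eventually_elim
    case (elim i)
    have "moment M p (\<lambda>x. (X i x - Y x) - (X' i x - Y' x)) \<le> ennreal (2 powr p) * (?m i + ?m' i)"
      using elim 1(1) 2(1) assms(3) by (intro moment_diff_le borel_measurable_diff) (simp_all add: Lp_iff_moment)
    then show ?case by (simp add: algebra_simps)
  qed
  moreover have "((\<lambda>i. ennreal (2 powr p) * (?m i + ?m' i)) \<longlongrightarrow> ennreal (2 powr p) * (0 + 0)) F"
    by (intro ennreal_tendsto_cmult tendsto_add 1(3) 2(3)) simp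
  ultimately have "((\<lambda>i. moment M p (\<lambda>x. (X i x - X' i x) - (Y x - Y' x))) \<longlongrightarrow> 0) F"
    using tendsto_sandwich[of "\<lambda>_. 0::ennreal" "\<lambda>i. moment M p (\<lambda>x. (X i x - X' i x) - (Y x - Y' x))" F
      "\<lambda>i. ennreal (2 powr p) * (?m i + ?m' i)" 0] by simp
  moreover have "\<forall>\<^sub>F i in F. (\<lambda>x. X i x - X' i x) \<in> Lp M p"
    using 1(2) 2(2) 
  proof eventually_elim
    case (elim i)
    show ?case by (rule Lp_diff[OF elim]) (use assms(3) in simp)
  qed
  moreover have "(\<lambda>x. Y x - Y' x) \<in> Lp M p"
    by (rule Lp_diff[OF 1(1) 2(1)]) (use assms(3) in simp)
  ultimately show ?thesis unfolding tendsto_Lp_iff_moment[OF assms(3)] by blast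
qed

text \<open>
  Riesz--Fischer along a filter.  The Cauchy condition is stated through sets \<open>B\<close> of the filter: points
  picked from shrinking sets \<open>B\<^sub>n\<close> give a sequence that converges almost everywhere, and Fatou's lemma
  compares its limit with every other member of \<open>B\<^sub>n\<close>.
\<close>

lemma Lp_complete:
  assumes "0 < p" "F \<noteq> bot" and mem: "\<forall>\<^sub>F i in F. X i \<in> Lp M p"
    and cauchy: "\<And>e::real. e > 0 \<Longrightarrow>
      \<exists>B. (\<forall>\<^sub>F i in F. B i) \<and> (\<forall>i j. B i \<longrightarrow> B j \<longrightarrow> moment M p (\<lambda>x. X i x - X j x) \<le> ennreal e)"
  shows "\<exists>Y. tendsto_Lp M p X Y F"
proof -
  define e :: "nat \<Rightarrow> real" where "e n = (1/2) powr (p * n) * (1/2) ^ n" for n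
  have e: "e n > 0" for n by (simp add: e_def)
  have "\<forall>n. \<exists>B. (\<forall>\<^sub>F i in F. B i) \<and> (\<forall>i j. B i \<longrightarrow> B j \<longrightarrow> moment M p (\<lambda>x. X i x - X j x) \<le> ennreal (e n))"
    using cauchy e by blast
  then obtain B where B: "\<And>n. \<forall>\<^sub>F i in F. B n i"
      "\<And>n i j. B n i \<Longrightarrow> B n j \<Longrightarrow> moment M p (\<lambda>x. X i x - X j x) \<le> ennreal (e n)"
    by metis
  have "\<exists>i. X i \<in> Lp M p \<and> (\<forall>m\<le>n. B m i)" for n :: nat
  proof -
    have "\<forall>\<^sub>F i in F. \<forall>m\<in>{..n}. B m i"
      using B(1) by (intro eventually_ball_finite) auto
    with mem have "\<forall>\<^sub>F i in F. X i \<in> Lp M p \<and> (\<forall>m\<le>n. B m i)"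
      by eventually_elim auto
    then show ?thesis by (rule eventually_happens'[OF assms(2)])
  qed
  then obtain s where s: "\<And>n. X (s n) \<in> Lp M p" "\<And>n m. m \<le> n \<Longrightarrow> B m (s n)" by metis
  have [measurable]: "X (s n) \<in> borel_measurable M" for n
    using s by (auto simp: Lp_iff_moment)
  have "AE x in M. convergent (\<lambda>n. X (s n) x)"
  proof (rule AE_convergent_of_summable_moments[OF _ \<open>0 < p\<close>])
    show "moment M p (\<lambda>x. X (s (Suc n)) x - X (s n) x) \<le> ennreal ((1/2) powr (p * n) * (1/2) ^ n)" for n
      using B(2)[of n "s (Suc n)" "s n"] s(2) by (simp add: e_def)
  qed simp
  then have lim: "AE x in M. (\<lambda>n. X (s n) x) \<longlonglongrightarrow> lim (\<lambda>n. X (s n) x)"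
    by eventually_elim (simp add: convergent_LIMSEQ_iff)
  define Y where "Y x = lim (\<lambda>n. X (s n) x)" for x
  have [measurable]: "Y \<in> borel_measurable M" unfolding Y_def by measurable
  have close: "moment M p (\<lambda>x. X i x - Y x) \<le> ennreal (e n)" if "B n i" "X i \<in> Lp M p" for n i
  proof (rule moment_Fatou)
    show "AE x in M. (\<lambda>k. X i x - X (s (k + n)) x) \<longlonglongrightarrow> X i x - Y x"
      using lim unfolding Y_def
      by eventually_elim (rule tendsto_diff[OF tendsto_const LIMSEQ_ignore_initial_segment])
    show "moment M p (\<lambda>x. X i x - X (s (k + n)) x) \<le> ennreal (e n)" for k
      using that s by (intro B) auto
  qed (use that assms in \<open>auto simp: Lp_iff_moment\<close>)
  have "(\<lambda>x. X (s 0) x - Y x) \<in> Lp M p"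
    using close[of 0 "s 0"] s by (auto simp: Lp_iff_moment intro: le_less_trans)
  from Lp_diff[OF s(1)[of 0] this] \<open>0 < p\<close> have Y: "Y \<in> Lp M p" by simp
  have e0: "e \<longlonglongrightarrow> 0"
  proof (rule tendsto_sandwich[OF _ _ tendsto_const LIMSEQ_power_zero[of "1/2::real"]])
    show "\<forall>\<^sub>F n in sequentially. e n \<le> (1/2) ^ n"
    proof (intro always_eventually allI)
      fix n :: nat
      have "(1/2) powr (p * n) \<le> (1::real)"
        using \<open>0 < p\<close> by (intro powr_le1) auto
      then show "e n \<le> (1/2) ^ n"
        unfolding e_def by (intro mult_left_le_one_le) auto
    qed
    show "\<forall>\<^sub>F n in sequentially. 0 \<le> e n"
      by (intro always_eventually allI less_imp_le e)
  qed simp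
  have "((\<lambda>i. moment M p (\<lambda>x. X i x - Y x)) \<longlongrightarrow> 0) F"
  proof (rule order_tendstoI)
    fix a :: ennreal assume "0 < a"
    have "(\<lambda>n. ennreal (e n)) \<longlonglongrightarrow> 0" using tendsto_ennrealI[OF e0] by simp
    then obtain n where n: "ennreal (e n) < a"
      using eventually_happens'[OF _ order_tendstoD(2)[OF _ \<open>0 < a\<close>]] trivial_limit_sequentially by blast
    show "\<forall>\<^sub>F i in F. moment M p (\<lambda>x. X i x - Y x) < a"
      using B(1)[of n] mem by eventually_elim (rule le_less_trans[OF close n])
  qed simp
  with Y mem show ?thesis unfolding tendsto_Lp_iff_moment[OF assms(1)] by blast
qed

section \<open>Khinchine's inequality for subgaussian families\<close>

lemma powr_le_exp:
  fixes x p :: real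
  assumes "0 \<le> x" "0 < p"
  shows "x powr p \<le> p powr p * exp x"
proof -
  have "x / p \<le> exp (x / p)"
    using exp_ge_add_one_self[of "x / p"] by linarith
  then have "(x / p) powr p \<le> exp (x / p) powr p"
    using assms by (intro powr_mono2) auto
  also have "\<dots> = exp x" using assms by (simp add: powr_def)
  finally show ?thesis
    using assms by (simp add: powr_divide pos_divide_le_eq mult.commute)
qed

lemma subgaussian_family_measurable:
  assumes "prob_space M" "subgaussian_family M I g c" "k \<in> I"
  shows "g k \<in> borel_measurable M"
proof -
  interpret prob_space M by fact
  show ?thesis using assms by (auto simp: subgaussian_family_def indep_vars_def)
qed

lemma subgaussian_sum_mgf:
  fixes a :: "'i \<Rightarrow> real"
  assumes "prob_space M" and sub: "subgaussian_family M I g c" and K: "finite K" "K \<subseteq> I"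
  shows "(\<integral>\<^sup>+ w. ennreal (exp (\<Sum>k\<in>K. g k w * a k)) \<partial>M) \<le> ennreal (exp (c * (\<Sum>k\<in>K. (a k)\<^sup>2)))"
proof -
  interpret prob_space M by fact
  have ind: "indep_vars (\<lambda>_. borel) g K"
    using sub K by (auto simp: subgaussian_family_def intro: indep_vars_subset)
  have "indep_vars (\<lambda>_. borel) (\<lambda>k w. ennreal (exp (g k w * a k))) K"
    by (rule indep_vars_compose2[OF ind, where Y="\<lambda>k x. ennreal (exp (x * a k))"]) simp
  then have "(\<integral>\<^sup>+ w. (\<Prod>k\<in>K. ennreal (exp (g k w * a k))) \<partial>M) = (\<Prod>k\<in>K. \<integral>\<^sup>+ w. ennreal (exp (g k w * a k)) \<partial>M)"
    using K by (intro indep_vars_nn_integral) auto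
  also have "\<dots> = (\<Prod>k\<in>K. ennreal (LINT x|distr M borel (g k). exp (a k * x)))"
  proof (rule prod.cong[OF refl])
    fix k assume "k \<in> K"
    then have k: "k \<in> I" using K by auto
    have [measurable]: "g k \<in> borel_measurable M"
      by (rule subgaussian_family_measurable[OF \<open>prob_space M\<close> sub k])
    have int: "integrable (distr M borel (g k)) (\<lambda>x. exp (a k * x))"
      using sub k by (auto simp: subgaussian_family_def)
    have "(\<integral>\<^sup>+ w. ennreal (exp (g k w * a k)) \<partial>M) = (\<integral>\<^sup>+ x. ennreal (exp (a k * x)) \<partial>distr M borel (g k))"
      by (subst nn_integral_distr) (auto simp: mult.commute)
    also have "\<dots> = ennreal (LINT x|distr M borel (g k). exp (a k * x))"
      using int by (intro nn_integral_eq_integral) auto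
    finally show "(\<integral>\<^sup>+ w. ennreal (exp (g k w * a k)) \<partial>M) = ennreal (LINT x|distr M borel (g k). exp (a k * x))" .
  qed
  also have "\<dots> = ennreal (\<Prod>k\<in>K. LINT x|distr M borel (g k). exp (a k * x))"
    by (rule prod_ennreal) simp
  also have "\<dots> \<le> ennreal (\<Prod>k\<in>K. exp (c * (a k)\<^sup>2))"
  proof (intro ennreal_leI prod_mono conjI)
    fix k assume "k \<in> K"
    then have "\<bar>LINT x|distr M borel (g k). exp (a k * x)\<bar> \<le> exp (c * (a k)\<^sup>2)"
      using sub K by (auto simp: subgaussian_family_def)
    then show "(LINT x|distr M borel (g k). exp (a k * x)) \<le> exp (c * (a k)\<^sup>2)" by linarith
  qed simp
  also have "(\<Prod>k\<in>K. exp (c * (a k)\<^sup>2)) = exp (c * (\<Sum>k\<in>K. (a k)\<^sup>2))"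
    using K by (simp add: exp_sum sum_distrib_left)
  finally show ?thesis
    using K by (simp add: prod_ennreal exp_sum)
qed

text \<open>
  After division by \<open>s = (\<Sum>\<^sub>k a\<^sub>k\<^sup>2)\<^sup>1\<^sup>/\<^sup>2\<close> the sum \<open>S\<close> has moment generating function at most \<open>e\<^sup>c\<close> at the points
  \<open>1\<close> and \<open>-1\<close>, and \<open>|S|\<^sup>p \<le> p\<^sup>p (e\<^sup>S + e\<^sup>-\<^sup>S)\<close>.
\<close>

lemma khinchine_real:
  fixes a :: "'i \<Rightarrow> real"
  assumes "prob_space M" and sub: "subgaussian_family M I g c" and K: "finite K" "K \<subseteq> I" and "0 < p"
  shows "(\<integral>\<^sup>+ w. ennreal (\<bar>\<Sum>k\<in>K. g k w * a k\<bar> powr p) \<partial>M)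
    \<le> ennreal (2 * p powr p * exp c * (\<Sum>k\<in>K. (a k)\<^sup>2) powr (p / 2))"
proof (cases "(\<Sum>k\<in>K. (a k)\<^sup>2) = 0")
  case True
  then have "\<forall>k\<in>K. a k = 0" using K by (simp add: sum_nonneg_eq_0_iff)
  then show ?thesis by simp
next
  case False
  define s where "s = sqrt (\<Sum>k\<in>K. (a k)\<^sup>2)"
  have s2: "s\<^sup>2 = (\<Sum>k\<in>K. (a k)\<^sup>2)" unfolding s_def by (simp add: sum_nonneg)
  have "0 \<le> s" unfolding s_def by (simp add: sum_nonneg)
  with False s2 have s: "0 < s" by (cases "s = 0") auto
  have [measurable]: "g k \<in> borel_measurable M" if "k \<in> K" for k
    using K that by (intro subgaussian_family_measurable[OF assms(1,2)]) auto
  have mgf: "(\<integral>\<^sup>+ w. ennreal (exp (\<Sum>k\<in>K. g k w * (u * a k / s))) \<partial>M) \<le> ennreal (exp c)" if "u\<^sup>2 = 1" for u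
  proof -
    have "(\<Sum>k\<in>K. (u * a k / s)\<^sup>2) = (\<Sum>k\<in>K. (a k)\<^sup>2) / s\<^sup>2"
      by (simp add: power_divide power_mult_distrib that sum_divide_distrib)
    also have "\<dots> = 1" using s by (simp add: s2[symmetric])
    finally show ?thesis
      using subgaussian_sum_mgf[OF assms(1,2) K, of "\<lambda>k. u * a k / s"] by simp
  qed
  have "\<bar>\<Sum>k\<in>K. g k w * a k\<bar> powr p \<le> s powr p * p powr p *
      (exp (\<Sum>k\<in>K. g k w * (1 * a k / s)) + exp (\<Sum>k\<in>K. g k w * (-1 * a k / s)))" for w
  proof -
    define S where "S = (\<Sum>k\<in>K. g k w * a k)"
    have S: "(\<Sum>k\<in>K. g k w * (1 * a k / s)) = S / s" "(\<Sum>k\<in>K. g k w * (-1 * a k / s)) = - (S / s)"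
      by (simp_all add: S_def sum_divide_distrib sum_negf)
    have "\<bar>S\<bar> powr p = s powr p * \<bar>S / s\<bar> powr p"
      using s by (simp add: powr_divide)
    also have "\<dots> \<le> s powr p * (p powr p * exp \<bar>S / s\<bar>)"
      using \<open>0 < p\<close> by (intro mult_left_mono powr_le_exp) auto
    also have "\<dots> \<le> s powr p * (p powr p * (exp (S / s) + exp (- (S / s))))"
      by (intro mult_left_mono) (auto simp: abs_if)
    finally show ?thesis unfolding S unfolding S_def by (simp add: mult.assoc)
  qed
  then have "(\<integral>\<^sup>+ w. ennreal (\<bar>\<Sum>k\<in>K. g k w * a k\<bar> powr p) \<partial>M) \<le>
      (\<integral>\<^sup>+ w. ennreal (s powr p * p powr p) * (ennreal (exp (\<Sum>k\<in>K. g k w * (1 * a k / s)))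
        + ennreal (exp (\<Sum>k\<in>K. g k w * (-1 * a k / s)))) \<partial>M)"
    by (intro nn_integral_mono) (simp add: ennreal_mult[symmetric] ennreal_plus[symmetric] del: ennreal_plus)
  also have "\<dots> = ennreal (s powr p * p powr p) *
      ((\<integral>\<^sup>+ w. ennreal (exp (\<Sum>k\<in>K. g k w * (1 * a k / s))) \<partial>M)
        + (\<integral>\<^sup>+ w. ennreal (exp (\<Sum>k\<in>K. g k w * (-1 * a k / s))) \<partial>M))"
    by (simp add: nn_integral_cmult nn_integral_add)
  also have "\<dots> \<le> ennreal (s powr p * p powr p) * (ennreal (exp c) + ennreal (exp c))"
    by (intro mult_left_mono add_mono mgf) auto
  also have "\<dots> = ennreal (s powr p * p powr p * (exp c + exp c))"
    by (simp add: ennreal_mult[symmetric] ennreal_plus[symmetric] del: ennreal_plus)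
  also have "s powr p * p powr p * (exp c + exp c) = 2 * p powr p * exp c * (s\<^sup>2) powr (p / 2)"
    using s by (simp add: powr_powr flip: powr_numeral)
  finally show ?thesis unfolding s2 .
qed

definition khinchine_const :: "real \<Rightarrow> real \<Rightarrow> real" where
  "khinchine_const c p = 2 powr p * (4 * p powr p * exp c)"

lemma khinchine_const_nonneg: "0 \<le> khinchine_const c p"
  by (simp add: khinchine_const_def)

lemma khinchine:
  fixes a :: "'i \<Rightarrow> complex"
  assumes "prob_space M" and sub: "subgaussian_family M I g c" and K: "finite K" "K \<subseteq> I" and "0 < p"
  shows "moment M p (\<lambda>w. \<Sum>k\<in>K. complex_of_real (g k w) * a k)
    \<le> ennreal (khinchine_const c p * (\<Sum>k\<in>K. (cmod (a k))\<^sup>2) powr (p / 2))"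
proof -
  define A where "A = (\<Sum>k\<in>K. (cmod (a k))\<^sup>2)"
  have [measurable]: "g k \<in> borel_measurable M" if "k \<in> K" for k
    using K that by (intro subgaussian_family_measurable[OF assms(1,2)]) auto
  have part: "(\<integral>\<^sup>+ w. ennreal (\<bar>\<Sum>k\<in>K. g k w * b k\<bar> powr p) \<partial>M) \<le> ennreal (2 * p powr p * exp c * A powr (p / 2))"
    if "\<And>k. \<bar>b k\<bar> \<le> cmod (a k)" for b
  proof -
    have "(\<Sum>k\<in>K. (b k)\<^sup>2) \<le> A"
      unfolding A_def using that by (intro sum_mono) (metis abs_ge_zero power2_abs power_mono)
    then have "(\<Sum>k\<in>K. (b k)\<^sup>2) powr (p / 2) \<le> A powr (p / 2)"
      using \<open>0 < p\<close> by (intro powr_mono2) (auto simp: sum_nonneg)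
    then show ?thesis
      by (intro order_trans[OF khinchine_real[OF assms]] ennreal_leI mult_left_mono) auto
  qed
  have "(\<lambda>w. \<Sum>k\<in>K. complex_of_real (g k w) * a k) =
      (\<lambda>w. complex_of_real (\<Sum>k\<in>K. g k w * Re (a k)) + \<i> * complex_of_real (\<Sum>k\<in>K. g k w * Im (a k)))"
    by (rule ext, rule complex_eqI) (simp_all add: Re_sum Im_sum)
  then have "moment M p (\<lambda>w. \<Sum>k\<in>K. complex_of_real (g k w) * a k) \<le> ennreal (2 powr p) *
      (moment M p (\<lambda>w. complex_of_real (\<Sum>k\<in>K. g k w * Re (a k)))
        + moment M p (\<lambda>w. \<i> * complex_of_real (\<Sum>k\<in>K. g k w * Im (a k))))"
    using \<open>0 < p\<close> by (simp only:) (intro moment_add_le; simp)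
  also have "\<dots> \<le> ennreal (2 powr p) * (ennreal (2 * p powr p * exp c * A powr (p / 2)) + ennreal (2 * p powr p * exp c * A powr (p / 2)))"
  proof (intro mult_left_mono add_mono)
    show "moment M p (\<lambda>w. complex_of_real (\<Sum>k\<in>K. g k w * Re (a k))) \<le> ennreal (2 * p powr p * exp c * A powr (p / 2))"
      unfolding moment_def norm_of_real by (rule part) (rule abs_Re_le_cmod)
    show "moment M p (\<lambda>w. \<i> * complex_of_real (\<Sum>k\<in>K. g k w * Im (a k))) \<le> ennreal (2 * p powr p * exp c * A powr (p / 2))"
      unfolding moment_def norm_mult norm_ii mult_1 norm_of_real by (rule part) (rule abs_Im_le_cmod)
  qed simp
  also have "\<dots> = ennreal (khinchine_const c p * A powr (p / 2))"
    by (simp add: khinchine_const_def ennreal_mult[symmetric] ennreal_plus[symmetric] field_simps del: ennreal_plus)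
  finally show ?thesis unfolding A_def .
qed

text \<open>
  The partial sums are Cauchy: two of them that contain a large finite set \<open>K\<^sub>0\<close> differ by a sum, up to
  signs, over their symmetric difference, which misses \<open>K\<^sub>0\<close> and so carries little of \<open>\<Sum>\<^sub>k |a\<^sub>k|\<^sup>2\<close>.
\<close>

lemma tendsto_random_series:
  fixes a :: "int \<Rightarrow> complex"
  assumes "prob_space M" and sub: "subgaussian_family M UNIV g c" and "0 < r"
    and bound: "\<And>K. finite K \<Longrightarrow> (\<Sum>k\<in>K. (cmod (a k))\<^sup>2) \<le> A"
  shows "tendsto_Lp M r (\<lambda>K w. \<Sum>k\<in>K. complex_of_real (g k w) * a k) (random_series M r g a)
    (finite_subsets_at_top UNIV)"
proof -
  let ?S = "\<lambda>K w. \<Sum>k\<in>K. complex_of_real (g k w) * a k"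
  let ?C = "khinchine_const c r"
  have [measurable]: "g k \<in> borel_measurable M" for k
    by (intro subgaussian_family_measurable[OF assms(1,2)]) auto
  have fin: "\<forall>\<^sub>F K in finite_subsets_at_top UNIV. finite (K :: int set)"
    by (rule eventually_finite_subsets_at_top_weakI)
  have "\<exists>Y. tendsto_Lp M r ?S Y (finite_subsets_at_top UNIV)"
  proof (rule Lp_complete[OF \<open>0 < r\<close>])
    show "\<forall>\<^sub>F K in finite_subsets_at_top UNIV. ?S K \<in> Lp M r"
      using fin
    proof eventually_elim
      case (elim K)
      have "moment M r (?S K) < \<infinity>"
        using khinchine[OF assms(1,2) elim _ \<open>0 < r\<close>, of a] by (auto intro: le_less_trans)
      then show ?case by (simp add: Lp_iff_moment)
    qed
    fix e :: real assume "e > 0"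
    \<comment> \<open>A tail of size \<open>\<eta>\<close> contributes at most \<open>C \<eta>\<^sup>r\<^sup>/\<^sup>2 \<le> e\<close>; the summand 1 covers \<open>C = 0\<close>.\<close>
    define \<eta> where "\<eta> = (e / (?C + 1)) powr (2 / r)"
    have C: "0 < ?C + 1" using khinchine_const_nonneg[of c r] by simp
    have \<eta>: "\<eta> > 0" using \<open>e > 0\<close> C by (simp add: \<eta>_def)
    have "?C * \<eta> powr (r / 2) = ?C * (e / (?C + 1))"
      using \<open>e > 0\<close> C \<open>0 < r\<close> by (simp add: \<eta>_def powr_powr)
    also have "\<dots> = e * (?C / (?C + 1))" by simp
    also have "\<dots> \<le> e * 1"
      using \<open>e > 0\<close> C by (intro mult_left_mono) (auto simp: pos_divide_le_eq)
    finally have \<eta>_le: "?C * \<eta> powr (r / 2) \<le> e" by simp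
    define L where "L = (SUP K\<in>{K. finite K}. \<Sum>k\<in>K. (cmod (a k))\<^sup>2)"
    have bdd: "bdd_above ((\<lambda>K. \<Sum>k\<in>K. (cmod (a k))\<^sup>2) ` {K. finite K})"
      using bound by (auto intro!: bdd_aboveI2)
    obtain K0 where K0: "finite K0" "L - \<eta> < (\<Sum>k\<in>K0. (cmod (a k))\<^sup>2)"
      using less_cSUP_iff[OF _ bdd, of "L - \<eta>"] \<eta> unfolding L_def[symmetric] by auto
    have tail: "(\<Sum>k\<in>J. (cmod (a k))\<^sup>2) \<le> \<eta>" if "finite J" "J \<inter> K0 = {}" for J
    proof -
      have "(\<Sum>k\<in>J \<union> K0. (cmod (a k))\<^sup>2) \<le> L"
        unfolding L_def using that K0 bdd by (intro cSUP_upper) auto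
      moreover have "(\<Sum>k\<in>J \<union> K0. (cmod (a k))\<^sup>2) = (\<Sum>k\<in>J. (cmod (a k))\<^sup>2) + (\<Sum>k\<in>K0. (cmod (a k))\<^sup>2)"
        using that K0 by (intro sum.union_disjoint) auto
      ultimately show ?thesis using K0(2) by linarith
    qed
    show "\<exists>B. (\<forall>\<^sub>F K in finite_subsets_at_top UNIV. B K) \<and>
      (\<forall>J K. B J \<longrightarrow> B K \<longrightarrow> moment M r (\<lambda>w. ?S J w - ?S K w) \<le> ennreal e)"
    proof (intro exI[of _ "\<lambda>K. finite K \<and> K0 \<subseteq> K"] conjI allI impI)
      show "\<forall>\<^sub>F K in finite_subsets_at_top UNIV. finite K \<and> K0 \<subseteq> K"
        using K0 unfolding eventually_finite_subsets_at_top by auto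
      fix J K assume J: "finite J \<and> K0 \<subseteq> J" and K: "finite K \<and> K0 \<subseteq> K"
      let ?U = "(J - K) \<union> (K - J)"
      let ?b = "\<lambda>k. if k \<in> J then a k else - a k"
      have eq: "?S J w - ?S K w = (\<Sum>k\<in>?U. complex_of_real (g k w) * ?b k)" for w
      proof -
        have "?S J w = ?S (J - K) w + ?S (J \<inter> K) w" "?S K w = ?S (K - J) w + ?S (J \<inter> K) w"
          using J K by (subst sum.union_disjoint[symmetric]; auto intro!: sum.cong)+
        moreover have "(\<Sum>k\<in>?U. complex_of_real (g k w) * ?b k) = ?S (J - K) w - ?S (K - J) w"
          using J K by (subst sum.union_disjoint) (auto simp: sum_negf[symmetric] intro!: sum.cong arg_cong2[where f="(+)"])
        ultimately show ?thesis by simp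
      qed
      have "moment M r (\<lambda>w. ?S J w - ?S K w) \<le> ennreal (?C * (\<Sum>k\<in>?U. (cmod (?b k))\<^sup>2) powr (r / 2))"
        unfolding eq using J K \<open>0 < r\<close> by (intro khinchine[OF assms(1,2)]) auto
      also have "(\<Sum>k\<in>?U. (cmod (?b k))\<^sup>2) = (\<Sum>k\<in>?U. (cmod (a k))\<^sup>2)"
        by (intro sum.cong) auto
      also have "ennreal (?C * (\<Sum>k\<in>?U. (cmod (a k))\<^sup>2) powr (r / 2)) \<le> ennreal (?C * \<eta> powr (r / 2))"
        using J K K0 \<open>0 < r\<close> khinchine_const_nonneg[of c r]
        by (intro ennreal_leI mult_left_mono powr_mono2 tail) (auto simp: sum_nonneg)
      also have "\<dots> \<le> ennreal e" by (intro ennreal_leI \<eta>_le)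
      finally show "moment M r (\<lambda>w. ?S J w - ?S K w) \<le> ennreal e" .
    qed
  qed simp
  then show ?thesis unfolding random_series_def by (blast intro: lim_Lp_eq)
qed

lemma moment_random_series_le:
  fixes a :: "int \<Rightarrow> complex"
  assumes "prob_space M" and sub: "subgaussian_family M UNIV g c" and "0 < r" "0 < q"
    and bound: "\<And>K. finite K \<Longrightarrow> (\<Sum>k\<in>K. (cmod (a k))\<^sup>2) \<le> A"
  shows "moment M q (random_series M r g a) \<le> ennreal (khinchine_const c q * A powr (q / 2))"
proof (rule tendsto_Lp_moment_le[OF tendsto_random_series[OF assms(1-3) bound] \<open>0 < r\<close> _ \<open>0 < q\<close>])
  show "\<forall>\<^sub>F K in finite_subsets_at_top UNIV. moment M q (\<lambda>w. \<Sum>k\<in>K. complex_of_real (g k w) * a k)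
      \<le> ennreal (khinchine_const c q * A powr (q / 2))"
  proof (rule eventually_finite_subsets_at_top_weakI)
    fix K :: "int set" assume "finite K"
    then show "moment M q (\<lambda>w. \<Sum>k\<in>K. complex_of_real (g k w) * a k) \<le> ennreal (khinchine_const c q * A powr (q / 2))"
      using \<open>0 < q\<close> khinchine_const_nonneg[of c q] bound
      by (intro order_trans[OF khinchine[OF assms(1,2)]] ennreal_leI mult_left_mono powr_mono2) (auto simp: sum_nonneg)
  qed
qed simp_all

text \<open>
  The two series are separate limits, each fixed only up to null sets; passing to the limit in the
  difference of the partial sums gives a bound by the coefficients \<open>a\<^sub>k - b\<^sub>k\<close> nevertheless.
\<close>

lemma moment_random_series_diff_le:
  fixes a b :: "int \<Rightarrow> complex"
  assumes "prob_space M" and sub: "subgaussian_family M UNIV g c" and "0 < r" "0 < q"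
    and a: "\<And>K. finite K \<Longrightarrow> (\<Sum>k\<in>K. (cmod (a k))\<^sup>2) \<le> A"
    and b: "\<And>K. finite K \<Longrightarrow> (\<Sum>k\<in>K. (cmod (b k))\<^sup>2) \<le> A'"
    and ab: "\<And>K. finite K \<Longrightarrow> (\<Sum>k\<in>K. (cmod (a k - b k))\<^sup>2) \<le> D"
  shows "moment M q (\<lambda>w. random_series M r g a w - random_series M r g b w)
    \<le> ennreal (khinchine_const c q * D powr (q / 2))"
proof -
  have "tendsto_Lp M r (\<lambda>K w. (\<Sum>k\<in>K. complex_of_real (g k w) * a k) - (\<Sum>k\<in>K. complex_of_real (g k w) * b k))
      (\<lambda>w. random_series M r g a w - random_series M r g b w) (finite_subsets_at_top UNIV)"
    by (intro tendsto_Lp_diff tendsto_random_series[OF assms(1-3) a] tendsto_random_series[OF assms(1-3) b] \<open>0 < r\<close>)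
  then show ?thesis
  proof (rule tendsto_Lp_moment_le[OF _ \<open>0 < r\<close> _ \<open>0 < q\<close>])
    show "\<forall>\<^sub>F K in finite_subsets_at_top UNIV. moment M q
        (\<lambda>w. (\<Sum>k\<in>K. complex_of_real (g k w) * a k) - (\<Sum>k\<in>K. complex_of_real (g k w) * b k))
        \<le> ennreal (khinchine_const c q * D powr (q / 2))"
    proof (rule eventually_finite_subsets_at_top_weakI)
      fix K :: "int set" assume "finite K"
      then show "moment M q (\<lambda>w. (\<Sum>k\<in>K. complex_of_real (g k w) * a k) - (\<Sum>k\<in>K. complex_of_real (g k w) * b k))
          \<le> ennreal (khinchine_const c q * D powr (q / 2))"
        unfolding sum_subtractf[symmetric] right_diff_distrib[symmetric]
        using \<open>0 < q\<close> khinchine_const_nonneg[of c q] ab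
        by (intro order_trans[OF khinchine[OF assms(1,2)]] ennreal_leI mult_left_mono powr_mono2) (auto simp: sum_nonneg)
    qed
  qed simp
qed

section \<open>The Fourier--Plancherel transform\<close>

lemma moment_2: "moment M 2 X = (\<integral>\<^sup>+ x. ennreal ((cmod (X x))\<^sup>2) \<partial>M)"
  unfolding moment_def by (simp add: powr_numeral)

lemma integrable_mult_L2:
  assumes "X \<in> Lp M 2" "Y \<in> Lp M 2"
  shows "integrable M (\<lambda>x. X x * Y x)"
proof (rule Bochner_Integration.integrable_bound)
  have i: "integrable M (\<lambda>x. (cmod (X x))\<^sup>2)" "integrable M (\<lambda>x. (cmod (Y x))\<^sup>2)"
    using assms by (simp_all add: Lp_def)
  then show "integrable M (\<lambda>x. (cmod (X x))\<^sup>2 + (cmod (Y x))\<^sup>2)" by simp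
  show "AE x in M. norm (X x * Y x) \<le> norm ((cmod (X x))\<^sup>2 + (cmod (Y x))\<^sup>2)"
  proof (intro AE_I2)
    fix x
    have "0 \<le> (cmod (X x) - cmod (Y x))\<^sup>2 + (cmod (X x) * cmod (X x) + cmod (Y x) * cmod (Y x))" by simp
    then show "norm (X x * Y x) \<le> norm ((cmod (X x))\<^sup>2 + (cmod (Y x))\<^sup>2)"
      by (simp add: norm_mult power2_eq_square algebra_simps)
  qed
qed (use assms in \<open>auto simp: Lp_def\<close>)

lemma tendsto_Lp_2_integral_mult:
  assumes lim: "tendsto_Lp M 2 X Y F" and v: "v \<in> Lp M 2"
  shows "((\<lambda>i. LINT x|M. X i x * v x) \<longlongrightarrow> (LINT x|M. Y x * v x)) F"
proof -
  let ?m = "\<lambda>i. moment M 2 (\<lambda>x. X i x - Y x)"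
  have Y: "Y \<in> Lp M 2" and ev: "\<forall>\<^sub>F i in F. X i \<in> Lp M 2" and m: "(?m \<longlongrightarrow> 0) F"
    using lim by (simp_all add: tendsto_Lp_iff_moment)
  have v': "moment M 2 v < \<infinity>" "v \<in> borel_measurable M" using v by (auto simp: Lp_iff_moment)
  have "\<forall>\<^sub>F i in F. ennreal ((cmod ((LINT x|M. X i x * v x) - (LINT x|M. Y x * v x)))\<^sup>2) \<le> ?m i * moment M 2 v"
    using ev
  proof eventually_elim
    case (elim i)
    have [measurable]: "X i \<in> borel_measurable M" "Y \<in> borel_measurable M" "v \<in> borel_measurable M"
      using elim Y v by (auto simp: Lp_def)
    have "(LINT x|M. X i x * v x) - (LINT x|M. Y x * v x) = (LINT x|M. (X i x - Y x) * v x)"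
      using integrable_mult_L2[OF elim v] integrable_mult_L2[OF Y v] by (simp add: left_diff_distrib)
    also have "ennreal (cmod \<dots>) \<le> (\<integral>\<^sup>+ x. ennreal (cmod ((X i x - Y x) * v x)) \<partial>M)"
      using integrable_mult_L2[OF Lp_diff[OF elim Y] v] by (intro integral_norm_bound_ennreal) simp
    also have "\<dots> = (\<integral>\<^sup>+ x. ennreal (cmod (X i x - Y x)) * ennreal (cmod (v x)) \<partial>M)"
      by (simp add: norm_mult ennreal_mult)
    finally have "(ennreal (cmod ((LINT x|M. X i x * v x) - (LINT x|M. Y x * v x))))\<^sup>2
        \<le> (\<integral>\<^sup>+ x. ennreal (cmod (X i x - Y x)) * ennreal (cmod (v x)) \<partial>M)\<^sup>2"
      by (intro power_mono) auto
    also have "\<dots> \<le> (\<integral>\<^sup>+ x. (ennreal (cmod (X i x - Y x)))\<^sup>2 \<partial>M) * (\<integral>\<^sup>+ x. (ennreal (cmod (v x)))\<^sup>2 \<partial>M)"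
      by (intro Cauchy_Schwarz_nn_integral) auto
    also have "\<dots> = ?m i * moment M 2 v"
      unfolding moment_2 by (simp add: ennreal_power)
    finally show ?case by (simp add: ennreal_power)
  qed
  moreover have "((\<lambda>i. ?m i * moment M 2 v) \<longlongrightarrow> 0 * moment M 2 v) F"
    using v' by (intro tendsto_mult_ennreal m tendsto_const) auto
  ultimately have "((\<lambda>i. ennreal ((cmod ((LINT x|M. X i x * v x) - (LINT x|M. Y x * v x)))\<^sup>2)) \<longlongrightarrow> ennreal 0) F"
    using tendsto_sandwich[of "\<lambda>_. 0" "\<lambda>i. ennreal ((cmod ((LINT x|M. X i x * v x) - (LINT x|M. Y x * v x)))\<^sup>2)" F
      "\<lambda>i. ?m i * moment M 2 v" 0] by simp
  then have "((\<lambda>i. (cmod ((LINT x|M. X i x * v x) - (LINT x|M. Y x * v x)))\<^sup>2) \<longlongrightarrow> 0) F"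
    by (subst (asm) tendsto_ennreal_iff) auto
  then have "((\<lambda>i. sqrt ((cmod ((LINT x|M. X i x * v x) - (LINT x|M. Y x * v x)))\<^sup>2)) \<longlongrightarrow> sqrt 0) F"
    by (rule tendsto_real_sqrt)
  then have "((\<lambda>i. (LINT x|M. X i x * v x) - (LINT x|M. Y x * v x)) \<longlongrightarrow> 0) F"
    by (simp add: tendsto_norm_zero_iff)
  then show ?thesis by (rule LIM_zero_cancel)
qed

lemma borel_measurable_cnj [measurable (raw)]:
  "f \<in> borel_measurable M \<Longrightarrow> (\<lambda>x. cnj (f x)) \<in> borel_measurable M"
  by (rule measurable_compose[OF _ borel_measurable_continuous_onI]) (auto intro: continuous_intros)

lemma norm_exp_minus_ii [simp]: "cmod (exp (- (\<i> * complex_of_real r))) = 1"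
  by (simp add: norm_exp_eq_Re)

lemma measurable_fourier_L1 [measurable]:
  assumes [measurable]: "f \<in> borel_measurable borel"
  shows "fourier_L1 f \<in> borel_measurable borel"
  unfolding fourier_L1_def[abs_def] by measurable

lemma integrable_fourier_L1_integrand:
  "integrable lborel f \<Longrightarrow> integrable lborel (\<lambda>x. exp (- (\<i> * complex_of_real (x * \<xi>))) * f x)"
  by (rule Bochner_Integration.integrable_bound[of _ f]) (auto simp: norm_mult)

lemma norm_fourier_L1_le:
  assumes "integrable lborel f"
  shows "cmod (fourier_L1 f \<xi>) \<le> 1 / sqrt (2 * pi) * (LINT x|lborel. cmod (f x))"
proof -
  have "cmod (LINT x|lborel. exp (- (\<i> * complex_of_real (x * \<xi>))) * f x) \<le> (LINT x|lborel. cmod (f x))"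
    using integral_norm_bound[of lborel "\<lambda>x. exp (- (\<i> * complex_of_real (x * \<xi>))) * f x"]
    by (simp add: norm_mult del: of_real_mult)
  then show ?thesis
    unfolding fourier_L1_def norm_mult norm_of_real by (intro mult_mono) auto
qed

lemma fourier_L1_diff:
  assumes "integrable lborel f" "integrable lborel g"
  shows "fourier_L1 (\<lambda>x. f x - g x) \<xi> = fourier_L1 f \<xi> - fourier_L1 g \<xi>"
  using integrable_fourier_L1_integrand[OF assms(1)] integrable_fourier_L1_integrand[OF assms(2)]
  unfolding fourier_L1_def by (simp add: right_diff_distrib)

lemma fourier_L1_multiplication_formula:
  assumes f: "integrable lborel f" and v: "integrable lborel v"
  shows "(LINT \<xi>|lborel. fourier_L1 f \<xi> * v \<xi>) = (LINT x|lborel. f x * fourier_L1 v x)"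
proof -
  have [measurable]: "f \<in> borel_measurable borel" "v \<in> borel_measurable borel"
    using f v by auto
  let ?e = "\<lambda>x \<xi>. exp (- (\<i> * complex_of_real (x * \<xi>))) * (f x * v \<xi>)"
  have nrm: "cmod (?e x \<xi>) = cmod (f x) * cmod (v \<xi>)" for x \<xi>
    by (simp only: norm_mult norm_exp_minus_ii mult_1)
  have "integrable (lborel \<Otimes>\<^sub>M lborel) (case_prod ?e)"
  proof (rule lborel_pair.Fubini_integrable)
    show "case_prod ?e \<in> borel_measurable (lborel \<Otimes>\<^sub>M lborel)" by measurable
    show "integrable lborel (\<lambda>x. LINT y|lborel. cmod (case (x, y) of (x, y) \<Rightarrow> ?e x y))"
      unfolding prod.case nrm using f by simp
    show "AE x in lborel. integrable lborel (\<lambda>y. case (x, y) of (x, y) \<Rightarrow> ?e x y)"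
      unfolding prod.case
      by (intro AE_I2 Bochner_Integration.integrable_bound[OF integrable_mult_right[OF v, of "f x" for x]])
        (auto simp: norm_mult)
  qed
  then have "(LINT \<xi>|lborel. LINT x|lborel. ?e x \<xi>) = (LINT x|lborel. LINT \<xi>|lborel. ?e x \<xi>)"
    by (rule lborel_pair.Fubini_integral)
  moreover have "(LINT x|lborel. ?e x \<xi>) = (LINT x|lborel. exp (- (\<i> * complex_of_real (x * \<xi>))) * f x) * v \<xi>" for \<xi>
    by (simp add: mult.assoc[symmetric] del: of_real_mult)
  moreover have "(LINT \<xi>|lborel. ?e x \<xi>) = f x * (LINT \<xi>|lborel. exp (- (\<i> * complex_of_real (\<xi> * x))) * v \<xi>)" for x
    by (subst integral_mult_right_zero[symmetric]) (simp add: mult_ac)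
  ultimately show ?thesis
    unfolding fourier_L1_def by (simp add: mult_ac del: of_real_mult)
qed

lemma fourier_L1_gaussian:
  assumes s: "0 < s"
  shows "fourier_L1 (\<lambda>\<xi>. exp (\<i> * complex_of_real (a * \<xi>)) * complex_of_real (exp (- (s * \<xi>)\<^sup>2 / 2))) y =
    complex_of_real (sqrt (2 * pi) * normal_density a s y)"
proof -
  let ?b = "(a - y) / s"
  have "(LINT x|lborel. exp (- (\<i> * complex_of_real (x * y))) *
        (exp (\<i> * complex_of_real (a * x)) * complex_of_real (exp (- (s * x)\<^sup>2 / 2)))) =
      (LINT x|lborel. exp (\<i> * complex_of_real ((a - y) * x)) * complex_of_real (exp (- (s * x)\<^sup>2 / 2)))"
  proof (intro Bochner_Integration.integral_cong refl)
    fix x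
    have "exp (- (\<i> * complex_of_real (x * y))) * exp (\<i> * complex_of_real (a * x)) =
        exp (\<i> * complex_of_real ((a - y) * x))"
      by (simp add: mult_exp_exp algebra_simps)
    then show "exp (- (\<i> * complex_of_real (x * y))) *
        (exp (\<i> * complex_of_real (a * x)) * complex_of_real (exp (- (s * x)\<^sup>2 / 2))) =
        exp (\<i> * complex_of_real ((a - y) * x)) * complex_of_real (exp (- (s * x)\<^sup>2 / 2))"
      by (simp only: mult.assoc[symmetric])
  qed
  also have "\<dots> = (1 / s) *\<^sub>R (LINT u|lborel. exp (\<i> * complex_of_real ((a - y) * (0 + 1 / s * u)))
      * complex_of_real (exp (- (s * (0 + 1 / s * u))\<^sup>2 / 2)))"
    by (subst lborel_integral_real_affine[where c="1/s" and t=0]) (use s in auto)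
  also have "(LINT u|lborel. exp (\<i> * complex_of_real ((a - y) * (0 + 1 / s * u)))
      * complex_of_real (exp (- (s * (0 + 1 / s * u))\<^sup>2 / 2))) =
      (LINT u|lborel. complex_of_real (sqrt (2 * pi)) * (std_normal_density u *\<^sub>R exp (\<i> * complex_of_real (?b * u))))"
    using s by (intro Bochner_Integration.integral_cong refl)
      (simp add: std_normal_density_def scaleR_conv_of_real mult_ac)
  also have "\<dots> = complex_of_real (sqrt (2 * pi)) * char std_normal_distribution ?b"
    unfolding char_def integral_mult_right_zero by (subst integral_density) auto
  also have "\<dots> = complex_of_real (sqrt (2 * pi)) * complex_of_real (exp (- (?b\<^sup>2) / 2))"
    by (simp add: char_std_normal_distribution)
  finally have "fourier_L1 (\<lambda>\<xi>. exp (\<i> * complex_of_real (a * \<xi>)) * complex_of_real (exp (- (s * \<xi>)\<^sup>2 / 2))) y =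
      complex_of_real (1 / s * exp (- (?b\<^sup>2) / 2))"
    unfolding fourier_L1_def by (simp add: scaleR_conv_of_real)
  also have "1 / s * exp (- (?b\<^sup>2) / 2) = sqrt (2 * pi) * normal_density a s y"
    using s by (simp add: normal_density_def real_sqrt_mult power_divide power2_commute[of a y])
  finally show ?thesis .
qed

lemma integrable_gaussian: "0 < s \<Longrightarrow> integrable lborel (\<lambda>\<xi>. exp (- (s * \<xi>)\<^sup>2 / 2) :: real)"
proof -
  assume s: "0 < s"
  have "integrable lborel (\<lambda>x. sqrt (2 * pi * (1/s)\<^sup>2) * normal_density 0 (1/s) x)"
    using s by (intro integrable_mult_right integrable_normal_density) simp
  also have "(\<lambda>x. sqrt (2 * pi * (1/s)\<^sup>2) * normal_density 0 (1/s) x) = (\<lambda>\<xi>. exp (- (s * \<xi>)\<^sup>2 / 2))"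
    using s by (auto simp: normal_density_def fun_eq_iff power_divide power_mult_distrib divide_simps)
  finally show ?thesis .
qed

text \<open>
  Parseval's identity with a Gaussian cut-off in frequency, which amounts to smoothing \<open>g\<close> by the heat
  kernel.  It is the multiplication formula for \<open>f\<close> and the damped function \<open>w = e\<^sup>-\<^sup>(\<^sup>s\<^sup>\<xi>\<^sup>)\<^sup>2\<^sup>/\<^sup>2 cnj (F g)\<close>; the
  transform of \<open>w\<close> is found by a second use of that formula, for \<open>g\<close> and a modulated Gaussian.
\<close>

lemma fourier_L1_gaussian_parseval:
  assumes s: "0 < s" and f: "integrable lborel f" and g: "integrable lborel g"
  shows "(LINT \<xi>|lborel. complex_of_real (exp (- (s * \<xi>)\<^sup>2 / 2)) * (fourier_L1 f \<xi> * cnj (fourier_L1 g \<xi>))) =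
    (LINT x|lborel. f x * cnj (LINT y|lborel. complex_of_real (normal_density x s y) * g y))"
proof -
  have [measurable]: "g \<in> borel_measurable borel" using g by auto
  let ?G = "\<lambda>\<xi>. complex_of_real (exp (- (s * \<xi>)\<^sup>2 / 2))"
  have G: "integrable lborel ?G" using integrable_gaussian[OF s] by (rule integrable_of_real)
  define w where "w \<xi> = ?G \<xi> * cnj (fourier_L1 g \<xi>)" for \<xi>
  have w: "integrable lborel w"
    unfolding w_def
  proof (rule Bochner_Integration.integrable_bound[OF integrable_mult_left[OF G]])
    show "AE \<xi> in lborel. norm (?G \<xi> * cnj (fourier_L1 g \<xi>)) \<le>
        norm (?G \<xi> * complex_of_real (1 / sqrt (2 * pi) * (LINT x|lborel. cmod (g x))))"
      unfolding norm_mult[of "?G _"] complex_mod_cnj norm_of_real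
      by (intro AE_I2 mult_left_mono order_trans[OF norm_fourier_L1_le[OF g] abs_ge_self]) auto
  qed measurable
  have "cnj (fourier_L1 w x) = (LINT y|lborel. complex_of_real (normal_density x s y) * g y)" for x
  proof -
    have i: "integrable lborel (\<lambda>\<xi>. exp (\<i> * complex_of_real (x * \<xi>)) * ?G \<xi>)"
      by (rule Bochner_Integration.integrable_bound[OF G]) (auto simp: norm_mult)
    have "cnj (LINT \<xi>|lborel. exp (- (\<i> * complex_of_real (\<xi> * x))) * w \<xi>) =
        (LINT \<xi>|lborel. fourier_L1 g \<xi> * (exp (\<i> * complex_of_real (x * \<xi>)) * ?G \<xi>))"
      unfolding Bochner_Integration.integral_cnj[symmetric] w_def
      by (intro Bochner_Integration.integral_cong refl) (simp add: exp_cnj mult_ac)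
    also have "\<dots> = (LINT y|lborel. g y * fourier_L1 (\<lambda>\<xi>. exp (\<i> * complex_of_real (x * \<xi>)) * ?G \<xi>) y)"
      by (rule fourier_L1_multiplication_formula[OF g i])
    also have "\<dots> = (LINT y|lborel. complex_of_real (sqrt (2 * pi)) * (complex_of_real (normal_density x s y) * g y))"
      unfolding fourier_L1_gaussian[OF s] by (simp add: mult_ac)
    also have "\<dots> = complex_of_real (sqrt (2 * pi)) * (LINT y|lborel. complex_of_real (normal_density x s y) * g y)"
      by (rule integral_mult_right_zero)
    finally show ?thesis
      unfolding fourier_L1_def[of w] complex_cnj_mult complex_cnj_complex_of_real
      by (simp only:) (simp add: mult.assoc[symmetric] flip: of_real_mult)
  qed
  then have "fourier_L1 w x = cnj (LINT y|lborel. complex_of_real (normal_density x s y) * g y)" for x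
    by (metis complex_cnj_cnj)
  moreover have "(LINT \<xi>|lborel. fourier_L1 f \<xi> * w \<xi>) = (LINT x|lborel. f x * fourier_L1 w x)"
    by (rule fourier_L1_multiplication_formula[OF f w])
  ultimately show ?thesis by (simp add: w_def mult_ac)
qed

lemma nn_integral_normal_density: "0 < s \<Longrightarrow> (\<integral>\<^sup>+ y. ennreal (normal_density x s y) \<partial>lborel) = 1"
  by (subst nn_integral_eq_integral) (auto simp: normal_density_nonneg)

text \<open>
  The smoothed pairing is at most \<open>\<integral>\<integral> N(x,y) |f x| |f y|\<close> with a symmetric kernel \<open>N\<close> of mass 1 in each
  variable, so \<open>a b \<le> (a\<^sup>2 + b\<^sup>2) / 2\<close> bounds it by \<open>\<parallel>f\<parallel>\<^sup>2\<close>; the cut-off is then removed by Fatou's lemma.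
  The inequality is enough to extend the transform to \<open>L\<^sup>2\<close>.
\<close>

lemma fourier_L1_plancherel_le:
  assumes f: "integrable lborel f"
  shows "moment lborel 2 (fourier_L1 f) \<le> moment lborel 2 f"
proof -
  have [measurable]: "f \<in> borel_measurable borel" using f by auto
  have reg: "(\<integral>\<^sup>+ \<xi>. ennreal (exp (- (s * \<xi>)\<^sup>2 / 2) * (cmod (fourier_L1 f \<xi>))\<^sup>2) \<partial>lborel) \<le> moment lborel 2 f"
    if s: "0 < s" for s
  proof -
    let ?N = "\<lambda>x y. ennreal (normal_density x s y)"
    let ?S = "\<lambda>x. LINT y|lborel. complex_of_real (normal_density x s y) * f y"
    define C where "C = 1 / sqrt (2 * pi) * (LINT x|lborel. cmod (f x))"
    have int: "integrable lborel (\<lambda>\<xi>. exp (- (s * \<xi>)\<^sup>2 / 2) * (cmod (fourier_L1 f \<xi>))\<^sup>2)"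
    proof (rule Bochner_Integration.integrable_bound[OF integrable_mult_left[OF integrable_gaussian[OF s]]])
      show "AE \<xi> in lborel. norm (exp (- (s * \<xi>)\<^sup>2 / 2) * (cmod (fourier_L1 f \<xi>))\<^sup>2) \<le>
          norm (exp (- (s * \<xi>)\<^sup>2 / 2) * C\<^sup>2)"
        using norm_fourier_L1_le[OF f]
        by (intro AE_I2) (auto simp: norm_mult C_def intro!: mult_left_mono power_mono)
    qed measurable
    have N_sym: "?N x y = ?N y x" for x y
      by (simp add: normal_density_def power2_commute)
    have N_meas: "(\<lambda>(x, y). normal_density x s y) \<in> borel_measurable (lborel \<Otimes>\<^sub>M lborel)"
      unfolding normal_density_def by measurable
    then have [measurable]: "(\<lambda>p. normal_density (fst p) s (snd p)) \<in> borel_measurable (lborel \<Otimes>\<^sub>M lborel)"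
      by (simp add: case_prod_beta')
    have S: "ennreal (cmod (?S x)) \<le> (\<integral>\<^sup>+ y. ?N x y * ennreal (cmod (f y)) \<partial>lborel)" for x
    proof (cases "integrable lborel (\<lambda>y. complex_of_real (normal_density x s y) * f y)")
      case True
      then have "ennreal (cmod (?S x)) \<le> (\<integral>\<^sup>+ y. ennreal (cmod (complex_of_real (normal_density x s y) * f y)) \<partial>lborel)"
        by (rule integral_norm_bound_ennreal)
      also have "\<dots> = (\<integral>\<^sup>+ y. ?N x y * ennreal (cmod (f y)) \<partial>lborel)"
        by (simp add: norm_mult ennreal_mult normal_density_nonneg)
      finally show ?thesis .
    qed (simp add: not_integrable_integral_eq)
    have "(\<integral>\<^sup>+ \<xi>. ennreal (exp (- (s * \<xi>)\<^sup>2 / 2) * (cmod (fourier_L1 f \<xi>))\<^sup>2) \<partial>lborel) =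
        ennreal (LINT \<xi>|lborel. exp (- (s * \<xi>)\<^sup>2 / 2) * (cmod (fourier_L1 f \<xi>))\<^sup>2)"
      by (rule nn_integral_eq_integral[OF int]) auto
    also have "(LINT \<xi>|lborel. exp (- (s * \<xi>)\<^sup>2 / 2) * (cmod (fourier_L1 f \<xi>))\<^sup>2) =
        cmod (complex_of_real (LINT \<xi>|lborel. exp (- (s * \<xi>)\<^sup>2 / 2) * (cmod (fourier_L1 f \<xi>))\<^sup>2))"
      by (simp add: norm_of_real integral_nonneg_AE)
    also have "complex_of_real (LINT \<xi>|lborel. exp (- (s * \<xi>)\<^sup>2 / 2) * (cmod (fourier_L1 f \<xi>))\<^sup>2) =
        (LINT \<xi>|lborel. complex_of_real (exp (- (s * \<xi>)\<^sup>2 / 2)) * (fourier_L1 f \<xi> * cnj (fourier_L1 f \<xi>)))"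
      unfolding integral_complex_of_real[symmetric]
      by (intro Bochner_Integration.integral_cong refl) (simp only: of_real_mult complex_norm_square)
    also have "\<dots> = (LINT x|lborel. f x * cnj (?S x))"
      by (rule fourier_L1_gaussian_parseval[OF s f f])
    also have "ennreal (cmod \<dots>) \<le> (\<integral>\<^sup>+ x. ennreal (cmod (f x)) * ennreal (cmod (?S x)) \<partial>lborel)"
    proof (cases "integrable lborel (\<lambda>x. f x * cnj (?S x))")
      case True
      then have "ennreal (cmod (LINT x|lborel. f x * cnj (?S x))) \<le> (\<integral>\<^sup>+ x. ennreal (cmod (f x * cnj (?S x))) \<partial>lborel)"
        by (rule integral_norm_bound_ennreal)
      then show ?thesis by (simp add: norm_mult ennreal_mult del: integral_cnj)
    qed (simp add: not_integrable_integral_eq)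
    also have "\<dots> \<le> (\<integral>\<^sup>+ x. ennreal (cmod (f x)) * (\<integral>\<^sup>+ y. ?N x y * ennreal (cmod (f y)) \<partial>lborel) \<partial>lborel)"
      by (intro nn_integral_mono mult_left_mono S) auto
    also have "\<dots> = (\<integral>\<^sup>+ x. (\<integral>\<^sup>+ y. ennreal (cmod (f x)) * (?N x y * ennreal (cmod (f y))) \<partial>lborel) \<partial>lborel)"
      by (intro nn_integral_cong nn_integral_cmult[symmetric]) measurable
    also have "\<dots> \<le> (\<integral>\<^sup>+ x. (\<integral>\<^sup>+ y. ennreal ((cmod (f x))\<^sup>2 / 2) * ?N x y + ennreal ((cmod (f y))\<^sup>2 / 2) * ?N x y \<partial>lborel) \<partial>lborel)"
    proof (intro nn_integral_mono)
      fix x y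
      have "0 \<le> (cmod (f x) - cmod (f y))\<^sup>2" by simp
      then have "cmod (f x) * cmod (f y) \<le> (cmod (f x))\<^sup>2 / 2 + (cmod (f y))\<^sup>2 / 2"
        by (simp add: power2_diff)
      then have "(cmod (f x) * cmod (f y)) * normal_density x s y \<le> ((cmod (f x))\<^sup>2 / 2 + (cmod (f y))\<^sup>2 / 2) * normal_density x s y"
        by (intro mult_right_mono) (auto simp: normal_density_nonneg)
      then show "ennreal (cmod (f x)) * (?N x y * ennreal (cmod (f y))) \<le>
          ennreal ((cmod (f x))\<^sup>2 / 2) * ?N x y + ennreal ((cmod (f y))\<^sup>2 / 2) * ?N x y"
        by (simp add: ennreal_mult[symmetric] ennreal_plus[symmetric] normal_density_nonneg algebra_simps del: ennreal_plus)
    qed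
    also have "\<dots> = (\<integral>\<^sup>+ x. (\<integral>\<^sup>+ y. ennreal ((cmod (f x))\<^sup>2 / 2) * ?N x y \<partial>lborel) \<partial>lborel)
        + (\<integral>\<^sup>+ x. (\<integral>\<^sup>+ y. ennreal ((cmod (f y))\<^sup>2 / 2) * ?N x y \<partial>lborel) \<partial>lborel)"
      by (subst nn_integral_add; (subst nn_integral_add)?; simp)
    also have "(\<integral>\<^sup>+ x. (\<integral>\<^sup>+ y. ennreal ((cmod (f y))\<^sup>2 / 2) * ?N x y \<partial>lborel) \<partial>lborel) =
        (\<integral>\<^sup>+ y. (\<integral>\<^sup>+ x. ennreal ((cmod (f y))\<^sup>2 / 2) * ?N x y \<partial>lborel) \<partial>lborel)"
      by (rule lborel_pair.Fubini'[symmetric]) measurable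
    also have "\<dots> = (\<integral>\<^sup>+ y. (\<integral>\<^sup>+ x. ennreal ((cmod (f y))\<^sup>2 / 2) * ?N y x \<partial>lborel) \<partial>lborel)"
      by (simp only: N_sym)
    also have "(\<integral>\<^sup>+ x. (\<integral>\<^sup>+ y. ennreal ((cmod (f x))\<^sup>2 / 2) * ?N x y \<partial>lborel) \<partial>lborel) = (\<integral>\<^sup>+ x. ennreal ((cmod (f x))\<^sup>2 / 2) \<partial>lborel)"
      by (subst nn_integral_cmult) (simp_all add: nn_integral_normal_density[OF s])
    also have "(\<integral>\<^sup>+ x. ennreal ((cmod (f x))\<^sup>2 / 2) \<partial>lborel) + (\<integral>\<^sup>+ x. ennreal ((cmod (f x))\<^sup>2 / 2) \<partial>lborel) =
        moment lborel 2 f"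
      unfolding moment_2 by (subst nn_integral_add[symmetric]) (auto simp: ennreal_plus[symmetric] simp del: ennreal_plus)
    finally show ?thesis .
  qed
  show ?thesis
  proof (rule moment_Fatou)
    let ?X = "\<lambda>n \<xi>. complex_of_real (exp (- (1 / Suc n * \<xi>)\<^sup>2 / 4)) * fourier_L1 f \<xi>"
    show "?X n \<in> borel_measurable lborel" for n by measurable
    show "AE \<xi> in lborel. (\<lambda>n. ?X n \<xi>) \<longlonglongrightarrow> fourier_L1 f \<xi>"
    proof (rule AE_I2)
      fix \<xi>
      have "(\<lambda>n. 1 / Suc n) \<longlonglongrightarrow> 0" using LIMSEQ_inverse_real_of_nat by (simp add: inverse_eq_divide)
      then have "(\<lambda>n. ?X n \<xi>) \<longlonglongrightarrow> complex_of_real (exp (- (0 * \<xi>)\<^sup>2 / 4)) * fourier_L1 f \<xi>"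
        by (intro tendsto_intros) auto
      then show "(\<lambda>n. ?X n \<xi>) \<longlonglongrightarrow> fourier_L1 f \<xi>" by simp
    qed
    show "moment lborel 2 (?X n) \<le> moment lborel 2 f" for n
    proof -
      have "(cmod (?X n \<xi>))\<^sup>2 = exp (- (1 / Suc n * \<xi>)\<^sup>2 / 2) * (cmod (fourier_L1 f \<xi>))\<^sup>2" for \<xi>
        by (simp add: norm_mult power_mult_distrib exp_double[symmetric])
      then show ?thesis using reg[of "1 / Suc n"] unfolding moment_2 by simp
    qed
  qed simp
qed

lemma fourier_L1_in_L2:
  assumes "integrable lborel f" "f \<in> L2"
  shows "fourier_L1 f \<in> L2"
  using fourier_L1_plancherel_le[OF assms(1)] assms by (auto simp: Lp_iff_moment intro: le_less_trans)

lemma integrable_indicator_Icc: "integrable lborel (indicat_real {a..b :: real})"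
  by (rule integrable_real_indicator) (auto simp: emeasure_lborel_Icc_eq)

lemma indicator_Icc_L1_L2:
  fixes a b :: real
  shows "integrable lborel (indicator {a..b} :: real \<Rightarrow> complex)" "indicator {a..b} \<in> L2"
proof -
  have "indicator {a..b} = (\<lambda>x. complex_of_real (indicator {a..b} x))"
    by (auto simp: indicator_def)
  with integrable_indicator_Icc[of a b]
  show int: "integrable lborel (indicator {a..b} :: real \<Rightarrow> complex)" by (simp add: integrable_of_real)
  have "(\<lambda>x. cmod (indicator {a..b} x) powr 2) = indicat_real {a..b}"
    by (auto simp: indicator_def fun_eq_iff)
  with int show "indicator {a..b} \<in> L2"
    using integrable_indicator_Icc[of a b] by (simp add: Lp_def)
qed

text \<open>
  The step where equality, and not just an upper bound, is obtained.  Against the indicator of an interval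
  the Gaussian cut-off can be removed by dominated convergence: the heat kernel applied to the indicator
  is bounded by 1 and converges to it except at the two end points.
\<close>

lemma fourier_L1_parseval_interval:
  fixes a b :: real
  assumes f: "integrable lborel f" "f \<in> L2"
  shows "(LINT \<xi>|lborel. fourier_L1 f \<xi> * cnj (fourier_L1 (indicator {a..b}) \<xi>)) = (LINT x|lborel. f x * indicator {a..b} x)"
proof -
  define v :: "real \<Rightarrow> complex" where "v = indicator {a..b}"
  have v: "integrable lborel v" and v2: "v \<in> L2"
    unfolding v_def by (rule indicator_Icc_L1_L2)+
  have [measurable]: "f \<in> borel_measurable borel" "v \<in> borel_measurable borel" using f v by auto
  define s where "s n = 1 / real (Suc n)" for n
  have s: "0 < s n" for n by (simp add: s_def)
  have s0: "s \<longlonglongrightarrow> 0"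
    unfolding s_def using LIMSEQ_inverse_real_of_nat by (simp add: inverse_eq_divide)
  have prod: "integrable lborel (\<lambda>\<xi>. fourier_L1 f \<xi> * cnj (fourier_L1 v \<xi>))"
  proof (rule integrable_mult_L2)
    show "fourier_L1 f \<in> L2" using f by (rule fourier_L1_in_L2)
    show "(\<lambda>\<xi>. cnj (fourier_L1 v \<xi>)) \<in> L2"
      using fourier_L1_in_L2[OF v v2] by (auto simp: Lp_def)
  qed
  have "(\<lambda>n. LINT \<xi>|lborel. complex_of_real (exp (- (s n * \<xi>)\<^sup>2 / 2)) * (fourier_L1 f \<xi> * cnj (fourier_L1 v \<xi>)))
      \<longlonglongrightarrow> (LINT \<xi>|lborel. fourier_L1 f \<xi> * cnj (fourier_L1 v \<xi>))"
  proof (rule integral_dominated_convergence[where w="\<lambda>\<xi>. cmod (fourier_L1 f \<xi> * cnj (fourier_L1 v \<xi>))"])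
    show "AE \<xi> in lborel. (\<lambda>n. complex_of_real (exp (- (s n * \<xi>)\<^sup>2 / 2)) * (fourier_L1 f \<xi> * cnj (fourier_L1 v \<xi>)))
        \<longlonglongrightarrow> fourier_L1 f \<xi> * cnj (fourier_L1 v \<xi>)"
    proof (rule AE_I2)
      fix \<xi>
      have "(\<lambda>n. complex_of_real (exp (- (s n * \<xi>)\<^sup>2 / 2)) * (fourier_L1 f \<xi> * cnj (fourier_L1 v \<xi>)))
        \<longlonglongrightarrow> complex_of_real (exp (- (0 * \<xi>)\<^sup>2 / 2)) * (fourier_L1 f \<xi> * cnj (fourier_L1 v \<xi>))"
        by (intro tendsto_intros s0) auto
      then show "(\<lambda>n. complex_of_real (exp (- (s n * \<xi>)\<^sup>2 / 2)) * (fourier_L1 f \<xi> * cnj (fourier_L1 v \<xi>)))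
        \<longlonglongrightarrow> fourier_L1 f \<xi> * cnj (fourier_L1 v \<xi>)" by simp
    qed
    show "AE \<xi> in lborel. cmod (complex_of_real (exp (- (s n * \<xi>)\<^sup>2 / 2)) * (fourier_L1 f \<xi> * cnj (fourier_L1 v \<xi>)))
        \<le> cmod (fourier_L1 f \<xi> * cnj (fourier_L1 v \<xi>))" for n
      unfolding norm_mult[of "complex_of_real _"] norm_of_real by (intro AE_I2 mult_left_le_one_le) auto
    show "integrable lborel (\<lambda>\<xi>. cmod (fourier_L1 f \<xi> * cnj (fourier_L1 v \<xi>)))"
      using prod by (rule integrable_norm)
  qed measurable
  then have lim1: "(\<lambda>n. LINT x|lborel. f x * cnj (LINT y|lborel. complex_of_real (normal_density x (s n) y) * v y))
      \<longlonglongrightarrow> (LINT \<xi>|lborel. fourier_L1 f \<xi> * cnj (fourier_L1 v \<xi>))"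
    unfolding fourier_L1_gaussian_parseval[OF s f(1) v] .
  have smooth: "(LINT y|lborel. complex_of_real (normal_density x (s n) y) * v y) =
      (LINT u|lborel. complex_of_real (std_normal_density u) * v (x + s n * u))" for x n
  proof -
    have "s n * normal_density x (s n) (x + s n * u) = std_normal_density u" for u
      using s[of n] by (simp add: normal_density_def real_sqrt_mult power_mult_distrib)
    then have "complex_of_real (std_normal_density u) * z = s n *\<^sub>R (complex_of_real (normal_density x (s n) (x + s n * u)) * z)" for u z
      by (metis scaleR_conv_of_real mult.assoc of_real_mult)
    then show ?thesis
      using s[of n] by (subst lborel_integral_real_affine[where c="s n" and t=x]) simp_all
  qed
  have nv: "cmod (v x) \<le> 1" for x by (simp add: v_def indicator_def)
  have std: "integrable lborel (\<lambda>u. complex_of_real (std_normal_density u) * v (x + s n * u))" for x n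
    by (rule Bochner_Integration.integrable_bound[of _ std_normal_density])
      (auto simp: norm_mult normal_density_nonneg intro!: mult_left_le nv)
  have le1: "cmod (LINT u|lborel. complex_of_real (std_normal_density u) * v (x + s n * u)) \<le> 1" for x n
  proof -
    have "cmod (LINT u|lborel. complex_of_real (std_normal_density u) * v (x + s n * u)) \<le> (LINT u|lborel. std_normal_density u)"
      by (rule Bochner_Integration.integral_norm_bound_integral[OF std])
        (auto simp: norm_mult normal_density_nonneg intro!: mult_left_le nv)
    then show ?thesis by simp
  qed
  have conv: "(\<lambda>n. LINT u|lborel. complex_of_real (std_normal_density u) * v (x + s n * u)) \<longlonglongrightarrow> v x"
    if x: "x \<noteq> a" "x \<noteq> b" for x
  proof -
    have "(\<lambda>n. LINT u|lborel. complex_of_real (std_normal_density u) * v (x + s n * u)) \<longlonglongrightarrow>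
        (LINT u|lborel. complex_of_real (std_normal_density u) * v x)"
    proof (rule integral_dominated_convergence[where w=std_normal_density])
      show "AE u in lborel. (\<lambda>n. complex_of_real (std_normal_density u) * v (x + s n * u)) \<longlonglongrightarrow>
          complex_of_real (std_normal_density u) * v x"
      proof (rule AE_I2)
        fix u
        have l: "(\<lambda>n. x + s n * u) \<longlonglongrightarrow> x"
          using tendsto_add[OF tendsto_const[of x] tendsto_mult[OF s0 tendsto_const[of u]]] by simp
        have "x < a \<or> (a < x \<and> x < b) \<or> b < x" using x by linarith
        then have "\<forall>\<^sub>F n in sequentially. v (x + s n * u) = v x"
        proof (elim disjE conjE)
          assume "x < a"
          then show ?thesis using order_tendstoD(2)[OF l, of a]
            by (auto elim!: eventually_mono simp: v_def)
        next
          assume "a < x" "x < b"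
          then show ?thesis using eventually_conj[OF order_tendstoD(1)[OF l, of a] order_tendstoD(2)[OF l, of b]]
            by (auto elim!: eventually_mono simp: v_def)
        next
          assume "b < x"
          then show ?thesis using order_tendstoD(1)[OF l, of b]
            by (auto elim!: eventually_mono simp: v_def)
        qed
        then show "(\<lambda>n. complex_of_real (std_normal_density u) * v (x + s n * u)) \<longlonglongrightarrow>
            complex_of_real (std_normal_density u) * v x"
          by (intro tendsto_mult tendsto_const tendsto_eventually)
      qed
      show "AE u in lborel. cmod (complex_of_real (std_normal_density u) * v (x + s n * u)) \<le> std_normal_density u" for n
        by (auto simp: norm_mult normal_density_nonneg intro!: mult_left_le nv)
    qed simp_all
    then show ?thesis by (simp add: integral_complex_of_real)
  qed
  have "(\<lambda>n. LINT x|lborel. f x * cnj (LINT u|lborel. complex_of_real (std_normal_density u) * v (x + s n * u)))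
      \<longlonglongrightarrow> (LINT x|lborel. f x * cnj (v x))"
  proof (rule integral_dominated_convergence[where w="\<lambda>x. cmod (f x)"])
    have "AE x in lborel. x \<noteq> a \<and> x \<noteq> b"
      using AE_lborel_singleton[of a] AE_lborel_singleton[of b] by eventually_elim auto
    then show "AE x in lborel. (\<lambda>n. f x * cnj (LINT u|lborel. complex_of_real (std_normal_density u) * v (x + s n * u)))
        \<longlonglongrightarrow> f x * cnj (v x)"
      by eventually_elim (intro tendsto_mult tendsto_const tendsto_cnj conv; simp)
    show "AE x in lborel. cmod (f x * cnj (LINT u|lborel. complex_of_real (std_normal_density u) * v (x + s n * u))) \<le> cmod (f x)" for n
      unfolding norm_mult complex_mod_cnj by (intro AE_I2 mult_left_le le1) auto
  qed (use f in \<open>auto intro: integrable_norm\<close>)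
  then have "(LINT \<xi>|lborel. fourier_L1 f \<xi> * cnj (fourier_L1 v \<xi>)) = (LINT x|lborel. f x * cnj (v x))"
    using lim1 unfolding smooth by (rule LIMSEQ_unique[rotated])
  moreover have "cnj (v x) = indicator {a..b} x" for x by (simp add: v_def indicator_def)
  ultimately show ?thesis unfolding v_def by simp
qed

text \<open>
  The densities \<open>max 0 w\<close> and \<open>max 0 (- w)\<close> define measures that agree on the compact intervals, which are
  stable under intersection and generate the Borel sets; so the measures are equal.
\<close>

lemma AE_zero_of_interval_integrals_real:
  fixes w :: "real \<Rightarrow> real"
  assumes w: "\<And>a b. integrable lborel (\<lambda>x. indicator {a..b} x * w x)"
    and zero: "\<And>a b. (LINT x|lborel. indicator {a..b} x * w x) = 0"
    and [measurable]: "w \<in> borel_measurable borel"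
  shows "AE x in lborel. w x = 0"
proof -
  let ?p = "\<lambda>x. ennreal (max 0 (w x))" and ?n = "\<lambda>x. ennreal (max 0 (- w x))"
  have fin: "emeasure (density lborel (\<lambda>x. ennreal (max 0 (u x)))) {a..b} = ennreal (LINT x|lborel. indicator {a..b} x * max 0 (u x))"
      "integrable lborel (\<lambda>x. indicator {a..b} x * max 0 (u x))"
    if [measurable]: "u \<in> borel_measurable borel" and u: "integrable lborel (\<lambda>x. indicator {a..b} x * u x)" for u :: "real \<Rightarrow> real" and a b
  proof -
    show i: "integrable lborel (\<lambda>x. indicator {a..b} x * max 0 (u x))"
      by (rule Bochner_Integration.integrable_bound[OF u]) (auto simp: indicator_def)
    have "emeasure (density lborel (\<lambda>x. ennreal (max 0 (u x)))) {a..b} = (\<integral>\<^sup>+ x. ennreal (indicator {a..b} x * max 0 (u x)) \<partial>lborel)"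
      by (subst emeasure_density) (auto intro!: nn_integral_cong simp: indicator_def)
    also have "\<dots> = ennreal (LINT x|lborel. indicator {a..b} x * max 0 (u x))"
      by (rule nn_integral_eq_integral[OF i]) auto
    finally show "emeasure (density lborel (\<lambda>x. ennreal (max 0 (u x)))) {a..b} = ennreal (LINT x|lborel. indicator {a..b} x * max 0 (u x))" .
  qed
  have w': "integrable lborel (\<lambda>x. indicator {a..b} x * - w x)" for a b
    using w[of a b] by simp
  have "density lborel ?p = density lborel ?n"
  proof (rule measure_eqI_generator_eq[where E="range (\<lambda>(a, b). {a..b::real})" and \<Omega>=UNIV and A="\<lambda>i. {- real i..real i}"])
    show "Int_stable (range (\<lambda>(a, b). {a..b::real}))"
      by (auto simp: Int_stable_def)
    fix X assume "X \<in> range (\<lambda>(a, b). {a..b::real})"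
    then obtain a b where X: "X = {a..b}" by auto
    have "(LINT x|lborel. indicator {a..b} x * max 0 (w x)) - (LINT x|lborel. indicator {a..b} x * max 0 (- w x)) =
        (LINT x|lborel. indicator {a..b} x * max 0 (w x) - indicator {a..b} x * max 0 (- w x))"
      using fin(2)[OF _ w[of a b]] fin(2)[OF _ w'[of a b]] by simp
    also have "\<dots> = (LINT x|lborel. indicator {a..b} x * w x)"
      by (intro Bochner_Integration.integral_cong refl) (auto simp: indicator_def max_def)
    finally have "(LINT x|lborel. indicator {a..b} x * max 0 (w x)) = (LINT x|lborel. indicator {a..b} x * max 0 (- w x))"
      using zero by simp
    then show "emeasure (density lborel ?p) X = emeasure (density lborel ?n) X"
      unfolding X using fin(1)[OF _ w[of a b]] fin(1)[OF _ w'[of a b]] by simp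
  next
    show "sets (density lborel ?p) = sigma_sets UNIV (range (\<lambda>(a, b). {a..b::real}))"
      by (simp add: borel_eq_atLeastAtMost)
    show "sets (density lborel ?n) = sigma_sets UNIV (range (\<lambda>(a, b). {a..b::real}))"
      by (simp add: borel_eq_atLeastAtMost)
    show "(\<Union>i. {- real i..real i}) = UNIV"
    proof (intro equalityI subsetI UNIV_I)
      fix x :: real
      obtain n :: nat where "\<bar>x\<bar> \<le> n" using real_arch_simple by blast
      then show "x \<in> (\<Union>i. {- real i..real i})" by (auto intro!: exI[of _ n])
    qed
    show "emeasure (density lborel ?p) {- real i..real i} \<noteq> \<infinity>" for i
      using fin(1)[OF _ w] by simp
  qed auto
  then have "AE x in lborel. ?p x = ?n x"
    by (intro sigma_finite_measure.density_unique[OF lborel.sigma_finite_measure_axioms]) auto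
  then show ?thesis by eventually_elim (auto simp: max_def split: if_splits)
qed

lemma AE_zero_of_interval_integrals:
  fixes w :: "real \<Rightarrow> complex"
  assumes w: "\<And>a b. integrable lborel (\<lambda>x. indicator {a..b} x * w x)"
    and zero: "\<And>a b. (LINT x|lborel. indicator {a..b} x * w x) = 0"
    and [measurable]: "w \<in> borel_measurable borel"
  shows "AE x in lborel. w x = 0"
proof -
  have re: "Re (indicator {a..b} x * w x) = indicator {a..b} x * Re (w x)"
    and im: "Im (indicator {a..b} x * w x) = indicator {a..b} x * Im (w x)" for a b x :: real
    by (auto simp: indicator_def)
  have "AE x in lborel. Re (w x) = 0"
  proof (rule AE_zero_of_interval_integrals_real)
    show "integrable lborel (\<lambda>x. indicator {a..b} x * Re (w x))" for a b
      using integrable_Re[OF w[of a b]] unfolding re .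
    show "(LINT x|lborel. indicator {a..b} x * Re (w x)) = 0" for a b
      using integral_Re[OF w[of a b]] unfolding re zero by simp
  qed measurable
  moreover have "AE x in lborel. Im (w x) = 0"
  proof (rule AE_zero_of_interval_integrals_real)
    show "integrable lborel (\<lambda>x. indicator {a..b} x * Im (w x))" for a b
      using integrable_Im[OF w[of a b]] unfolding im .
    show "(LINT x|lborel. indicator {a..b} x * Im (w x)) = 0" for a b
      using integral_Im[OF w[of a b]] unfolding im zero by simp
  qed measurable
  ultimately show ?thesis by eventually_elim (simp add: complex_eq_iff)
qed

lemma truncation_L2:
  fixes f :: "real \<Rightarrow> complex" and R :: real
  assumes "f \<in> L2"
  shows "integrable lborel (\<lambda>x. indicator {-R..R} x * f x)" "(\<lambda>x. indicator {-R..R} x * f x) \<in> L2"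
    "moment lborel 2 (\<lambda>x. indicator {-R..R} x * f x) \<le> moment lborel 2 f"
proof -
  have [measurable]: "f \<in> borel_measurable borel" and f: "integrable lborel (\<lambda>x. (cmod (f x))\<^sup>2)"
    using assms by (auto simp: Lp_def)
  have "integrable lborel (\<lambda>x. indicat_real {-R..R} x + (cmod (f x))\<^sup>2)"
    using f integrable_indicator_Icc[of "-R" R] by simp
  then show "integrable lborel (\<lambda>x. indicator {-R..R} x * f x)"
  proof (rule Bochner_Integration.integrable_bound)
    have "cmod (f x) \<le> 1 + (cmod (f x))\<^sup>2" for x
    proof -
      have "0 \<le> (cmod (f x) - 1 / 2)\<^sup>2 + 3 / 4" by simp
      then show ?thesis by (simp add: power2_eq_square algebra_simps)
    qed
    then show "AE x in lborel. cmod (indicator {-R..R} x * f x) \<le> norm (indicat_real {-R..R} x + (cmod (f x))\<^sup>2)"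
      by (intro AE_I2) (simp add: indicator_def)
  qed measurable
  show le: "moment lborel 2 (\<lambda>x. indicator {-R..R} x * f x) \<le> moment lborel 2 f"
    unfolding moment_2 by (intro nn_integral_mono) (auto simp: indicator_def)
  then show "(\<lambda>x. indicator {-R..R} x * f x) \<in> L2"
    using assms by (auto simp: Lp_iff_moment intro: le_less_trans)
qed

lemma tendsto_truncation_L2:
  fixes f :: "real \<Rightarrow> complex"
  assumes f: "f \<in> L2"
  shows "tendsto_Lp lborel 2 (\<lambda>R x. indicator {-R..R} x * f x) f (at_top :: real filter)"
proof -
  have [measurable]: "f \<in> borel_measurable borel" and i: "integrable lborel (\<lambda>x. (cmod (f x))\<^sup>2)"
    using assms by (auto simp: Lp_def)
  have "((\<lambda>R::real. LINT x|lborel. (cmod (indicator {-R..R} x * f x - f x))\<^sup>2) \<longlongrightarrow> (LINT x|(lborel :: real measure). 0)) at_top"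
  proof (rule integral_dominated_convergence_at_top[OF _ _ i])
    show "AE x in lborel. ((\<lambda>R::real. (cmod (indicator {-R..R} x * f x - f x))\<^sup>2) \<longlongrightarrow> 0) at_top"
    proof (rule AE_I2)
      fix x :: real
      show "((\<lambda>R::real. (cmod (indicator {-R..R} x * f x - f x))\<^sup>2) \<longlongrightarrow> 0) at_top"
      proof (rule tendsto_eventually, rule eventually_mono[OF eventually_ge_at_top[of "\<bar>x\<bar>"]])
        fix R :: real assume "\<bar>x\<bar> \<le> R"
        then have "x \<in> {-R..R}" by auto
        then show "(cmod (indicator {-R..R} x * f x - f x))\<^sup>2 = 0" by simp
      qed
    qed
    show "\<forall>\<^sub>F R in at_top. AE x in lborel. norm ((cmod (indicator {-R..R} x * f x - f x))\<^sup>2) \<le> (cmod (f x))\<^sup>2"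
      by (intro always_eventually allI AE_I2) (auto simp: indicator_def)
  qed measurable
  then have "((\<lambda>R::real. ennreal (LINT x|lborel. (cmod (indicator {-R..R} x * f x - f x))\<^sup>2)) \<longlongrightarrow> 0) at_top"
    using tendsto_ennrealI by fastforce
  moreover have "ennreal (LINT x|lborel. (cmod (indicator {-R..R} x * f x - f x))\<^sup>2) = moment lborel 2 (\<lambda>x. indicator {-R..R} x * f x - f x)" for R :: real
    unfolding moment_2
    by (rule nn_integral_eq_integral[symmetric], rule Bochner_Integration.integrable_bound[OF i])
      (auto simp: indicator_def)
  ultimately show ?thesis
    using truncation_L2(2)[OF f] f by (simp add: tendsto_Lp_iff_moment)
qed

text \<open>
  The transforms of the truncations are Cauchy since, by the Plancherel bound, they are at most as far
  apart as the truncations themselves.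
\<close>

lemma tendsto_fourier:
  assumes f: "f \<in> L2"
  shows "tendsto_Lp lborel 2 (\<lambda>R::real. fourier_L1 (\<lambda>x. indicator {-R..R} x * f x)) (fourier f) at_top"
proof -
  let ?T = "\<lambda>(R::real) x. indicator {-R..R} x * f x"
  note T = truncation_L2[OF f]
  have m: "((\<lambda>R::real. moment lborel 2 (\<lambda>x. ?T R x - f x)) \<longlongrightarrow> 0) at_top"
    using tendsto_truncation_L2[OF f] by (simp add: tendsto_Lp_iff_moment)
  have "\<exists>Y. tendsto_Lp lborel 2 (\<lambda>R. fourier_L1 (?T R)) Y at_top"
  proof (rule Lp_complete)
    show "\<forall>\<^sub>F R in at_top. fourier_L1 (?T R) \<in> L2"
      by (intro always_eventually allI fourier_L1_in_L2 T)
    fix e :: real assume "0 < e"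
    \<comment> \<open>\<open>e / 8\<close>, because the triangle inequality for second moments costs a factor \<open>2\<^sup>2\<close>.\<close>
    have ev: "\<forall>\<^sub>F R in at_top. moment lborel 2 (\<lambda>x. ?T R x - f x) < ennreal (e / 8)"
      using \<open>0 < e\<close> by (intro order_tendstoD(2)[OF m]) simp
    show "\<exists>B. (\<forall>\<^sub>F R in at_top. B R) \<and> (\<forall>R S. B R \<longrightarrow> B S \<longrightarrow>
        moment lborel 2 (\<lambda>x. fourier_L1 (?T R) x - fourier_L1 (?T S) x) \<le> ennreal e)"
    proof (intro exI conjI allI impI, rule ev)
      fix R S
      assume R: "moment lborel 2 (\<lambda>x. ?T R x - f x) < ennreal (e / 8)"
        and S: "moment lborel 2 (\<lambda>x. ?T S x - f x) < ennreal (e / 8)"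
      have meas: "(\<lambda>x. ?T R x - f x) \<in> borel_measurable lborel" for R
        using f by (auto simp: Lp_def)
      have "moment lborel 2 (\<lambda>x. fourier_L1 (?T R) x - fourier_L1 (?T S) x) =
          moment lborel 2 (fourier_L1 (\<lambda>x. ?T R x - ?T S x))"
        by (rule arg_cong[where f="moment lborel 2"], rule ext)
          (rule fourier_L1_diff[OF T(1) T(1), symmetric])
      also have "\<dots> \<le> moment lborel 2 (\<lambda>x. ?T R x - ?T S x)"
        by (intro fourier_L1_plancherel_le Bochner_Integration.integrable_diff T)
      also have "\<dots> = moment lborel 2 (\<lambda>x. (?T R x - f x) - (?T S x - f x))"
        by simp
      also have "\<dots> \<le> ennreal (2 powr 2) * (moment lborel 2 (\<lambda>x. ?T R x - f x) + moment lborel 2 (\<lambda>x. ?T S x - f x))"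
        by (rule moment_diff_le[OF meas meas]) simp
      also have "\<dots> \<le> ennreal (2 powr 2) * (ennreal (e / 8) + ennreal (e / 8))"
        using R S by (intro mult_left_mono add_mono) auto
      also have "\<dots> = ennreal e"
      proof -
        have "ennreal e = ennreal (2 powr 2 * (e / 8 + e / 8))" by simp
        also have "\<dots> = ennreal (2 powr 2) * ennreal (e / 8 + e / 8)" by (rule ennreal_mult') simp
        also have "ennreal (e / 8 + e / 8) = ennreal (e / 8) + ennreal (e / 8)"
          by (rule ennreal_plus) (use \<open>0 < e\<close> in simp_all)
        finally show ?thesis by (rule sym)
      qed
      finally show "moment lborel 2 (\<lambda>x. fourier_L1 (?T R) x - fourier_L1 (?T S) x) \<le> ennreal e" .
    qed
  qed simp_all
  then show ?thesis unfolding fourier_def by (blast intro: lim_Lp_eq)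
qed

lemma fourier_in_L2: "f \<in> L2 \<Longrightarrow> fourier f \<in> L2"
  using tendsto_fourier by (auto simp: tendsto_Lp_def)

lemma moment_fourier_le:
  assumes f: "f \<in> L2"
  shows "moment lborel 2 (fourier f) \<le> moment lborel 2 f"
proof (rule tendsto_Lp_moment_le[OF tendsto_fourier[OF f]])
  show "\<forall>\<^sub>F R in at_top. moment lborel 2 (fourier_L1 (\<lambda>x. indicator {-R..R} x * f x)) \<le> moment lborel 2 f"
    by (intro always_eventually allI order_trans[OF fourier_L1_plancherel_le] truncation_L2 f)
qed simp_all

text \<open>
  The inverse transform is \<open>H = \<surd>(2\<pi>) cnj (F (cnj G))\<close>.  By the multiplication formula, the integral of
  \<open>fourier H\<close> over an interval with indicator \<open>v\<close> is \<open>\<integral> H F v\<close>, which Parseval's identity turns into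
  \<open>\<surd>(2\<pi>) \<integral> G v\<close>.  A function is determined almost everywhere by its integrals over intervals.
\<close>

lemma fourier_inversion:
  assumes G: "integrable lborel G" "G \<in> L2"
  defines "H \<equiv> \<lambda>x. LINT \<xi>|lborel. exp (\<i> * complex_of_real (x * \<xi>)) * G \<xi>"
  shows "H \<in> L2" "AE \<xi> in lborel. fourier H \<xi> = complex_of_real (sqrt (2 * pi)) * G \<xi>"
proof -
  let ?c = "complex_of_real (sqrt (2 * pi))"
  have cG: "integrable lborel (\<lambda>x. cnj (G x))" "(\<lambda>x. cnj (G x)) \<in> L2"
    using G by (auto simp: Lp_def)
  have H_eq: "H x = ?c * cnj (fourier_L1 (\<lambda>x. cnj (G x)) x)" for x
  proof -
    have "cnj (LINT \<xi>|lborel. exp (- (\<i> * complex_of_real (\<xi> * x))) * cnj (G \<xi>)) = H x"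
      unfolding H_def Bochner_Integration.integral_cnj[symmetric]
      by (intro Bochner_Integration.integral_cong refl) (simp add: exp_cnj mult_ac)
    then show ?thesis
      unfolding fourier_L1_def complex_cnj_mult complex_cnj_complex_of_real
      by (simp only:) (simp add: mult.assoc[symmetric] flip: of_real_mult)
  qed
  have F2: "fourier_L1 (\<lambda>x. cnj (G x)) \<in> L2" by (rule fourier_L1_in_L2[OF cG])
  show H: "H \<in> L2"
    using F2 unfolding H_eq[abs_def] Lp_def by (auto simp: norm_mult power_mult_distrib)
  have G2: "(\<lambda>x. ?c * G x) \<in> L2"
    using G unfolding Lp_def by (auto simp: norm_mult power_mult_distrib)
  note u = fourier_in_L2[OF H]
  have "AE \<xi> in lborel. fourier H \<xi> - ?c * G \<xi> = 0"
  proof (rule AE_zero_of_interval_integrals)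
    let ?w = "\<lambda>\<xi>. fourier H \<xi> - ?c * G \<xi>"
    show "?w \<in> borel_measurable borel"
      using u G by (auto simp: Lp_def)
    fix a b :: real
    define v :: "real \<Rightarrow> complex" where "v = indicator {a..b}"
    have v_eq: "v = (\<lambda>x. complex_of_real (indicator {a..b} x))"
      by (auto simp: v_def indicator_def)
    have v1: "integrable lborel v" and v2: "v \<in> L2"
      unfolding v_def by (rule indicator_Icc_L1_L2)+
    have Fv: "fourier_L1 v \<in> L2" by (rule fourier_L1_in_L2[OF v1 v2])
    have iu: "integrable lborel (\<lambda>\<xi>. fourier H \<xi> * v \<xi>)" by (rule integrable_mult_L2[OF u v2])
    have iG: "integrable lborel (\<lambda>\<xi>. ?c * G \<xi> * v \<xi>)" by (rule integrable_mult_L2[OF G2 v2])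
    have eq: "indicator {a..b} x * ?w x = fourier H x * v x - ?c * G x * v x" for x
      by (simp add: v_def algebra_simps)
    show "integrable lborel (\<lambda>x. indicator {a..b} x * ?w x)"
      unfolding eq using iu iG by (rule Bochner_Integration.integrable_diff)
    have l1: "((\<lambda>R::real. LINT \<xi>|lborel. fourier_L1 (\<lambda>x. indicator {-R..R} x * H x) \<xi> * v \<xi>) \<longlongrightarrow>
        (LINT \<xi>|lborel. fourier H \<xi> * v \<xi>)) at_top"
      by (rule tendsto_Lp_2_integral_mult[OF tendsto_fourier[OF H] v2])
    have l2: "((\<lambda>R::real. LINT x|lborel. (indicator {-R..R} x * H x) * fourier_L1 v x) \<longlongrightarrow>
        (LINT x|lborel. H x * fourier_L1 v x)) at_top"
      by (rule tendsto_Lp_2_integral_mult[OF tendsto_truncation_L2[OF H] Fv])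
    have mf: "(LINT \<xi>|lborel. fourier_L1 (\<lambda>x. indicator {-R..R} x * H x) \<xi> * v \<xi>) =
        (LINT x|lborel. (indicator {-R..R} x * H x) * fourier_L1 v x)" for R :: real
      by (rule fourier_L1_multiplication_formula[OF truncation_L2(1)[OF H] v1])
    have "(LINT \<xi>|lborel. fourier H \<xi> * v \<xi>) = (LINT x|lborel. H x * fourier_L1 v x)"
      by (rule tendsto_unique[OF trivial_limit_at_top_linorder l1[unfolded mf] l2])
    also have "\<dots> = (LINT x|lborel. ?c * cnj (fourier_L1 (\<lambda>x. cnj (G x)) x * cnj (fourier_L1 v x)))"
      unfolding H_eq by (simp add: mult.assoc)
    also have "\<dots> = ?c * cnj (LINT x|lborel. fourier_L1 (\<lambda>x. cnj (G x)) x * cnj (fourier_L1 v x))"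
      unfolding Bochner_Integration.integral_cnj[symmetric] by (rule integral_mult_right_zero)
    also have "\<dots> = ?c * cnj (LINT x|lborel. cnj (G x) * v x)"
      unfolding v_def fourier_L1_parseval_interval[OF cG] ..
    also have "\<dots> = (LINT x|lborel. ?c * (G x * v x))"
      unfolding Bochner_Integration.integral_cnj[symmetric] integral_mult_right_zero
      by (simp add: v_eq)
    finally show "(LINT x|lborel. indicator {a..b} x * ?w x) = 0"
      unfolding eq Bochner_Integration.integral_diff[OF iu iG] by (simp add: mult.assoc)
  qed
  then show "AE \<xi> in lborel. fourier H \<xi> = ?c * G \<xi>" by eventually_elim simp
qed

section \<open>Frequency localised pieces\<close>

definition energy :: "(real \<Rightarrow> complex) \<Rightarrow> real" where
  "energy u = (LINT \<xi>|lborel. (cmod (u \<xi>))\<^sup>2)"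

lemma energy_nonneg [simp]: "0 \<le> energy u"
  unfolding energy_def by simp

lemma moment_2_eq_energy:
  assumes "u \<in> L2"
  shows "moment lborel 2 u = ennreal (energy u)"
  unfolding moment_2 energy_def using assms by (intro nn_integral_eq_integral) (auto simp: Lp_def)

text \<open>
  The common form of the coefficients: \<open>u\<close> is the Fourier transform of an orbital, the same after
  evolution in time, or the difference of the two.
\<close>

definition packet :: "(real \<Rightarrow> real) \<Rightarrow> (real \<Rightarrow> complex) \<Rightarrow> int \<Rightarrow> real \<Rightarrow> complex" where
  "packet \<psi> u k x =
     (LINT \<xi>|lborel. exp (\<i> * complex_of_real (x * \<xi>)) * (complex_of_real (\<psi> (\<xi> - of_int k)) * u \<xi>))"

lemma partition_bump_measurable:
  assumes "partition_bump \<psi>"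
  shows "\<psi> \<in> borel_measurable borel"
proof -
  have "\<psi> differentiable (at x)" for x
    using assms unfolding partition_bump_def by (metis funpow_0)
  then show ?thesis
    by (intro borel_measurable_continuous_onI continuous_at_imp_continuous_on ballI differentiable_imp_continuous_within)
qed

lemma partition_bump_sum_le_1:
  assumes "partition_bump \<psi>" "finite K"
  shows "(\<Sum>k\<in>K. \<psi> (\<xi> - of_int k)) \<le> 1"
proof -
  have h: "((\<lambda>k::int. \<psi> (\<xi> - of_int k)) has_sum 1) UNIV" "\<And>\<xi>. 0 \<le> \<psi> \<xi>"
    using assms(1) by (auto simp: partition_bump_def)
  show ?thesis
    by (rule finite_sum_le_has_sum[OF h(1) assms(2)]) (use h(2) in auto)
qed

lemma partition_bump_le_1:
  assumes "partition_bump \<psi>"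
  shows "\<psi> \<xi> \<le> 1"
  using partition_bump_sum_le_1[OF assms, of "{0}" \<xi>] by simp

lemma partition_bump_nonneg: "partition_bump \<psi> \<Longrightarrow> 0 \<le> \<psi> \<xi>"
  by (simp add: partition_bump_def)

lemma partition_bump_eq_indicator:
  assumes "partition_bump \<psi>"
  shows "\<psi> (\<xi> - of_int k) = indicator {of_int k - 1..of_int k + 1} \<xi> * \<psi> (\<xi> - of_int k)"
  using assms unfolding partition_bump_def by (auto simp: indicator_def)

lemma partition_bump_sum_squares_le_1:
  assumes "partition_bump \<psi>" "finite K"
  shows "(\<Sum>k\<in>K. (\<psi> (\<xi> - of_int k))\<^sup>2) \<le> 1"
proof -
  have "(\<Sum>k\<in>K. (\<psi> (\<xi> - of_int k))\<^sup>2) \<le> (\<Sum>k\<in>K. \<psi> (\<xi> - of_int k))"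
    using assms(1) by (intro sum_mono) (simp add: power2_eq_square mult_left_le partition_bump_le_1 partition_bump_nonneg)
  then show ?thesis using partition_bump_sum_le_1[OF assms] by (rule order_trans)
qed

lemma bump_mult_L2:
  assumes \<psi>: "partition_bump \<psi>" and u: "u \<in> L2"
  shows "(\<lambda>\<xi>. complex_of_real (\<psi> (\<xi> - of_int k)) * u \<xi>) \<in> L2"
    and "integrable lborel (\<lambda>\<xi>. complex_of_real (\<psi> (\<xi> - of_int k)) * u \<xi>)"
proof -
  note [measurable] = partition_bump_measurable[OF \<psi>]
  have [measurable]: "u \<in> borel_measurable borel" using u by (auto simp: Lp_def)
  have b: "\<bar>\<psi> \<eta>\<bar> \<le> 1" for \<eta>
    using partition_bump_le_1[OF \<psi>, of \<eta>] partition_bump_nonneg[OF \<psi>, of \<eta>] by simp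
  have "integrable lborel (\<lambda>\<xi>. (cmod (complex_of_real (\<psi> (\<xi> - of_int k)) * u \<xi>))\<^sup>2)"
  proof (rule Bochner_Integration.integrable_bound)
    show "integrable lborel (\<lambda>\<xi>. (cmod (u \<xi>))\<^sup>2)" using u by (simp add: Lp_def)
    show "AE \<xi> in lborel. norm ((cmod (complex_of_real (\<psi> (\<xi> - of_int k)) * u \<xi>))\<^sup>2) \<le> norm ((cmod (u \<xi>))\<^sup>2)"
      using b by (intro AE_I2) (auto simp: norm_mult intro!: power_mono mult_left_le_one_le)
  qed measurable
  then show "(\<lambda>\<xi>. complex_of_real (\<psi> (\<xi> - of_int k)) * u \<xi>) \<in> L2"
    by (simp add: Lp_def)
  show "integrable lborel (\<lambda>\<xi>. complex_of_real (\<psi> (\<xi> - of_int k)) * u \<xi>)"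
  proof (rule integrable_mult_L2[OF _ u])
    note i = integrable_indicator_Icc[of "of_int k - 1" "of_int k + 1"]
    have "(\<psi> (\<xi> - of_int k))\<^sup>2 \<le> indicat_real {of_int k - 1..of_int k + 1} \<xi>" for \<xi>
      by (subst partition_bump_eq_indicator[OF \<psi>]) (auto simp: indicator_def abs_square_le_1 b)
    then have "integrable lborel (\<lambda>\<xi>. (\<psi> (\<xi> - of_int k))\<^sup>2)"
      by (intro Bochner_Integration.integrable_bound[OF i]) auto
    then show "(\<lambda>\<xi>. complex_of_real (\<psi> (\<xi> - of_int k))) \<in> L2"
      by (simp add: Lp_def)
  qed
qed

text \<open>
  Cauchy--Schwarz on the window \<open>[k - 1, k + 1]\<close> of length 2 bounds a squared packet by
  \<open>2 \<integral> \<psi>(\<xi> - k)\<^sup>2 |u(\<xi>)|\<^sup>2 d\<xi>\<close>, and the squares of the bumps add up to at most 1.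
\<close>

lemma sum_packets_le:
  assumes \<psi>: "partition_bump \<psi>" and u: "u \<in> L2" and K: "finite K"
  shows "(\<Sum>k\<in>K. (cmod (packet \<psi> u k x))\<^sup>2) \<le> 2 * energy u"
proof -
  note [measurable] = partition_bump_measurable[OF \<psi>]
  have [measurable]: "u \<in> borel_measurable borel" using u by (auto simp: Lp_def)
  have pos: "0 \<le> \<psi> \<eta>" for \<eta> by (rule partition_bump_nonneg[OF \<psi>])
  have one: "ennreal ((cmod (packet \<psi> u k x))\<^sup>2) \<le> 2 * (\<integral>\<^sup>+ \<xi>. ennreal ((\<psi> (\<xi> - of_int k))\<^sup>2) * ennreal ((cmod (u \<xi>))\<^sup>2) \<partial>lborel)" for k
  proof -
    let ?I = "{of_int k - 1..of_int k + 1} :: real set"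
    have "ennreal (cmod (packet \<psi> u k x)) \<le>
        (\<integral>\<^sup>+ \<xi>. ennreal (cmod (exp (\<i> * complex_of_real (x * \<xi>)) * (complex_of_real (\<psi> (\<xi> - of_int k)) * u \<xi>))) \<partial>lborel)"
      unfolding packet_def
    proof (rule integral_norm_bound_ennreal)
      show "integrable lborel (\<lambda>\<xi>. exp (\<i> * complex_of_real (x * \<xi>)) * (complex_of_real (\<psi> (\<xi> - of_int k)) * u \<xi>))"
        by (rule Bochner_Integration.integrable_bound[OF bump_mult_L2(2)[OF \<psi> u, of k]]) (auto simp: norm_mult)
    qed
    also have "\<dots> = (\<integral>\<^sup>+ \<xi>. indicator ?I \<xi> * ennreal (\<psi> (\<xi> - of_int k) * cmod (u \<xi>)) \<partial>lborel)"
    proof (rule nn_integral_cong)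
      fix \<xi> :: real
      have "cmod (exp (\<i> * complex_of_real (x * \<xi>)) * (complex_of_real (\<psi> (\<xi> - of_int k)) * u \<xi>)) = \<psi> (\<xi> - of_int k) * cmod (u \<xi>)"
        using pos[of "\<xi> - of_int k"] by (simp add: norm_mult)
      also have "\<dots> = indicator ?I \<xi> * (\<psi> (\<xi> - of_int k) * cmod (u \<xi>))"
        by (subst partition_bump_eq_indicator[OF \<psi>]) simp
      finally show "ennreal (cmod (exp (\<i> * complex_of_real (x * \<xi>)) * (complex_of_real (\<psi> (\<xi> - of_int k)) * u \<xi>))) =
          indicator ?I \<xi> * ennreal (\<psi> (\<xi> - of_int k) * cmod (u \<xi>))"
        by (auto simp: indicator_def)
    qed
    finally have "(ennreal (cmod (packet \<psi> u k x)))\<^sup>2 \<le>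
        (\<integral>\<^sup>+ \<xi>. indicator ?I \<xi> * ennreal (\<psi> (\<xi> - of_int k) * cmod (u \<xi>)) \<partial>lborel)\<^sup>2"
      by (intro power_mono) auto
    also have "\<dots> \<le> (\<integral>\<^sup>+ \<xi>. (indicator ?I \<xi>)\<^sup>2 \<partial>lborel) * (\<integral>\<^sup>+ \<xi>. (ennreal (\<psi> (\<xi> - of_int k) * cmod (u \<xi>)))\<^sup>2 \<partial>lborel)"
      by (intro Cauchy_Schwarz_nn_integral) measurable
    also have "(\<integral>\<^sup>+ \<xi>. (indicator ?I \<xi>)\<^sup>2 \<partial>lborel) = (\<integral>\<^sup>+ \<xi>. indicator ?I \<xi> \<partial>lborel)"
      by (intro nn_integral_cong) (auto simp: indicator_def)
    also have "\<dots> = 2"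
      by (simp add: emeasure_lborel_Icc_eq)
    also have "(\<integral>\<^sup>+ \<xi>. (ennreal (\<psi> (\<xi> - of_int k) * cmod (u \<xi>)))\<^sup>2 \<partial>lborel) =
        (\<integral>\<^sup>+ \<xi>. ennreal ((\<psi> (\<xi> - of_int k))\<^sup>2) * ennreal ((cmod (u \<xi>))\<^sup>2) \<partial>lborel)"
      using pos by (intro nn_integral_cong) (simp add: ennreal_power power_mult_distrib ennreal_mult)
    finally show ?thesis by (simp add: ennreal_power)
  qed
  have "ennreal (\<Sum>k\<in>K. (cmod (packet \<psi> u k x))\<^sup>2) = (\<Sum>k\<in>K. ennreal ((cmod (packet \<psi> u k x))\<^sup>2))"
    by (rule sum_ennreal[symmetric]) simp
  also have "\<dots> \<le> (\<Sum>k\<in>K. 2 * (\<integral>\<^sup>+ \<xi>. ennreal ((\<psi> (\<xi> - of_int k))\<^sup>2) * ennreal ((cmod (u \<xi>))\<^sup>2) \<partial>lborel))"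
    by (intro sum_mono one)
  also have "\<dots> = 2 * (\<integral>\<^sup>+ \<xi>. (\<Sum>k\<in>K. ennreal ((\<psi> (\<xi> - of_int k))\<^sup>2) * ennreal ((cmod (u \<xi>))\<^sup>2)) \<partial>lborel)"
    by (subst nn_integral_sum) (auto simp: sum_distrib_left)
  also have "\<dots> \<le> 2 * (\<integral>\<^sup>+ \<xi>. ennreal ((cmod (u \<xi>))\<^sup>2) \<partial>lborel)"
  proof (intro mult_left_mono nn_integral_mono)
    fix \<xi>
    have "(\<Sum>k\<in>K. ennreal ((\<psi> (\<xi> - of_int k))\<^sup>2)) = ennreal (\<Sum>k\<in>K. (\<psi> (\<xi> - of_int k))\<^sup>2)"
      by (rule sum_ennreal) simp
    also have "\<dots> \<le> ennreal 1"
      by (intro ennreal_leI partition_bump_sum_squares_le_1[OF \<psi> K])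
    finally have "(\<Sum>k\<in>K. ennreal ((\<psi> (\<xi> - of_int k))\<^sup>2)) * ennreal ((cmod (u \<xi>))\<^sup>2) \<le> ennreal 1 * ennreal ((cmod (u \<xi>))\<^sup>2)"
      by (rule mult_right_mono) simp
    then show "(\<Sum>k\<in>K. ennreal ((\<psi> (\<xi> - of_int k))\<^sup>2) * ennreal ((cmod (u \<xi>))\<^sup>2)) \<le> ennreal ((cmod (u \<xi>))\<^sup>2)"
      unfolding sum_distrib_right[symmetric] by simp
  qed simp
  also have "\<dots> = 2 * ennreal (energy u)"
    using moment_2_eq_energy[OF u] by (simp add: moment_2)
  also have "\<dots> = ennreal (2 * energy u)"
    by (simp add: ennreal_mult)
  finally show ?thesis by (simp add: ennreal_le_iff)
qed

lemma packet_diff: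
  assumes "partition_bump \<psi>" "u \<in> L2" "v \<in> L2"
  shows "packet \<psi> u k x - packet \<psi> v k x = packet \<psi> (\<lambda>\<xi>. u \<xi> - v \<xi>) k x"
proof -
  have i: "integrable lborel (\<lambda>\<xi>. exp (\<i> * complex_of_real (x * \<xi>)) * (complex_of_real (\<psi> (\<xi> - of_int k)) * u \<xi>))"
    if "u \<in> L2" for u
    by (rule Bochner_Integration.integrable_bound[OF bump_mult_L2(2)[OF assms(1) that, of k]])
      (use bump_mult_L2(2)[OF assms(1) that, of k] in \<open>auto simp: norm_mult\<close>)
  show ?thesis
    unfolding packet_def Bochner_Integration.integral_diff[OF i[OF assms(2)] i[OF assms(3)], symmetric]
    by (simp add: right_diff_distrib)
qed

definition evolve :: "real \<Rightarrow> (real \<Rightarrow> complex) \<Rightarrow> real \<Rightarrow> complex" where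
  "evolve t h \<xi> = exp (\<i> * complex_of_real (t * phi \<xi>)) * h \<xi>"

lemma measurable_phi [measurable]: "phi \<in> borel_measurable borel"
  unfolding phi_def[abs_def] by measurable

lemma cmod_evolve [simp]: "cmod (evolve t h \<xi>) = cmod (h \<xi>)"
  unfolding evolve_def norm_mult norm_exp_i_times by simp

lemma evolve_in_L2:
  assumes "h \<in> L2" shows "evolve t h \<in> L2" "energy (evolve t h) = energy h"
proof -
  have [measurable]: "h \<in> borel_measurable borel" using assms by (auto simp: Lp_def)
  have "evolve t h \<in> borel_measurable borel" unfolding evolve_def[abs_def] by measurable
  then show "evolve t h \<in> L2" using assms by (simp add: Lp_def)
  show "energy (evolve t h) = energy h" by (simp add: energy_def)
qed

lemma freq_proj_eq_packet: "freq_proj \<psi> k f x = packet \<psi> (fourier f) k x"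
  unfolding freq_proj_def packet_def by (simp add: mult.assoc)

text \<open>
  The piece \<open>\<psi>(D - k) f\<close> is an inverse transform without the factor \<open>1 / \<surd>(2\<pi>)\<close>, so inversion gives its
  Fourier transform as \<open>\<surd>(2\<pi>) \<psi>(\<cdot> - k) fourier f\<close>, and this factor cancels the one in the flow.
\<close>

lemma flow_freq_proj_eq_packet:
  assumes \<psi>: "partition_bump \<psi>" and f: "f \<in> L2"
  shows "flow t (freq_proj \<psi> k f) x = packet \<psi> (evolve t (fourier f)) k x"
proof -
  note h = fourier_in_L2[OF f]
  let ?G = "\<lambda>\<xi>. complex_of_real (\<psi> (\<xi> - of_int k)) * fourier f \<xi>"
  have G: "integrable lborel ?G" "?G \<in> L2" by (rule bump_mult_L2[OF \<psi> h])+
  have F: "freq_proj \<psi> k f = (\<lambda>x. LINT \<xi>|lborel. exp (\<i> * complex_of_real (x * \<xi>)) * ?G \<xi>)"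
    by (rule ext) (simp add: freq_proj_def mult.assoc)
  have inv: "freq_proj \<psi> k f \<in> L2"
    "AE \<xi> in lborel. fourier (freq_proj \<psi> k f) \<xi> = complex_of_real (sqrt (2 * pi)) * ?G \<xi>"
    unfolding F by (rule fourier_inversion[OF G])+
  have [measurable]: "fourier (freq_proj \<psi> k f) \<in> borel_measurable borel" "?G \<in> borel_measurable borel"
    using fourier_in_L2[OF inv(1)] G by (auto simp: Lp_def)
  have "(LINT \<xi>|lborel. exp (\<i> * complex_of_real (x * \<xi>)) * exp (\<i> * complex_of_real (t * phi \<xi>)) * fourier (freq_proj \<psi> k f) \<xi>) =
      (LINT \<xi>|lborel. complex_of_real (sqrt (2 * pi)) * (exp (\<i> * complex_of_real (x * \<xi>)) * (complex_of_real (\<psi> (\<xi> - of_int k)) * evolve t (fourier f) \<xi>)))"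
  proof (rule integral_cong_AE)
    have "(\<lambda>\<xi>. complex_of_real (\<psi> (\<xi> - of_int k)) * evolve t (fourier f) \<xi>) \<in> borel_measurable borel"
      using bump_mult_L2(1)[OF \<psi> evolve_in_L2(1)[OF h]] by (auto simp: Lp_def)
    then show "(\<lambda>\<xi>. complex_of_real (sqrt (2 * pi)) * (exp (\<i> * complex_of_real (x * \<xi>)) * (complex_of_real (\<psi> (\<xi> - of_int k)) * evolve t (fourier f) \<xi>))) \<in> borel_measurable lborel"
      by (auto intro!: borel_measurable_times)
    show "AE \<xi> in lborel. exp (\<i> * complex_of_real (x * \<xi>)) * exp (\<i> * complex_of_real (t * phi \<xi>)) * fourier (freq_proj \<psi> k f) \<xi> =
        complex_of_real (sqrt (2 * pi)) * (exp (\<i> * complex_of_real (x * \<xi>)) * (complex_of_real (\<psi> (\<xi> - of_int k)) * evolve t (fourier f) \<xi>))"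
      using inv(2) by eventually_elim (simp add: evolve_def mult_ac)
  qed measurable
  then show ?thesis
    unfolding flow_def packet_def integral_mult_right_zero
    by (simp only:) (simp add: mult.assoc[symmetric] flip: of_real_mult)
qed

lemma evolve_tendsto:
  assumes h: "h \<in> L2"
  shows "((\<lambda>t. energy (\<lambda>\<xi>. h \<xi> - evolve t h \<xi>)) \<longlongrightarrow> 0) (at 0)"
  unfolding tendsto_at_iff_sequentially
proof (intro allI impI)
  fix X :: "nat \<Rightarrow> real" assume X: "X \<longlonglongrightarrow> 0"
  have [measurable]: "h \<in> borel_measurable borel" using h by (auto simp: Lp_def)
  have [measurable]: "evolve t h \<in> borel_measurable borel" for t
    using evolve_in_L2(1)[OF h, of t] by (auto simp: Lp_def)
  have "(\<lambda>n. LINT \<xi>|lborel. (cmod (h \<xi> - evolve (X n) h \<xi>))\<^sup>2) \<longlonglongrightarrow> (LINT \<xi>|(lborel::real measure). 0)"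
  proof (rule integral_dominated_convergence[where w="\<lambda>\<xi>. 4 * (cmod (h \<xi>))\<^sup>2"])
    show "integrable lborel (\<lambda>\<xi>. 4 * (cmod (h \<xi>))\<^sup>2)" using h by (simp add: Lp_def)
    show "AE \<xi> in lborel. (\<lambda>n. (cmod (h \<xi> - evolve (X n) h \<xi>))\<^sup>2) \<longlonglongrightarrow> 0"
    proof (rule AE_I2)
      fix \<xi>
      have "(\<lambda>n. (cmod (h \<xi> - evolve (X n) h \<xi>))\<^sup>2) \<longlonglongrightarrow> (cmod (h \<xi> - evolve 0 h \<xi>))\<^sup>2"
        unfolding evolve_def by (intro tendsto_intros X)
      then show "(\<lambda>n. (cmod (h \<xi> - evolve (X n) h \<xi>))\<^sup>2) \<longlonglongrightarrow> 0" by (simp add: evolve_def)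
    qed
    show "AE \<xi> in lborel. norm ((cmod (h \<xi> - evolve (X n) h \<xi>))\<^sup>2) \<le> 4 * (cmod (h \<xi>))\<^sup>2" for n
    proof (rule AE_I2)
      fix \<xi>
      have "cmod (h \<xi> - evolve (X n) h \<xi>) \<le> 2 * cmod (h \<xi>)"
        using norm_triangle_ineq4[of "h \<xi>" "evolve (X n) h \<xi>"] by simp
      then have "(cmod (h \<xi> - evolve (X n) h \<xi>))\<^sup>2 \<le> (2 * cmod (h \<xi>))\<^sup>2"
        by (intro power_mono) auto
      then show "norm ((cmod (h \<xi> - evolve (X n) h \<xi>))\<^sup>2) \<le> 4 * (cmod (h \<xi>))\<^sup>2"
        by (simp add: power_mult_distrib)
    qed
  qed measurable
  then show "((\<lambda>t. energy (\<lambda>\<xi>. h \<xi> - evolve t h \<xi>)) \<circ> X) \<longlonglongrightarrow> 0"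
    by (simp add: energy_def o_def)
qed

lemma energy_evolve_diff_le:
  assumes h: "h \<in> L2"
  shows "energy (\<lambda>\<xi>. h \<xi> - evolve t h \<xi>) \<le> 4 * energy h"
proof -
  have i: "integrable lborel (\<lambda>\<xi>. (cmod (h \<xi> - evolve t h \<xi>))\<^sup>2)"
    using Lp_diff[OF h evolve_in_L2(1)[OF h]] by (simp add: Lp_def)
  have "energy (\<lambda>\<xi>. h \<xi> - evolve t h \<xi>) \<le> (LINT \<xi>|lborel. 4 * (cmod (h \<xi>))\<^sup>2)"
    unfolding energy_def
  proof (rule integral_mono[OF i])
    show "integrable lborel (\<lambda>\<xi>. 4 * (cmod (h \<xi>))\<^sup>2)" using h by (simp add: Lp_def)
    fix \<xi>
    have "cmod (h \<xi> - evolve t h \<xi>) \<le> 2 * cmod (h \<xi>)"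
      using norm_triangle_ineq4[of "h \<xi>" "evolve t h \<xi>"] by simp
    then have "(cmod (h \<xi> - evolve t h \<xi>))\<^sup>2 \<le> (2 * cmod (h \<xi>))\<^sup>2"
      by (intro power_mono) auto
    then show "(cmod (h \<xi> - evolve t h \<xi>))\<^sup>2 \<le> 4 * (cmod (h \<xi>))\<^sup>2"
      by (simp add: power_mult_distrib)
  qed
  then show ?thesis by (simp add: energy_def)
qed

section \<open>The random density of one orbital\<close>

lemma random_series_measurable:
  assumes "prob_space M" "subgaussian_family M UNIV g c" "0 < r"
    and "\<And>K. finite K \<Longrightarrow> (\<Sum>k\<in>K. (cmod (a k))\<^sup>2) \<le> A"
  shows "random_series M r g a \<in> borel_measurable M"
  using tendsto_random_series[OF assms] by (auto simp: tendsto_Lp_def Lp_def)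

text \<open>
  From \<open>||A|\<^sup>2 - |B|\<^sup>2| \<le> |A - B| (|A| + |B|)\<close> and the Cauchy--Schwarz inequality, which doubles the exponent.
\<close>

lemma moment_density_le:
  assumes "A \<in> borel_measurable M" "B \<in> borel_measurable M" and "0 < r" "0 \<le> S" "0 \<le> d"
    and A: "moment M (2 * r) A \<le> ennreal S" and B: "moment M (2 * r) B \<le> ennreal S"
    and D: "moment M (2 * r) (\<lambda>w. A w - B w) \<le> ennreal d"
  shows "moment M r (\<lambda>w. complex_of_real ((cmod (A w))\<^sup>2 - (cmod (B w))\<^sup>2)) \<le> ennreal (sqrt (d * (2 powr (2 * r) * (S + S))))"
proof -
  note [measurable] = assms(1,2)
  let ?Y = "\<lambda>w. complex_of_real ((cmod (A w))\<^sup>2 - (cmod (B w))\<^sup>2)"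
  have pw: "ennreal (cmod (?Y w) powr r) \<le> ennreal (cmod (A w - B w) powr r) * ennreal ((cmod (A w) + cmod (B w)) powr r)" for w
  proof -
    have "(cmod (A w))\<^sup>2 - (cmod (B w))\<^sup>2 = (cmod (A w) - cmod (B w)) * (cmod (A w) + cmod (B w))"
      by (simp add: power2_eq_square algebra_simps)
    then have "cmod (?Y w) = \<bar>cmod (A w) - cmod (B w)\<bar> * (cmod (A w) + cmod (B w))"
      by (simp only: norm_of_real abs_mult) simp
    also have "\<dots> \<le> cmod (A w - B w) * (cmod (A w) + cmod (B w))"
      by (intro mult_right_mono norm_triangle_ineq3) auto
    finally have "cmod (?Y w) powr r \<le> (cmod (A w - B w) * (cmod (A w) + cmod (B w))) powr r"
      using \<open>0 < r\<close> by (intro powr_mono2) auto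
    then show ?thesis by (simp add: powr_mult ennreal_mult[symmetric])
  qed
  have "(moment M r ?Y)\<^sup>2 \<le> (\<integral>\<^sup>+ w. ennreal (cmod (A w - B w) powr r) * ennreal ((cmod (A w) + cmod (B w)) powr r) \<partial>M)\<^sup>2"
    unfolding moment_def by (intro power_mono nn_integral_mono pw) auto
  also have "\<dots> \<le> (\<integral>\<^sup>+ w. (ennreal (cmod (A w - B w) powr r))\<^sup>2 \<partial>M) * (\<integral>\<^sup>+ w. (ennreal ((cmod (A w) + cmod (B w)) powr r))\<^sup>2 \<partial>M)"
    by (intro Cauchy_Schwarz_nn_integral) measurable
  also have "(\<integral>\<^sup>+ w. (ennreal (cmod (A w - B w) powr r))\<^sup>2 \<partial>M) = moment M (2 * r) (\<lambda>w. A w - B w)"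
    unfolding moment_def by (intro nn_integral_cong) (simp add: ennreal_power powr_powr mult.commute flip: powr_numeral)
  also have "(\<integral>\<^sup>+ w. (ennreal ((cmod (A w) + cmod (B w)) powr r))\<^sup>2 \<partial>M) \<le>
      (\<integral>\<^sup>+ w. ennreal (2 powr (2 * r)) * (ennreal (cmod (A w) powr (2 * r)) + ennreal (cmod (B w) powr (2 * r))) \<partial>M)"
  proof (rule nn_integral_mono)
    fix w
    have "((cmod (A w) + cmod (B w)) powr r)\<^sup>2 = (cmod (A w) + cmod (B w)) powr (2 * r)"
      by (simp add: powr_powr mult.commute flip: powr_numeral)
    also have "\<dots> \<le> 2 powr (2 * r) * (cmod (A w) powr (2 * r) + cmod (B w) powr (2 * r))"
      using \<open>0 < r\<close> by (intro powr_add_le) auto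
    finally show "(ennreal ((cmod (A w) + cmod (B w)) powr r))\<^sup>2 \<le>
        ennreal (2 powr (2 * r)) * (ennreal (cmod (A w) powr (2 * r)) + ennreal (cmod (B w) powr (2 * r)))"
      by (simp add: ennreal_power ennreal_mult[symmetric] ennreal_plus[symmetric] del: ennreal_plus)
  qed
  also have "\<dots> = ennreal (2 powr (2 * r)) * (moment M (2 * r) A + moment M (2 * r) B)"
    unfolding moment_def by (simp add: nn_integral_cmult nn_integral_add)
  also have "moment M (2 * r) (\<lambda>w. A w - B w) * (ennreal (2 powr (2 * r)) * (moment M (2 * r) A + moment M (2 * r) B)) \<le>
      ennreal d * (ennreal (2 powr (2 * r)) * (ennreal S + ennreal S))"
    by (intro mult_mono add_mono A B D) auto
  also have "\<dots> = ennreal (d * (2 powr (2 * r) * (S + S)))"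
    using \<open>0 \<le> S\<close> \<open>0 \<le> d\<close> by (simp add: ennreal_mult[symmetric] ennreal_plus[symmetric] del: ennreal_plus)
  finally have sq: "(moment M r ?Y)\<^sup>2 \<le> ennreal (d * (2 powr (2 * r) * (S + S)))"
    by (simp add: mult_left_mono)
  have "moment M r ?Y \<noteq> \<infinity>"
  proof
    assume "moment M r ?Y = \<infinity>"
    with sq have "\<infinity> \<le> ennreal (d * (2 powr (2 * r) * (S + S)))"
      by (simp only:) (simp add: power2_eq_square ennreal_mult_top)
    then show False using ennreal_less_top leD unfolding infinity_ennreal_def by blast
  qed
  then obtain m where m: "moment M r ?Y = ennreal m" "0 \<le> m"
    by (cases "moment M r ?Y") auto
  have "m\<^sup>2 \<le> d * (2 powr (2 * r) * (S + S))"
    using sq \<open>0 \<le> S\<close> \<open>0 \<le> d\<close> unfolding m by (simp add: ennreal_power ennreal_le_iff m)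
  then have "m \<le> sqrt (d * (2 powr (2 * r) * (S + S)))"
    by (rule real_le_rsqrt)
  then show ?thesis unfolding m by (rule ennreal_leI)
qed

text \<open>
  The energy of the transform of \<open>f\<close> is at most 1, so \<open>A\<close> and \<open>B\<close> have coefficients of square sum at most
  2 and their difference has coefficients of square sum at most \<open>2 D\<close>, for all \<open>x\<close> and \<open>t\<close>.
\<close>

lemma moment_orbital_density_le:
  fixes t x :: real
  assumes P: "prob_space P" and g: "subgaussian_family P UNIV g c" and \<psi>: "partition_bump \<psi>"
    and f: "f \<in> L2" "moment lborel 2 f \<le> 1" and r: "0 < r"
  defines "h \<equiv> fourier f"
  defines "A \<equiv> randomized P r \<psi> g f x" and "B \<equiv> flow_randomized P r \<psi> g t f x"
  shows "A \<in> borel_measurable P" "B \<in> borel_measurable P"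
    and "moment P r (\<lambda>w. complex_of_real ((cmod (A w))\<^sup>2 - (cmod (B w))\<^sup>2)) \<le>
      ennreal (4 * 8 powr r * khinchine_const c (2 * r) * energy (\<lambda>\<xi>. h \<xi> - evolve t h \<xi>) powr (r / 2))"
proof -
  let ?C = "khinchine_const c (2 * r)" and ?D = "energy (\<lambda>\<xi>. h \<xi> - evolve t h \<xi>)"
  have h: "h \<in> L2" unfolding h_def by (rule fourier_in_L2[OF f(1)])
  have "moment lborel 2 h \<le> 1"
    unfolding h_def using moment_fourier_le[OF f(1)] f(2) by (rule order_trans)
  then have "ennreal (energy h) \<le> 1"
    by (simp add: moment_2_eq_energy[OF h])
  then have E: "energy h \<le> 1" by simp
  define a where "a k = packet \<psi> h k x" for k
  define b where "b k = packet \<psi> (evolve t h) k x" for k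
  have A: "A = random_series P r g a"
    unfolding A_def randomized_def a_def h_def freq_proj_eq_packet ..
  have B: "B = random_series P r g b"
    unfolding B_def flow_randomized_def b_def h_def flow_freq_proj_eq_packet[OF \<psi> f(1)] ..
  have a: "(\<Sum>k\<in>K. (cmod (a k))\<^sup>2) \<le> 2" if "finite K" for K
    unfolding a_def using sum_packets_le[OF \<psi> h that, of x] E by linarith
  have b: "(\<Sum>k\<in>K. (cmod (b k))\<^sup>2) \<le> 2" if "finite K" for K
    unfolding b_def using sum_packets_le[OF \<psi> evolve_in_L2(1)[OF h] that, of t x] E
    by (simp add: evolve_in_L2(2)[OF h])
  have ab: "(\<Sum>k\<in>K. (cmod (a k - b k))\<^sup>2) \<le> 2 * ?D" if "finite K" for K
    unfolding a_def b_def packet_diff[OF \<psi> h evolve_in_L2(1)[OF h]]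
    by (rule sum_packets_le[OF \<psi> Lp_diff[OF h evolve_in_L2(1)[OF h]] that]) simp
  have C: "0 \<le> ?C" by (rule khinchine_const_nonneg)
  show mA: "A \<in> borel_measurable P" unfolding A by (rule random_series_measurable[OF P g r a])
  show mB: "B \<in> borel_measurable P" unfolding B by (rule random_series_measurable[OF P g r b])
  have r2: "0 < 2 * r" using r by simp
  have "moment P r (\<lambda>w. complex_of_real ((cmod (A w))\<^sup>2 - (cmod (B w))\<^sup>2)) \<le>
      ennreal (sqrt (?C * (2 * ?D) powr r * (2 powr (2 * r) * (?C * 2 powr r + ?C * 2 powr r))))"
  proof (rule moment_density_le[OF mA mB r])
    show "moment P (2 * r) A \<le> ennreal (?C * 2 powr r)"
      using moment_random_series_le[OF P g r r2 a] unfolding A by simp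
    show "moment P (2 * r) B \<le> ennreal (?C * 2 powr r)"
      using moment_random_series_le[OF P g r r2 b] unfolding B by simp
    show "moment P (2 * r) (\<lambda>w. A w - B w) \<le> ennreal (?C * (2 * ?D) powr r)"
      using moment_random_series_diff_le[OF P g r r2 a b ab] unfolding A B by simp
  qed (use C in simp_all)
  also have "\<dots> \<le> ennreal (4 * 8 powr r * ?C * ?D powr (r / 2))"
  proof (rule ennreal_leI, rule real_le_lsqrt)
    have "?C * (2 * ?D) powr r * (2 powr (2 * r) * (?C * 2 powr r + ?C * 2 powr r)) =
        2 * (2 powr r * 2 powr (2 * r) * 2 powr r) * (?C\<^sup>2 * ?D powr r)"
      by (simp add: powr_mult power2_eq_square mult_ac)
    also have "2 powr r * 2 powr (2 * r) * 2 powr r = (2 powr (4 * r) :: real)"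
      by (simp add: powr_add[symmetric])
    also have "2 * 2 powr (4 * r) * (?C\<^sup>2 * ?D powr r) \<le> 16 * 2 powr (6 * r) * (?C\<^sup>2 * ?D powr r)"
      using r by (intro mult_right_mono mult_mono powr_mono) auto
    also have "\<dots> = (4 * 8 powr r * ?C * ?D powr (r / 2))\<^sup>2"
    proof -
      have "(8::real) powr r = 2 powr (3 * r)"
        by (simp add: powr_powr[symmetric])
      then have "(8 powr r)\<^sup>2 = (2::real) powr (6 * r)"
        by (simp add: power2_eq_square powr_add[symmetric])
      moreover have "(?D powr (r / 2))\<^sup>2 = ?D powr r"
        by (simp add: power2_eq_square powr_add[symmetric])
      ultimately show ?thesis by (simp add: power_mult_distrib)
    qed
    finally show "?C * (2 * ?D) powr r * (2 powr (2 * r) * (?C * 2 powr r + ?C * 2 powr r)) \<le>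
        (4 * 8 powr r * ?C * ?D powr (r / 2))\<^sup>2" .
  qed (use C in simp_all)
  finally show "moment P r (\<lambda>w. complex_of_real ((cmod (A w))\<^sup>2 - (cmod (B w))\<^sup>2)) \<le>
      ennreal (4 * 8 powr r * ?C * ?D powr (r / 2))" .
qed

section \<open>Summation over the orbitals\<close>

text \<open>
  Jensen's inequality.  The sum is first restricted to the indices with \<open>z\<^sub>j > 0\<close>, since convexity
  of the power function is used on the open half-line.  For \<open>s = 1\<close> and total weight 0 the factor
  \<open>0 powr 0 = 0\<close> does no harm, as the left-hand side vanishes as well.
\<close>

lemma weighted_power_mean:
  fixes w z :: "'i \<Rightarrow> real"
  assumes J: "finite J" and w: "\<And>j. j \<in> J \<Longrightarrow> 0 \<le> w j" and z: "\<And>j. j \<in> J \<Longrightarrow> 0 \<le> z j" and s: "1 \<le> s"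
  shows "(\<Sum>j\<in>J. w j * z j) powr s \<le> (\<Sum>j\<in>J. w j) powr (s - 1) * (\<Sum>j\<in>J. w j * z j powr s)"
proof -
  define I where "I = {j\<in>J. 0 < z j}"
  have I: "finite I" "I \<subseteq> J" using J by (auto simp: I_def)
  define W where "W = (\<Sum>j\<in>I. w j)"
  have WJ: "W \<le> (\<Sum>j\<in>J. w j)" unfolding W_def using I w J by (intro sum_mono2) auto
  have W0: "0 \<le> W" unfolding W_def using I w by (intro sum_nonneg) auto
  have e1: "(\<Sum>j\<in>J. w j * z j) = (\<Sum>j\<in>I. w j * z j)"
    using I J z by (intro sum.mono_neutral_right) (auto simp: I_def less_le)
  have e2: "(\<Sum>j\<in>J. w j * z j powr s) = (\<Sum>j\<in>I. w j * z j powr s)"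
    using I J z by (intro sum.mono_neutral_right) (auto simp: I_def less_le)
  have n2: "0 \<le> (\<Sum>j\<in>I. w j * z j powr s)" using I w by (intro sum_nonneg) auto
  show ?thesis
  proof (cases "W = 0")
    case True
    then have "\<forall>j\<in>I. w j = 0" unfolding W_def using I w by (subst (asm) sum_nonneg_eq_0_iff) auto
    then have "(\<Sum>j\<in>I. w j * z j) = 0" by simp
    then show ?thesis unfolding e1 e2 using n2 by simp
  next
    case False
    with W0 have W: "0 < W" by simp
    then have ne: "I \<noteq> {}" by (auto simp: W_def)
    have "(\<lambda>x. x powr s) (\<Sum>j\<in>I. (w j / W) *\<^sub>R z j) \<le> (\<Sum>j\<in>I. (w j / W) * (z j) powr s)"
    proof (rule convex_on_sum[OF I(1) ne powr_convex[OF s]])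
      show "(\<Sum>j\<in>I. w j / W) = 1" using W by (simp add: sum_divide_distrib[symmetric] W_def)
    qed (use I w W in \<open>auto simp: I_def\<close>)
    then have "((\<Sum>j\<in>I. w j * z j) / W) powr s \<le> (\<Sum>j\<in>I. w j * z j powr s) / W"
      by (simp add: sum_divide_distrib)
    then have "(\<Sum>j\<in>I. w j * z j) powr s \<le> W powr s * ((\<Sum>j\<in>I. w j * z j powr s) / W)"
      using W by (simp add: powr_divide sum_nonneg I(2)[THEN subsetD] w z pos_divide_le_eq mult.commute)
    also have "\<dots> = W powr (s - 1) * (\<Sum>j\<in>I. w j * z j powr s)"
      using W by (simp add: powr_diff)
    also have "\<dots> \<le> (\<Sum>j\<in>J. w j) powr (s - 1) * (\<Sum>j\<in>I. w j * z j powr s)"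
      using s W0 WJ n2 by (intro mult_right_mono powr_mono2) auto
    finally show ?thesis unfolding e1 e2 .
  qed
qed

text \<open>
  For fixed \<open>w\<close> Khinchine's inequality in the second variable bounds the inner integral by a power of
  \<open>\<Sum>\<^sub>j |\<lambda>\<^sub>j|\<^sup>2 (Y\<^sub>j w)\<^sup>2\<close>.  As \<open>r / 2 \<ge> 1\<close>, Jensen's inequality then moves the power inside the sum, where the
  moments of the single \<open>Y\<^sub>j\<close> appear after integration in \<open>w\<close>.
\<close>

lemma moment_random_sum_le:
  fixes Y :: "nat \<Rightarrow> 'a \<Rightarrow> real" and lam :: "nat \<Rightarrow> complex"
  assumes P: "prob_space P" and Q: "prob_space Q" and g: "subgaussian_family Q {1..} g c" and r: "2 \<le> r"
    and Y: "\<And>j. 1 \<le> j \<Longrightarrow> Y j \<in> borel_measurable P"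
    and y: "\<And>j. 1 \<le> j \<Longrightarrow> moment P r (\<lambda>w. complex_of_real (Y j w)) \<le> ennreal (y j)" "\<And>j. 0 \<le> y j"
    and J: "finite J" "J \<subseteq> {1..}"
  shows "moment (P \<Otimes>\<^sub>M Q) r (\<lambda>(w, w'). \<Sum>j\<in>J. lam j * complex_of_real (g j w') * complex_of_real (Y j w)) \<le>
    ennreal (khinchine_const c r * (\<Sum>j\<in>J. (cmod (lam j))\<^sup>2) powr (r / 2 - 1) * (\<Sum>j\<in>J. (cmod (lam j))\<^sup>2 * y j))"
proof -
  interpret P: prob_space P by fact
  interpret Q: prob_space Q by fact
  interpret PQ: pair_sigma_finite P Q ..
  let ?C = "khinchine_const c r" and ?W = "\<Sum>j\<in>J. (cmod (lam j))\<^sup>2"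
  have r0: "0 < r" using r by simp
  have [measurable]: "Y j \<in> borel_measurable P" if "j \<in> J" for j using Y J that by auto
  have [measurable]: "g j \<in> borel_measurable Q" if "j \<in> J" for j
    using J that by (intro subgaussian_family_measurable[OF Q g]) auto
  let ?T = "\<lambda>w w'. \<Sum>j\<in>J. lam j * complex_of_real (g j w') * complex_of_real (Y j w)"
  have "moment (P \<Otimes>\<^sub>M Q) r (\<lambda>(w, w'). ?T w w') = (\<integral>\<^sup>+ w. \<integral>\<^sup>+ w'. ennreal (cmod (?T w w') powr r) \<partial>Q \<partial>P)"
    unfolding moment_def by (subst Q.nn_integral_fst[symmetric]) (simp_all add: case_prod_beta')
  also have "\<dots> \<le> (\<integral>\<^sup>+ w. ennreal (?C * ?W powr (r / 2 - 1)) * (\<Sum>j\<in>J. ennreal ((cmod (lam j))\<^sup>2) * ennreal (\<bar>Y j w\<bar> powr r)) \<partial>P)"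
  proof (rule nn_integral_mono)
    fix w
    have sq: "((Y j w)\<^sup>2) powr (r / 2) = \<bar>Y j w\<bar> powr r" for j
    proof -
      have "((Y j w)\<^sup>2) powr (r / 2) = (\<bar>Y j w\<bar> powr 2) powr (r / 2)" by (simp add: powr_numeral)
      also have "\<dots> = \<bar>Y j w\<bar> powr r" by (simp only: powr_powr) simp
      finally show ?thesis .
    qed
    have "(\<integral>\<^sup>+ w'. ennreal (cmod (?T w w') powr r) \<partial>Q) =
        moment Q r (\<lambda>w'. \<Sum>j\<in>J. complex_of_real (g j w') * (lam j * complex_of_real (Y j w)))"
      unfolding moment_def by (simp add: mult_ac)
    also have "\<dots> \<le> ennreal (?C * (\<Sum>j\<in>J. (cmod (lam j * complex_of_real (Y j w)))\<^sup>2) powr (r / 2))"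
      by (rule khinchine[OF Q g J r0])
    also have "(\<Sum>j\<in>J. (cmod (lam j * complex_of_real (Y j w)))\<^sup>2) = (\<Sum>j\<in>J. (cmod (lam j))\<^sup>2 * (Y j w)\<^sup>2)"
      by (simp add: norm_mult power_mult_distrib)
    also have "ennreal (?C * (\<Sum>j\<in>J. (cmod (lam j))\<^sup>2 * (Y j w)\<^sup>2) powr (r / 2)) \<le>
        ennreal (?C * (?W powr (r / 2 - 1) * (\<Sum>j\<in>J. (cmod (lam j))\<^sup>2 * \<bar>Y j w\<bar> powr r)))"
      unfolding sq[symmetric] using r J(1) khinchine_const_nonneg[of c r]
      by (intro ennreal_leI mult_left_mono weighted_power_mean) auto
    also have "ennreal (?C * (?W powr (r / 2 - 1) * (\<Sum>j\<in>J. (cmod (lam j))\<^sup>2 * \<bar>Y j w\<bar> powr r))) =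
        ennreal (?C * ?W powr (r / 2 - 1)) * (\<Sum>j\<in>J. ennreal ((cmod (lam j))\<^sup>2) * ennreal (\<bar>Y j w\<bar> powr r))"
      using khinchine_const_nonneg[of c r]
      by (simp add: ennreal_mult[symmetric] sum_ennreal sum_nonneg mult.assoc)
    finally show "(\<integral>\<^sup>+ w'. ennreal (cmod (?T w w') powr r) \<partial>Q) \<le>
        ennreal (?C * ?W powr (r / 2 - 1)) * (\<Sum>j\<in>J. ennreal ((cmod (lam j))\<^sup>2) * ennreal (\<bar>Y j w\<bar> powr r))" .
  qed
  also have "\<dots> = ennreal (?C * ?W powr (r / 2 - 1)) *
      (\<Sum>j\<in>J. ennreal ((cmod (lam j))\<^sup>2) * moment P r (\<lambda>w. complex_of_real (Y j w)))"
    unfolding moment_def norm_of_real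
    by (simp add: nn_integral_cmult nn_integral_sum)
  also have "\<dots> \<le> ennreal (?C * ?W powr (r / 2 - 1)) * (\<Sum>j\<in>J. ennreal ((cmod (lam j))\<^sup>2) * ennreal (y j))"
    using J by (intro mult_left_mono sum_mono y) auto
  also have "\<dots> = ennreal (?C * ?W powr (r / 2 - 1) * (\<Sum>j\<in>J. (cmod (lam j))\<^sup>2 * y j))"
    using khinchine_const_nonneg[of c r] y(2)
    by (simp add: ennreal_mult[symmetric] sum_ennreal sum_nonneg)
  finally show ?thesis .
qed

text \<open>
  A block of the series is controlled by the weights \<open>|\<lambda>\<^sub>j|\<^sup>2\<close> in it, because the moments of all \<open>Y\<^sub>j\<close> are at
  most \<open>y0\<close>; so the series converges.  The bound for the limit keeps the individual \<open>y j\<close>, since these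
  are what becomes small with \<open>t\<close>.
\<close>

lemma tendsto_Lp_random_sum:
  fixes Y :: "nat \<Rightarrow> 'a \<Rightarrow> real" and lam :: "nat \<Rightarrow> complex" and g :: "nat \<Rightarrow> 'b \<Rightarrow> real"
  assumes P: "prob_space P" and Q: "prob_space Q" and g: "subgaussian_family Q {1..} g c" and r: "2 \<le> r"
    and Y: "\<And>j. 1 \<le> j \<Longrightarrow> Y j \<in> borel_measurable P"
    and y: "\<And>j. 1 \<le> j \<Longrightarrow> moment P r (\<lambda>w. complex_of_real (Y j w)) \<le> ennreal (y j)" "\<And>j. 0 \<le> y j" "\<And>j. y j \<le> y0"
    and lam: "summable (\<lambda>k. (cmod (lam (Suc k)))\<^sup>2)"
  defines "T \<equiv> \<lambda>(n::nat) (w, w'). \<Sum>j=1..n. lam j * complex_of_real (g j w') * complex_of_real (Y j w)"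
  defines "F \<equiv> lim_Lp (P \<Otimes>\<^sub>M Q) r sequentially T"
  shows "F \<in> Lp (P \<Otimes>\<^sub>M Q) r"
    and "moment (P \<Otimes>\<^sub>M Q) r F \<le>
      ennreal (khinchine_const c r * (\<Sum>k. (cmod (lam (Suc k)))\<^sup>2) powr (r / 2 - 1) * (\<Sum>k. (cmod (lam (Suc k)))\<^sup>2 * y (Suc k)))"
proof -
  let ?C = "khinchine_const c r" and ?w = "\<lambda>k. (cmod (lam k))\<^sup>2"
  let ?L = "\<Sum>k. ?w (Suc k)"
  have C: "0 \<le> ?C" by (rule khinchine_const_nonneg)
  have r0: "0 < r" using r by simp
  have y0: "0 \<le> y0" using y(2,3)[of 1] by linarith
  have shift: "(\<Sum>j=1..n. u j) = (\<Sum>k<n. u (Suc k))" for u :: "nat \<Rightarrow> real" and n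
    by (simp add: sum.atLeast1_atMost_eq)
  have meas: "T n \<in> borel_measurable (P \<Otimes>\<^sub>M Q)" for n
    unfolding T_def case_prod_beta'
  proof (rule borel_measurable_sum)
    fix j assume j: "j \<in> {1..n}"
    have [measurable]: "g j \<in> borel_measurable Q"
      using j by (intro subgaussian_family_measurable[OF Q g]) auto
    have [measurable]: "Y j \<in> borel_measurable P" using j by (intro Y) auto
    show "(\<lambda>p. lam j * complex_of_real (g j (snd p)) * complex_of_real (Y j (fst p))) \<in> borel_measurable (P \<Otimes>\<^sub>M Q)"
      by measurable
  qed
  have bound: "moment (P \<Otimes>\<^sub>M Q) r (T n) \<le> ennreal (?C * ?L powr (r / 2 - 1) * (\<Sum>k. ?w (Suc k) * y (Suc k)))" for n
  proof -
    have "summable (\<lambda>k. ?w (Suc k) * y0)" using lam by (rule summable_mult2)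
    then have "summable (\<lambda>k. ?w (Suc k) * y (Suc k))"
      by (rule summable_comparison_test'[where N=0]) (simp add: mult_left_mono y)
    then have "(\<Sum>j=1..n. ?w j * y j) \<le> (\<Sum>k. ?w (Suc k) * y (Suc k))"
      unfolding shift using y(2) by (intro sum_le_suminf) auto
    moreover have "(\<Sum>j=1..n. ?w j) \<le> ?L"
      unfolding shift using lam by (intro sum_le_suminf) auto
    ultimately have "?C * (\<Sum>j=1..n. ?w j) powr (r / 2 - 1) * (\<Sum>j=1..n. ?w j * y j) \<le>
        ?C * ?L powr (r / 2 - 1) * (\<Sum>k. ?w (Suc k) * y (Suc k))"
      using C r y(2) by (intro mult_mono mult_left_mono powr_mono2) (auto simp: sum_nonneg)
    moreover have "moment (P \<Otimes>\<^sub>M Q) r (T n) \<le> ennreal (?C * (\<Sum>j=1..n. ?w j) powr (r / 2 - 1) * (\<Sum>j=1..n. ?w j * y j))"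
      unfolding T_def using moment_random_sum_le[OF P Q g r Y y(1,2), where J="{1..n}" and lam=lam] by simp
    ultimately show ?thesis by (meson ennreal_leI order_trans)
  qed
  have "\<exists>Z. tendsto_Lp (P \<Otimes>\<^sub>M Q) r T Z sequentially"
  proof (rule Lp_complete[OF r0])
    show "\<forall>\<^sub>F n in sequentially. T n \<in> Lp (P \<Otimes>\<^sub>M Q) r"
      using meas le_less_trans[OF bound ennreal_less_top] by (intro always_eventually allI) (simp add: Lp_iff_moment)
    fix e :: real assume e: "0 < e"
    \<comment> \<open>A block of weight \<open>\<eta>\<close> contributes at most \<open>C y0 \<eta>\<^sup>r\<^sup>/\<^sup>2 \<le> D \<eta>\<^sup>r\<^sup>/\<^sup>2 = e\<close>.\<close>
    define D where "D = ?C * y0 + 1"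
    have D: "0 < D" "?C * y0 \<le> D" using C y0 by (auto simp: D_def add_nonneg_pos)
    define \<eta> where "\<eta> = (e / D) powr (2 / r)"
    have \<eta>: "0 < \<eta>" using e D by (simp add: \<eta>_def)
    have \<eta>_le: "D * \<eta> powr (r / 2) = e"
      using e D r0 by (simp add: \<eta>_def powr_powr)
    have "Cauchy (\<lambda>n. \<Sum>k<n. ?w (Suc k))"
      by (rule LIMSEQ_imp_Cauchy[OF summable_LIMSEQ[OF lam]])
    then obtain N where N: "\<And>m n. N \<le> m \<Longrightarrow> N \<le> n \<Longrightarrow> dist (\<Sum>k<m. ?w (Suc k)) (\<Sum>k<n. ?w (Suc k)) < \<eta>"
      using \<eta> unfolding Cauchy_def by blast
    have step: "moment (P \<Otimes>\<^sub>M Q) r (\<lambda>p. T m p - T n p) \<le> ennreal e" if "N \<le> n" "n \<le> m" for m n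
    proof -
      let ?J = "{n<..m}"
      have split: "sum u {1..m} = sum u {1..n} + sum u ?J" for u :: "nat \<Rightarrow> 'c::comm_monoid_add"
      proof -
        have J: "{1..m} = {1..n} \<union> ?J" using that by auto
        show ?thesis unfolding J by (rule sum.union_disjoint) auto
      qed
      have "(\<Sum>j\<in>?J. ?w j) = (\<Sum>k<m. ?w (Suc k)) - (\<Sum>k<n. ?w (Suc k))"
        using split[of ?w] unfolding shift by simp
      then have W: "(\<Sum>j\<in>?J. ?w j) \<le> \<eta>"
        using N[of m n] that by (auto simp: dist_real_def)
      have W0: "0 \<le> (\<Sum>j\<in>?J. ?w j)" by (simp add: sum_nonneg)
      have "(\<lambda>p. T m p - T n p) = (\<lambda>(w, w'). \<Sum>j\<in>?J. lam j * complex_of_real (g j w') * complex_of_real (Y j w))"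
        unfolding T_def split by (simp add: case_prod_beta')
      then have "moment (P \<Otimes>\<^sub>M Q) r (\<lambda>p. T m p - T n p) \<le>
          ennreal (?C * (\<Sum>j\<in>?J. ?w j) powr (r / 2 - 1) * (\<Sum>j\<in>?J. ?w j * y j))"
        using moment_random_sum_le[OF P Q g r Y y(1,2), where J="?J" and lam=lam] by fastforce
      also have "\<dots> \<le> ennreal e"
      proof (rule ennreal_leI)
        have "(\<Sum>j\<in>?J. ?w j * y j) \<le> (\<Sum>j\<in>?J. ?w j) * y0"
          unfolding sum_distrib_right by (intro sum_mono mult_left_mono y) auto
        then have "?C * (\<Sum>j\<in>?J. ?w j) powr (r / 2 - 1) * (\<Sum>j\<in>?J. ?w j * y j) \<le>
            ?C * (\<Sum>j\<in>?J. ?w j) powr (r / 2 - 1) * ((\<Sum>j\<in>?J. ?w j) * y0)"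
          using C by (intro mult_left_mono) auto
        also have "\<dots> = ?C * y0 * (\<Sum>j\<in>?J. ?w j) powr (r / 2)"
        proof (cases "(\<Sum>j\<in>?J. ?w j) = 0")
          case False
          then have "(\<Sum>j\<in>?J. ?w j) powr (r / 2) = (\<Sum>j\<in>?J. ?w j) powr (r / 2 - 1) * (\<Sum>j\<in>?J. ?w j)"
            using W0 by (simp add: powr_diff)
          then show ?thesis by simp
        qed simp
        also have "\<dots> \<le> D * \<eta> powr (r / 2)"
          using W W0 D C y0 r0 by (intro mult_mono powr_mono2) auto
        finally show "?C * (\<Sum>j\<in>?J. ?w j) powr (r / 2 - 1) * (\<Sum>j\<in>?J. ?w j * y j) \<le> e"
          unfolding \<eta>_le .
      qed
      finally show ?thesis .
    qed
    show "\<exists>B. (\<forall>\<^sub>F n in sequentially. B n) \<and> (\<forall>m n. B m \<longrightarrow> B n \<longrightarrow>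
        moment (P \<Otimes>\<^sub>M Q) r (\<lambda>p. T m p - T n p) \<le> ennreal e)"
    proof (intro exI[of _ "\<lambda>n. N \<le> n"] conjI allI impI eventually_ge_at_top)
      fix m n assume "N \<le> m" "N \<le> n"
      then show "moment (P \<Otimes>\<^sub>M Q) r (\<lambda>p. T m p - T n p) \<le> ennreal e"
        using step[of n m] step[of m n] moment_diff_commute[of "P \<Otimes>\<^sub>M Q" r "T m" "T n"]
        by (cases "n \<le> m") auto
    qed
  qed simp
  then have lim: "tendsto_Lp (P \<Otimes>\<^sub>M Q) r T F sequentially"
    unfolding F_def by (blast intro: lim_Lp_eq)
  then show "F \<in> Lp (P \<Otimes>\<^sub>M Q) r" by (simp add: tendsto_Lp_def)
  show "moment (P \<Otimes>\<^sub>M Q) r F \<le> ennreal (?C * ?L powr (r / 2 - 1) * (\<Sum>k. ?w (Suc k) * y (Suc k)))"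
    using bound by (intro tendsto_Lp_moment_le[OF lim r0 _ r0] always_eventually allI) auto
qed

text \<open>
  The bound \<open>\<Phi>\<close> does not involve \<open>x\<close>.  It tends to 0 by dominated convergence in the sum over the orbitals
  (Tannery's theorem), with dominating terms from \<open>D\<^sub>j(t) \<le> 4\<close>.  The value at \<open>t = 0\<close> is recorded because a
  punctured limit does not determine it.
\<close>

lemma density_diff_moment_tendsto:
  fixes f :: "nat \<Rightarrow> real \<Rightarrow> complex"
  assumes \<psi>: "partition_bump \<psi>" and P: "prob_space P" and Q: "prob_space Q"
    and g1: "subgaussian_family P UNIV g1 c" and g2: "subgaussian_family Q {1..} g2 c"
    and f: "\<And>j. 1 \<le> j \<Longrightarrow> f j \<in> L2" "\<And>j. 1 \<le> j \<Longrightarrow> moment lborel 2 (f j) \<le> 1"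
    and lam: "(\<lambda>j. (cmod (lam j))\<^sup>2) summable_on {1..}" and r: "2 \<le> r"
  obtains \<Phi> :: "real \<Rightarrow> real" where "(\<Phi> \<longlongrightarrow> 0) (at 0)" "\<Phi> 0 = 0"
    "\<And>t x. density_diff P Q r \<psi> g1 g2 lam f t x \<in> Lp (P \<Otimes>\<^sub>M Q) r"
    "\<And>t x. moment (P \<Otimes>\<^sub>M Q) r (density_diff P Q r \<psi> g1 g2 lam f t x) \<le> ennreal (\<Phi> t)"
proof -
  let ?C = "khinchine_const c r" and ?w = "\<lambda>k. (cmod (lam (Suc k)))\<^sup>2"
  have r0: "0 < r" using r by simp
  have "?w summable_on UNIV"
    using summable_on_reindex[of Suc UNIV "\<lambda>j. (cmod (lam j))\<^sup>2"] lam
    by (simp add: o_def image_Suc_lessThan inj_on_def Suc_le_eq flip: atLeast_Suc_greaterThan)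
      (metis One_nat_def atLeast_Suc_greaterThan greaterThan_0)
  then have w: "summable ?w" by (rule summable_on_UNIV_nonneg_real_iff[THEN iffD1, rotated]) simp
  \<comment> \<open>The index 0 does not occur in the series; the value 0 makes the bounds below hold for all \<open>j\<close>.\<close>
  define D where "D j t = (if 1 \<le> j then energy (\<lambda>\<xi>. fourier (f j) \<xi> - evolve t (fourier (f j)) \<xi>) else 0)" for j t
  define \<kappa> where "\<kappa> = 4 * 8 powr r * khinchine_const c (2 * r)"
  have \<kappa>: "0 \<le> \<kappa>" unfolding \<kappa>_def using khinchine_const_nonneg by simp
  have D0: "0 \<le> D j t" for j t by (simp add: D_def)
  have D4: "D j t \<le> 4" for j t
  proof (cases "1 \<le> j")
    case True
    have "moment lborel 2 (fourier (f j)) \<le> 1"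
      using moment_fourier_le[OF f(1)[OF True]] f(2)[OF True] by (rule order_trans)
    then have "energy (fourier (f j)) \<le> 1"
      by (simp add: moment_2_eq_energy[OF fourier_in_L2[OF f(1)[OF True]]])
    then show ?thesis
      using energy_evolve_diff_le[OF fourier_in_L2[OF f(1)[OF True]], of t] True by (simp add: D_def)
  qed (simp add: D_def)
  have Dlim: "((\<lambda>t. D (Suc k) t) \<longlongrightarrow> 0) (at 0)" for k
    unfolding D_def using evolve_tendsto[OF fourier_in_L2[OF f(1)]] by simp
  have Dzero: "D j 0 = 0" for j
    by (simp add: D_def evolve_def energy_def)
  define \<Phi> where "\<Phi> t = ?C * (\<Sum>k. ?w k) powr (r / 2 - 1) * (\<Sum>k. ?w k * (\<kappa> * D (Suc k) t powr (r / 2)))" for t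
  have le: "\<kappa> * D j t powr (r / 2) \<le> \<kappa> * 4 powr (r / 2)" for j t
    using \<kappa> D0 D4 r0 by (intro mult_left_mono powr_mono2) auto
  have "((\<lambda>t. \<Sum>k. ?w k * (\<kappa> * D (Suc k) t powr (r / 2))) \<longlongrightarrow> (\<Sum>k. 0)) (at (0::real))"
  proof (rule tannerys_theorem[where M="\<lambda>k. ?w k * (\<kappa> * 4 powr (r / 2))", THEN conjunct2, THEN conjunct2])
    fix k
    have "((\<lambda>t. ?w k * (\<kappa> * D (Suc k) t powr (r / 2))) \<longlongrightarrow> ?w k * (\<kappa> * 0 powr (r / 2))) (at 0)"
      using r0 D0 by (intro tendsto_mult tendsto_const tendsto_powr' Dlim) auto
    then show "((\<lambda>t. ?w k * (\<kappa> * D (Suc k) t powr (r / 2))) \<longlongrightarrow> 0) (at 0)" by simp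
  next
    show "\<forall>\<^sub>F (k, t) in at_top \<times>\<^sub>F at 0. norm (?w k * (\<kappa> * D (Suc k) t powr (r / 2))) \<le> ?w k * (\<kappa> * 4 powr (r / 2))"
    proof (intro always_eventually allI, clarify)
      fix k t
      have "0 \<le> ?w k * (\<kappa> * D (Suc k) t powr (r / 2))" using \<kappa> by simp
      then have "norm (?w k * (\<kappa> * D (Suc k) t powr (r / 2))) = ?w k * (\<kappa> * D (Suc k) t powr (r / 2))"
        by (simp only: real_norm_def abs_of_nonneg)
      also have "\<dots> \<le> ?w k * (\<kappa> * 4 powr (r / 2))" by (rule mult_left_mono[OF le]) simp
      finally show "norm (?w k * (\<kappa> * D (Suc k) t powr (r / 2))) \<le> ?w k * (\<kappa> * 4 powr (r / 2))" .
    qed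
  qed (use w in \<open>auto intro: summable_mult2\<close>)
  then have "(\<Phi> \<longlongrightarrow> ?C * (\<Sum>k. ?w k) powr (r / 2 - 1) * 0) (at 0)"
    unfolding \<Phi>_def by (intro tendsto_mult tendsto_const) simp
  then have \<Phi>lim: "(\<Phi> \<longlongrightarrow> 0) (at 0)" by simp
  have main: "density_diff P Q r \<psi> g1 g2 lam f t x \<in> Lp (P \<Otimes>\<^sub>M Q) r \<and>
      moment (P \<Otimes>\<^sub>M Q) r (density_diff P Q r \<psi> g1 g2 lam f t x) \<le> ennreal (\<Phi> t)" for t x
  proof -
    define Y where "Y j \<omega> = (cmod (randomized P r \<psi> g1 (f j) x \<omega>))\<^sup>2 - (cmod (flow_randomized P r \<psi> g1 t (f j) x \<omega>))\<^sup>2" for j \<omega>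
    have orb: "randomized P r \<psi> g1 (f j) x \<in> borel_measurable P" "flow_randomized P r \<psi> g1 t (f j) x \<in> borel_measurable P"
      "moment P r (\<lambda>w. complex_of_real (Y j w)) \<le> ennreal (\<kappa> * D j t powr (r / 2))" if "1 \<le> j" for j
      using moment_orbital_density_le(1)[OF P g1 \<psi> f[OF that] r0, where x=x]
        moment_orbital_density_le(2,3)[OF P g1 \<psi> f[OF that] r0, where x=x and t=t] that
      by (simp_all add: Y_def D_def \<kappa>_def)
    have Ym: "Y j \<in> borel_measurable P" if "1 \<le> j" for j
      unfolding Y_def[abs_def] using orb(1,2)[OF that] by measurable
    have dd: "density_diff P Q r \<psi> g1 g2 lam f t x = lim_Lp (P \<Otimes>\<^sub>M Q) r sequentially
        (\<lambda>(n::nat) (w, w'). \<Sum>j=1..n. lam j * complex_of_real (g2 j w') * complex_of_real (Y j w))"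
      unfolding density_diff_def Y_def ..
    show ?thesis
      unfolding dd \<Phi>_def
      using tendsto_Lp_random_sum[OF P Q g2 r Ym orb(3) _ le w] \<kappa> by auto
  qed
  show thesis
    by (rule that[of \<Phi>]) (use \<Phi>lim main r0 in \<open>auto simp: \<Phi>_def Dzero\<close>)
qed

theorem theorem1p1:
  fixes P :: "'a measure" and Q :: "'b measure"
    and \<psi> :: "real \<Rightarrow> real"
    and g1 :: "int \<Rightarrow> 'a \<Rightarrow> real" and g2 :: "nat \<Rightarrow> 'b \<Rightarrow> real" and c :: real
    and f :: "nat \<Rightarrow> real \<Rightarrow> complex" and lam :: "nat \<Rightarrow> complex"
    and \<gamma>0 :: "(real \<Rightarrow> complex) \<Rightarrow> real \<Rightarrow> complex"
  assumes "partition_bump \<psi>"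
    and "prob_space P" and "prob_space Q"
    and "c > 0"
    and "subgaussian_family P UNIV g1 c"
    and "subgaussian_family Q {1..} g2 c"
    and "\<forall>j\<ge>1. f j \<in> L2"
    and "\<forall>i\<ge>1. \<forall>j\<ge>1. inner_L2 (f i) (f j) = (if i = j then 1 else 0)"
    and "(\<lambda>j. (cmod (lam j))\<^sup>2) summable_on {1..}"
    and "is_diagonal_sum \<gamma>0 lam f"
    and "hilbert_schmidt \<gamma>0"
  shows "\<exists>C>0. \<forall>r\<ge>2.
    (\<forall>\<epsilon> M1 M2. 0 < \<epsilon> \<and> \<epsilon> \<le> 1 \<and> admissible_cutoffs \<psi> lam f \<epsilon> M1 M2 \<longrightarrow>
       (\<exists>\<delta>>0. \<delta> \<le> M2 powi (-4) * \<epsilon> ^ 6 \<and>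
          (\<forall>t x. \<bar>t\<bar> < \<delta> \<longrightarrow>
             density_diff P Q r \<psi> g1 g2 lam f t x \<in> Lp (P \<Otimes>\<^sub>M Q) r \<and>
             norm_Lp (P \<Otimes>\<^sub>M Q) r (density_diff P Q r \<psi> g1 g2 lam f t x)
               \<le> C * r powr (3/2) * \<epsilon>\<^sup>2 * (norm_HS \<gamma>0 + 1)))) \<and>
    (\<forall>\<epsilon>. 0 < \<epsilon> \<and> \<epsilon> < 1 \<longrightarrow>
       uniform_limit UNIV
         (\<lambda>t x. measure (P \<Otimes>\<^sub>M Q)
            {w \<in> space (P \<Otimes>\<^sub>M Q). cmod (density_diff P Q r \<psi> g1 g2 lam f t x w) > C * alpha1 (norm_HS \<gamma>0) \<epsilon>})
         (\<lambda>x. 0) (at 0))"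
proof -
  define N where "N = norm_HS \<gamma>0"
  have N: "0 \<le> N" unfolding N_def norm_HS_def by (simp add: infsum_nonneg)
  have f1: "moment lborel 2 (f j) \<le> 1" if "1 \<le> j" for j
  proof -
    have "complex_of_real (energy (f j)) = inner_L2 (f j) (f j)"
      unfolding energy_def inner_L2_def integral_complex_of_real[symmetric]
      by (intro Bochner_Integration.integral_cong refl) (simp only: complex_norm_square mult.commute)
    then have "energy (f j) = 1" using assms(8) that by simp
    then show ?thesis using moment_2_eq_energy[of "f j"] assms(7) that by simp
  qed
  let ?F = "\<lambda>r. density_diff P Q r \<psi> g1 g2 lam f" and ?M = "P \<Otimes>\<^sub>M Q"
  show ?thesis
  proof (rule exI[of _ "1::real"], intro conjI allI impI)
    show "(0::real) < 1" by simp
  next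
    fix r \<epsilon> M2 :: real and M1 :: nat
    assume r: "2 \<le> r" and "0 < \<epsilon> \<and> \<epsilon> \<le> 1 \<and> admissible_cutoffs \<psi> lam f \<epsilon> M1 M2"
    then have \<epsilon>: "0 < \<epsilon>" "\<epsilon> \<le> 1" and M: "admissible_cutoffs \<psi> lam f \<epsilon> M1 M2" by auto
    have r0: "0 < r" using r by simp
    obtain \<Phi> where \<Phi>: "(\<Phi> \<longlongrightarrow> 0) (at 0)" "\<Phi> 0 = 0"
      and F: "\<And>t x. ?F r t x \<in> Lp ?M r" "\<And>t x. moment ?M r (?F r t x) \<le> ennreal (\<Phi> t)"
      by (rule density_diff_moment_tendsto[where f=f and lam=lam, OF assms(1,2,3,5,6) _ f1 assms(9) r])
        (use assms(7) in auto)
    have M2: "0 < M2" using M by (simp add: admissible_cutoffs_def)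
    \<comment> \<open>The target bound; it is positive, so \<open>\<Phi>\<close> lies below its \<open>r\<close>-th power near 0.\<close>
    define b where "b = r powr (3/2) * \<epsilon>\<^sup>2 * (N + 1)"
    have b: "0 < b" using \<epsilon> N r0 by (simp add: b_def)
    have "\<forall>\<^sub>F t in at 0. \<Phi> t < b powr r"
      using b by (intro order_tendstoD(2)[OF \<Phi>(1)]) simp
    then obtain d where d: "0 < d" "\<And>t. t \<noteq> 0 \<Longrightarrow> \<bar>t\<bar> < d \<Longrightarrow> \<Phi> t < b powr r"
      by (auto simp: eventually_at dist_real_def)
    have small: "\<Phi> t < b powr r" if "\<bar>t\<bar> < d" for t
      using d(2)[of t] that b \<Phi>(2) by (cases "t = 0") auto
    show "\<exists>\<delta>>0. \<delta> \<le> M2 powi (-4) * \<epsilon> ^ 6 \<and> (\<forall>t x. \<bar>t\<bar> < \<delta> \<longrightarrow> ?F r t x \<in> Lp ?M r \<and>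
        norm_Lp ?M r (?F r t x) \<le> 1 * r powr (3/2) * \<epsilon>\<^sup>2 * (norm_HS \<gamma>0 + 1))"
    proof (intro exI[of _ "min d (M2 powi (-4) * \<epsilon> ^ 6)"] conjI allI impI F)
      show "0 < min d (M2 powi (-4) * \<epsilon> ^ 6)" using d M2 \<epsilon> by simp
      fix t x assume "\<bar>t\<bar> < min d (M2 powi (-4) * \<epsilon> ^ 6)"
      then have "\<Phi> t < b powr r" by (intro small) simp
      then have "moment ?M r (?F r t x) \<le> ennreal (b powr r)"
        by (intro order_trans[OF F(2)] ennreal_leI) simp
      then have "enn2real (moment ?M r (?F r t x)) \<le> b powr r"
        by (intro enn2real_leI) auto
      then have "enn2real (moment ?M r (?F r t x)) powr (1 / r) \<le> (b powr r) powr (1 / r)"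
        using r0 by (intro powr_mono2) auto
      then show "norm_Lp ?M r (?F r t x) \<le> 1 * r powr (3/2) * \<epsilon>\<^sup>2 * (norm_HS \<gamma>0 + 1)"
        using F(1)[of t x] r0 b by (simp add: norm_Lp_eq_moment Lp_iff_moment powr_powr b_def N_def)
    qed simp
  next
    fix r \<epsilon> :: real
    assume r: "2 \<le> r" and "0 < \<epsilon> \<and> \<epsilon> < 1"
    then have \<epsilon>: "0 < \<epsilon>" "\<epsilon> < 1" by auto
    have r0: "0 < r" using r by simp
    obtain \<Phi> where \<Phi>: "(\<Phi> \<longlongrightarrow> 0) (at 0)" "\<Phi> 0 = 0"
      and F: "\<And>t x. ?F r t x \<in> Lp ?M r" "\<And>t x. moment ?M r (?F r t x) \<le> ennreal (\<Phi> t)"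
      by (rule density_diff_moment_tendsto[where f=f and lam=lam, OF assms(1,2,3,5,6) _ f1 assms(9) r])
        (use assms(7) in auto)
    define a where "a = alpha1 N \<epsilon>"
    have a: "0 < a"
      unfolding a_def alpha1_def using N \<epsilon> by (intro mult_pos_pos) (auto simp: ln_div)
    have cheb: "measure ?M {w \<in> space ?M. cmod (?F r t x w) > a} \<le> max 0 (\<Phi> t) / a powr r" for t x
    proof -
      have [measurable]: "?F r t x \<in> borel_measurable ?M" using F(1) by (simp add: Lp_def)
      let ?u = "\<lambda>w. ennreal (cmod (?F r t x w) powr r)"
      have "emeasure ?M {w \<in> space ?M. cmod (?F r t x w) > a} \<le>
          emeasure ?M {w \<in> space ?M. 1 \<le> ennreal (1 / a powr r) * ?u w}"
      proof (rule emeasure_mono, safe)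
        fix w assume "a < cmod (?F r t x w)"
        then have "a powr r \<le> cmod (?F r t x w) powr r" using a r0 by (intro powr_mono2) auto
        then have "1 \<le> 1 / a powr r * cmod (?F r t x w) powr r" using a by (simp add: pos_le_divide_eq)
        then show "1 \<le> ennreal (1 / a powr r) * ?u w"
          by (subst ennreal_mult[symmetric]) (auto simp del: ennreal_1 simp flip: ennreal_1)
      qed measurable
      also have "\<dots> \<le> ennreal (1 / a powr r) * (\<integral>\<^sup>+ w. ?u w * indicator (space ?M) w \<partial>?M)"
        by (rule nn_integral_Markov_inequality) measurable
      also have "(\<integral>\<^sup>+ w. ?u w * indicator (space ?M) w \<partial>?M) = moment ?M r (?F r t x)"
        unfolding moment_def by (intro nn_integral_cong) simp
      also have "ennreal (1 / a powr r) * \<dots> \<le> ennreal (1 / a powr r) * ennreal (\<Phi> t)"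
        by (intro mult_left_mono F) simp
      also have "\<dots> \<le> ennreal (1 / a powr r) * ennreal (max 0 (\<Phi> t))"
        by (intro mult_left_mono ennreal_leI) auto
      also have "\<dots> = ennreal (max 0 (\<Phi> t) / a powr r)"
        by (subst ennreal_mult[symmetric]) auto
      finally show ?thesis
        unfolding measure_def by (intro enn2real_leI) auto
    qed
    have lim: "((\<lambda>t. max 0 (\<Phi> t) / a powr r) \<longlongrightarrow> 0) (at 0)"
      using tendsto_divide[OF tendsto_max[OF tendsto_const[of 0] \<Phi>(1)] tendsto_const[of "a powr r"]] a by simp
    show "uniform_limit UNIV
       (\<lambda>t x. measure ?M {w \<in> space ?M. cmod (?F r t x w) > 1 * alpha1 (norm_HS \<gamma>0) \<epsilon>}) (\<lambda>x. 0) (at 0)"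
    proof (rule uniform_limitI)
      fix e :: real assume "0 < e"
      have "\<forall>\<^sub>F t in at 0. max 0 (\<Phi> t) / a powr r < e"
        using \<open>0 < e\<close> by (rule order_tendstoD(2)[OF lim])
      then show "\<forall>\<^sub>F t in at 0. \<forall>x\<in>UNIV.
          dist (measure ?M {w \<in> space ?M. cmod (?F r t x w) > 1 * alpha1 (norm_HS \<gamma>0) \<epsilon>}) 0 < e"
        by eventually_elim (auto simp: a_def[symmetric] N_def[symmetric] intro: le_less_trans[OF cheb])
    qed
  qed
qed

end
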